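(* Let $K\ge 1$, $k=\frac{K-1}{K+1}$, and $0<p<\infty$. Suppose $f=h+\overline{g}\in \mathcal{K}_H^0$ is $K$-quasiconformal. Then for every $0<r<1$, $$M_p(r,h')\le M_p(r,H_k)\quad\text{and}\quad M_p(r,g')\le M_p(r,G_k),$$ where $$H_k(z)=\frac{1+z}{(1-z)^2(1-kz)},\qquad G_k(z)=\frac{kz(1+z)}{(1-z)^2(1-kz)}.$$
   Context: $\mathbb{D}=\{z\in\mathbb{C}:|z|<1\}$. Every complex-valued harmonic function $f$ in $\mathbb{D}$ has a unique representation $f=h+\overline{g}$ with $h,g$ analytic in $\mathbb{D}$ and $g(0)=0$. $\mathcal{S}_H$ denotes the class of sense-preserving univalent harmonic functions $f=h+\overline{g}$ in $\mathbb{D}$ with $h(0)=g(0)=0$, $h'(0)=1$; $\mathcal{S}_H^0=\{f\in\mathcal{S}_H: g'(0)=0\}$. $\mathcal{K}_H^0$ is the subclass of $\mathcal{S}_H^0$ of functions mapping $\mathbb{D}$ onto a convex domain. For $K\ge1$, a sense-preserving harmonic $f=h+\overline g$ is $K$-quasiconformal if it is a homeomorphism of $\mathbb{D}$ and its analytic dilatation $\omega=g'/h'$ satisfies $|\omega(z)|\le k=\frac{K-1}{K+1}$ for all $z\in\mathbb{D}$. For $F$ analytic in $\mathbb{D}$ and $0<p<\infty$, $M_p(r,F)=\left(\frac{1}{2\pi}\int_0^{2\pi}|F(re^{i\theta})|^p\,d\theta\right)^{1/p}$. *)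

theory Defs
  imports "HOL-Complex_Analysis.Complex_Analysis"
begin

abbreviation unit_disk :: "complex set" where
  "unit_disk \<equiv> ball 0 1"

definition harm :: "(complex \<Rightarrow> complex) \<Rightarrow> (complex \<Rightarrow> complex) \<Rightarrow> complex \<Rightarrow> complex" where
  "harm h g = (\<lambda>z. h z + cnj (g z))"

text \<open>Sense-preserving: positive Jacobian |h'|^2 - |g'|^2 > 0 in the disk.\<close>
definition sense_preserving :: "(complex \<Rightarrow> complex) \<Rightarrow> (complex \<Rightarrow> complex) \<Rightarrow> bool" where
  "sense_preserving h g \<longleftrightarrow> (\<forall>z\<in>unit_disk. norm (deriv g z) < norm (deriv h z))"

definition S_H :: "(complex \<Rightarrow> complex) \<Rightarrow> (complex \<Rightarrow> complex) \<Rightarrow> bool" where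
  "S_H h g \<longleftrightarrow> h holomorphic_on unit_disk \<and> g holomorphic_on unit_disk \<and>
     h 0 = 0 \<and> g 0 = 0 \<and> deriv h 0 = 1 \<and>
     sense_preserving h g \<and> inj_on (harm h g) unit_disk"

definition S_H0 :: "(complex \<Rightarrow> complex) \<Rightarrow> (complex \<Rightarrow> complex) \<Rightarrow> bool" where
  "S_H0 h g \<longleftrightarrow> S_H h g \<and> deriv g 0 = 0"

definition K_H0 :: "(complex \<Rightarrow> complex) \<Rightarrow> (complex \<Rightarrow> complex) \<Rightarrow> bool" where
  "K_H0 h g \<longleftrightarrow> S_H0 h g \<and> convex (harm h g ` unit_disk)"

definition qc_harmonic :: "real \<Rightarrow> (complex \<Rightarrow> complex) \<Rightarrow> (complex \<Rightarrow> complex) \<Rightarrow> bool" where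
  "qc_harmonic K h g \<longleftrightarrow> sense_preserving h g \<and>
     (\<exists>f'. homeomorphism unit_disk (harm h g ` unit_disk) (harm h g) f') \<and>
     (\<forall>z\<in>unit_disk. norm (deriv g z / deriv h z) \<le> (K - 1) / (K + 1))"

definition Mp :: "real \<Rightarrow> real \<Rightarrow> (complex \<Rightarrow> complex) \<Rightarrow> real" where
  "Mp p r F = ((1 / (2 * pi)) *
      (LINT t:{0..2*pi}|lborel. norm (F (complex_of_real r * cis t)) powr p)) powr (1 / p)"

definition H_ext :: "real \<Rightarrow> complex \<Rightarrow> complex" where
  "H_ext k z = (1 + z) / ((1 - z)^2 * (1 - complex_of_real k * z))"

definition G_ext :: "real \<Rightarrow> complex \<Rightarrow> complex" where
  "G_ext k z = complex_of_real k * z * (1 + z) / ((1 - z)^2 * (1 - complex_of_real k * z))"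

end

theory Submission
  imports Defs
begin

text \<open>
  Let \<open>f\<close> be the convex harmonic map with parts \<open>h\<close> and \<open>g\<close>. The key fact, due to Clunie and
  Sheil-Small, is the existence of unimodular \<open>c, a\<close> such that
  \<open>(c h'(z) - cnj c g'(z)) (a - cnj a z\<^sup>2)\<close> has nonnegative imaginary part in the disc. If the image
  of \<open>f\<close> is bounded, a length-area argument extends \<open>f\<close> continuously to the closed disc. Half-planes
  cut the convex image in connected sets, so \<open>Im (c f)\<close> has no alternating quadruple of boundary
  values and is monotone on both arcs between a maximum point and a minimum point. By connectedness of
  the circle of directions these two points can be made antipodal, \<open>a\<close> and \<open>-a\<close>, for some \<open>c\<close>. The
  hyperbolic flow of the disc towards \<open>a\<close> then increases \<open>Im (c f)\<close> on the circle, hence in the disc,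
  and the derivative of the flow at time zero is the claim. Unbounded images are exhausted by
  \<open>f(D) \<inter> ball 0 n\<close>; the Riemann maps of the preimages converge to a rotation.

  Consequently \<open>\<bar>h'\<bar> = \<bar>1 + \<epsilon> \<phi>\<bar> / (\<bar>1 - \<phi>\<bar> \<bar>1 - cnj a\<^sup>2 z\<^sup>2\<bar> \<bar>1 - k \<psi>\<bar>)\<close> with Schwarz functions \<open>\<phi>, \<psi>\<close>.
  By Littlewood subordination the logarithm of each factor is majorized by that of the corresponding
  factor of \<open>H_k\<close>, whose values on a circle are symmetrically decreasing in the angle. Such
  majorizations can be added, and they pass to integrals of \<open>exp (p \<cdot>)\<close> by a layer-cake formula.
  The bound for \<open>g'\<close> follows from \<open>\<bar>g'\<bar> \<le> k \<bar>z\<bar> \<bar>h'\<bar>\<close>.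
\<close>


section \<open>Subordination and circular means\<close>

text \<open>The factors of \<open>deriv h\<close> are subordinate to those of \<open>H_ext\<close>
  through unrelated Schwarz functions, so Littlewood's theorem cannot be applied to their product.
  What survives is that all majorants peak at the same point of the circle and decrease away from
  it: arcs centred there are extremal for every factor at once, hence also for the sum of the
  logarithms. The unknown unimodular constants \<open>a\<close>, \<open>c\<close> and \<epsilon>
  leave no trace in the bound because they are absorbed in the Schwarz functions.

  The direction \<open>c\<close> is useful because Im (c f) is the imaginary part of the analytic
  function \<open>c * h - cnj c * g\<close>, so an inequality between boundary values passes to the
  interior by a minimum principle. This presupposes boundary values, and k < 1 provides them: the
  Jacobian is at least (1 - k^2) |h'|^2, so the area of a bounded image controls the lengths of the
  images of crosscuts.\<close>

lemma poisson_formula: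
  fixes F :: "complex \<Rightarrow> complex" and r :: real and w :: complex
  assumes cont: "continuous_on (cball 0 r) F" and hol: "F holomorphic_on ball 0 r"
    and w: "norm w < r"
  shows "((\<lambda>t. F (r * cis t) * of_real (Re ((r * cis t + w) / (r * cis t - w))))
           has_integral 2 * pi * F w) {0..2*pi}"
proof -
  have r: "r > 0" using w norm_ge_zero[of w] by linarith
  \<comment> \<open>The second term is holomorphic and vanishes at \<open>w\<close>, so Cauchy's
    formula still returns \<open>F w\<close>; on the circle, where r^2 = z * cnj z, it turns the
    Cauchy kernel into the real Poisson kernel.\<close>
  define \<Phi> where "\<Phi> z = F z * (1 + cnj w * (z - w) / (of_real (r\<^sup>2) - cnj w * z))" for z
  have nz: "of_real (r\<^sup>2) - cnj w * z \<noteq> 0" if "norm z \<le> r" for z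
  proof
    assume "of_real (r\<^sup>2) - cnj w * z = 0"
    hence "norm (of_real (r\<^sup>2) :: complex) = norm w * norm z"
      by (metis complex_mod_cnj eq_iff_diff_eq_0 norm_mult)
    hence "r\<^sup>2 = norm w * norm z" by (simp only: norm_of_real) simp
    also have "\<dots> \<le> norm w * r" using that by (simp add: mult_left_mono)
    also have "\<dots> < r\<^sup>2" using w r by (simp add: power2_eq_square)
    finally show False by simp
  qed
  have "continuous_on (cball 0 r) \<Phi>"
    unfolding \<Phi>_def using nz by (intro continuous_intros cont) auto
  moreover have "\<Phi> holomorphic_on ball 0 r"
    unfolding \<Phi>_def using nz by (intro holomorphic_intros hol) (auto simp: less_imp_le)
  ultimately have "((\<lambda>u. \<Phi> u / (u - w)) has_contour_integral 2 * of_real pi * \<i> * \<Phi> w) (circlepath 0 r)"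
    using w by (intro Cauchy_integral_circlepath) auto
  hence "((\<lambda>t. \<Phi> (of_real r * cis t) / (of_real r * cis t - w) * of_real r * \<i> * cis t)
     has_integral 2 * of_real pi * \<i> * \<Phi> w) {0..2*pi}"
    unfolding circlepath_def by (subst (asm) has_contour_integral_part_circlepath_iff) auto
  from has_integral_mult_right[OF this, of "-\<i>"]
  have I: "((\<lambda>t. -\<i> * (\<Phi> (of_real r * cis t) / (of_real r * cis t - w) * of_real r * \<i> * cis t))
     has_integral -\<i> * (2 * of_real pi * \<i> * \<Phi> w)) {0..2*pi}" .
  have v: "-\<i> * (2 * of_real pi * \<i> * \<Phi> w) = 2 * pi * F w"
    by (simp add: \<Phi>_def)
  have e:  "-\<i> * (\<Phi> (of_real r * cis t) / (of_real r * cis t - w) * of_real r * \<i> * cis t)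
      = F (r * cis t) * of_real (Re ((r * cis t + w) / (r * cis t - w)))" for t
  proof -
    define z where "z = of_real r * cis t"
    have nzr: "norm z = r" using r by (simp add: z_def norm_mult)
    have zz: "z * cnj z = of_real (r\<^sup>2)" using nzr by (metis complex_norm_square of_real_power)
    have z0: "z \<noteq> 0" using nzr r by auto
    have zw: "z - w \<noteq> 0" using nzr w by auto
    hence zw': "cnj z - cnj w \<noteq> 0" by (metis complex_cnj_cancel_iff complex_cnj_diff complex_cnj_zero)
    have e1: "of_real (r\<^sup>2) - cnj w * z = z * (cnj z - cnj w)"
      unfolding zz[symmetric] by (simp add: algebra_simps)
    have "of_real (Re ((z + w) / (z - w))) = ((z + w) / (z - w) + (cnj z + cnj w) / (cnj z - cnj w)) / 2"
      by (subst complex_add_cnj[symmetric, of "(z + w) / (z - w)", THEN arg_cong[of _ _ "\<lambda>x. x/2"], simplified, symmetric]) simp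
    also have "\<dots> = z * ((1 + cnj w * (z - w) / (z * (cnj z - cnj w))) / (z - w))"
      using z0 zw zw' by (simp add: divide_simps) (simp add: algebra_simps)
    finally have k: "of_real (Re ((z + w) / (z - w))) = z * ((1 + cnj w * (z - w) / (z * (cnj z - cnj w))) / (z - w))" .
    have "-\<i> * (A / d * of_real r * \<i> * cis t) = A * z / d" for A d
      unfolding z_def by (cases "d = 0") (simp_all add: field_simps)
    thus ?thesis
      unfolding \<Phi>_def z_def[symmetric] e1 k by (simp add: mult_ac)
  qed
  show ?thesis by (rule has_integral_eq_rhs[OF has_integral_eq[OF _ I] v[symmetric]]) (rule e)
qed

lemma mean_value_circle:
  fixes F :: "complex \<Rightarrow> complex" and r :: real
  assumes "continuous_on (cball 0 r) F" "F holomorphic_on ball 0 r" "r > 0"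
  shows "((\<lambda>t. F (complex_of_real r * cis t)) has_integral 2 * pi * F 0) {0..2*pi}"
  using poisson_formula[OF assms(1,2), of 0] assms(3) by simp

lemma poisson_kernel_pos:
  fixes z w :: complex
  assumes "norm w < norm z"
  shows "Re ((z + w) / (z - w)) > 0"
proof -
  have "Re ((z + w) / (z - w)) = Re ((z + w) * cnj (z - w)) / (norm (z - w))\<^sup>2"
    by (simp add: Re_divide cmod_power2 field_simps)
  also have "Re ((z + w) * cnj (z - w)) = (norm z)\<^sup>2 - (norm w)\<^sup>2"
    unfolding cmod_power2 by (simp add: algebra_simps power2_eq_square)
  also have "\<dots> / (norm (z - w))\<^sup>2 > 0"
    using assms by (intro divide_pos_pos) (auto simp: power_strict_mono)
  finally show ?thesis .
qed

text \<open>The positive part of Re L - \<tau> is subharmonic, so at \<phi> z it is at most its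
  Poisson integral over the circle of radius \<open>r\<close>. As a function of \<open>z\<close> the
  kernel is harmonic and equals 1 at the origin, since \<phi> fixes 0; averaging over
  \<open>z\<close> and exchanging the integrals therefore removes it. Strictness keeps \<phi> z off
  the circle, where the kernel is singular.\<close>

lemma littlewood_subordination_strict:
  fixes L \<phi> :: "complex \<Rightarrow> complex" and r \<tau> :: real
  assumes L: "L holomorphic_on ball 0 1" and \<phi>: "\<phi> holomorphic_on ball 0 1" "\<phi> 0 = 0"
    and small: "\<And>z. norm z \<le> r \<Longrightarrow> norm (\<phi> z) < r" and r: "0 < r" "r < 1"
  shows "integral {0..2*pi} (\<lambda>t. max (Re (L (\<phi> (r * cis t))) - \<tau>) 0)
       \<le> integral {0..2*pi} (\<lambda>t. max (Re (L (r * cis t)) - \<tau>) 0)"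
proof -
  define \<psi> where "\<psi> s = max (Re (L (r * cis s)) - \<tau>) 0" for s
  define P where "P t s = Re ((r * cis s + \<phi> (r * cis t)) / (r * cis s - \<phi> (r * cis t)))" for t s
  have sub: "cball 0 r \<subseteq> ball 0 (1::real)" "cball (0::complex) r \<subseteq> ball 0 1" using r by auto
  have cL: "continuous_on (ball 0 1) L" "continuous_on (ball 0 1) \<phi>"
    using L \<phi> holomorphic_on_imp_continuous_on by auto
  have nr: "norm (of_real r * cis t) = r" for t using r by (simp add: norm_mult)
  have sm: "norm (\<phi> (r * cis t)) < r" for t using small nr by simp
  have c\<psi>: "continuous_on A \<psi>" for A
    unfolding \<psi>_def by (intro continuous_intros continuous_on_compose2[OF cL(1)]) (auto simp: nr r)
  have ne: "complex_of_real r * cis s - \<phi> (r * cis t) \<noteq> 0" for s t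
  proof
    assume "complex_of_real r * cis s - \<phi> (r * cis t) = 0"
    hence "norm (of_real r * cis s) = norm (\<phi> (r * cis t))" by simp
    thus False using sm[of t] nr[of s] by simp
  qed
  have cP: "continuous_on A (\<lambda>(t,s). P t s)" for A
    unfolding P_def case_prod_unfold
    using ne by (intro continuous_intros continuous_on_compose2[OF cL(2)]) (auto simp: nr r)
  have cPs: "continuous_on A (\<lambda>s. P t s)" for A t
    unfolding P_def using ne by (intro continuous_intros) auto
  have Ppos: "P t s \<ge> 0" for t s
    unfolding P_def using poisson_kernel_pos[of "\<phi> (r * cis t)" "r * cis s"] sm[of t] nr[of s] by simp
  have key: "max (Re (L (\<phi> (r * cis t))) - \<tau>) 0 \<le> integral {0..2*pi} (\<lambda>s. P t s * \<psi> s) / (2*pi)" for t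
  proof -
    have "((\<lambda>s. L (r * cis s) * of_real (P t s)) has_integral 2 * pi * L (\<phi> (r * cis t))) {0..2*pi}"
      unfolding P_def using sm L
      by (intro poisson_formula holomorphic_on_subset[OF L] continuous_on_subset[OF cL(1)] sub) (use r in auto)
    hence "((\<lambda>s. Re (L (r * cis s) * of_real (P t s))) has_integral Re (2 * pi * L (\<phi> (r * cis t)))) {0..2*pi}"
      by (rule has_integral_Re)
    moreover have "((\<lambda>s. 1 * of_real (P t s)) has_integral 2 * pi * (1::complex)) {0..2*pi}"
      unfolding P_def using sm by (intro poisson_formula[of r "\<lambda>_. 1"]) (auto)
    hence "((\<lambda>s. Re (of_real (P t s))) has_integral Re (2 * pi * (1::complex))) {0..2*pi}"
      by (intro has_integral_Re) simp
    from has_integral_mult_right[OF this, of \<tau>]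
    have "((\<lambda>s. \<tau> * P t s) has_integral \<tau> * (2 * pi)) {0..2*pi}" by simp
    ultimately have A: "((\<lambda>s. Re (L (r * cis s) * of_real (P t s)) - \<tau> * P t s) has_integral
        Re (2 * pi * L (\<phi> (r * cis t))) - \<tau> * (2 * pi)) {0..2*pi}"
      by (rule has_integral_diff)
    have B: "((\<lambda>s. P t s * \<psi> s) has_integral integral {0..2*pi} (\<lambda>s. P t s * \<psi> s)) {0..2*pi}"
      by (intro integrable_integral integrable_continuous_interval continuous_intros cPs c\<psi>)
    have "Re (2 * pi * L (\<phi> (r * cis t))) - \<tau> * (2 * pi) \<le> integral {0..2*pi} (\<lambda>s. P t s * \<psi> s)"
    proof (rule has_integral_le[OF A B])
      fix s
      have "Re (L (r * cis s) * of_real (P t s)) - \<tau> * P t s = P t s * (Re (L (r * cis s)) - \<tau>)"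
        by (simp add: algebra_simps)
      also have "\<dots> \<le> P t s * \<psi> s" using Ppos by (intro mult_left_mono) (auto simp: \<psi>_def)
      finally show "Re (L (r * cis s) * of_real (P t s)) - \<tau> * P t s \<le> P t s * \<psi> s" .
    qed
    moreover have "Re (2 * pi * L (\<phi> (r * cis t))) = 2 * pi * Re (L (\<phi> (r * cis t)))" by simp
    moreover have "integral {0..2*pi} (\<lambda>s. P t s * \<psi> s) \<ge> 0"
      using Ppos by (intro integral_nonneg integrable_continuous_interval continuous_intros cPs c\<psi>)
        (auto simp: \<psi>_def)
    ultimately show ?thesis
      by (auto simp: field_simps)
  qed
  have mass: "integral {0..2*pi} (\<lambda>t. P t s) = 2 * pi" for s
  proof -
    define Q where "Q z = (r * cis s + \<phi> z) / (r * cis s - \<phi> z)" for z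
    have ne': "complex_of_real r * cis s - \<phi> z \<noteq> 0" if "norm z \<le> r" for z
      using small[OF that] nr[of s] by auto
    have "((\<lambda>t. Q (r * cis t)) has_integral 2 * pi * Q 0) {0..2*pi}"
    proof (rule mean_value_circle)
      show "continuous_on (cball 0 r) Q" unfolding Q_def
        using ne' by (intro continuous_intros continuous_on_subset[OF cL(2)] sub) auto
      show "Q holomorphic_on ball 0 r" unfolding Q_def
        using ne' r by (intro holomorphic_intros holomorphic_on_subset[OF \<phi>(1)]) (auto simp: less_imp_le)
    qed (use r in auto)
    hence "((\<lambda>t. Re (Q (r * cis t))) has_integral Re (2 * pi * Q 0)) {0..2*pi}" by (rule has_integral_Re)
    moreover have "Q 0 = 1" using \<phi>(2) r by (simp add: Q_def)
    ultimately show ?thesis unfolding P_def Q_def by (auto dest: integral_unique)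
  qed
  have cPsi: "continuous_on A (\<lambda>(t,s). P t s * \<psi> s)" for A
    unfolding case_prod_unfold
    by (intro continuous_intros cP[unfolded case_prod_unfold] continuous_on_compose2[OF c\<psi>[of UNIV]]) auto
  have "integral {0..2*pi} (\<lambda>t. max (Re (L (\<phi> (r * cis t))) - \<tau>) 0)
      \<le> integral {0..2*pi} (\<lambda>t. integral {0..2*pi} (\<lambda>s. P t s * \<psi> s) / (2*pi))"
  proof (rule integral_le)
    show "(\<lambda>t. max (Re (L (\<phi> (r * cis t))) - \<tau>) 0) integrable_on {0..2*pi}"
      by (intro integrable_continuous_interval continuous_intros continuous_on_compose2[OF cL(1)]
            continuous_on_compose2[OF cL(2)]) (use less_trans[OF sm r(2)] r nr in auto)
    show "(\<lambda>t. integral {0..2*pi} (\<lambda>s. P t s * \<psi> s) / (2*pi)) integrable_on {0..2*pi}"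
      using integral_continuous_on_param[of "{0..2*pi}" 0 "2*pi" "\<lambda>t s. P t s * \<psi> s"] cPsi
      by (intro integrable_continuous_interval continuous_intros) auto
  qed (use key in auto)
  also have "\<dots> = integral {0..2*pi} (\<lambda>t. integral {0..2*pi} (\<lambda>s. P t s * \<psi> s)) / (2*pi)"
    by simp
  also have "integral {0..2*pi} (\<lambda>t. integral {0..2*pi} (\<lambda>s. P t s * \<psi> s))
     = integral {0..2*pi} (\<lambda>s. integral {0..2*pi} (\<lambda>t. P t s * \<psi> s))"
    using integral_swap_continuous[of 0 0 "2*pi" "2*pi" "\<lambda>t s. P t s * \<psi> s", OF cPsi]
    by simp
  also have "\<dots> = integral {0..2*pi} (\<lambda>s. 2 * pi * \<psi> s)"
    by (simp add: mass)
  also have "\<dots> / (2*pi) = integral {0..2*pi} \<psi>" by simp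
  finally show ?thesis unfolding \<psi>_def .
qed

text \<open>The weak bound is the one that survives limits and quotients such as the dilatation
  divided by \<open>k\<close>. The strict form of Schwarz's lemma applies to q * \<phi>, and
  \<open>q\<close> tends to 1.\<close>

lemma Schwarz_bound:
  fixes \<phi> :: "complex \<Rightarrow> complex"
  assumes \<phi>: "\<phi> holomorphic_on ball 0 1" "\<phi> 0 = 0" and le: "\<And>z. norm z < 1 \<Longrightarrow> norm (\<phi> z) \<le> 1"
    and z: "norm z < 1"
  shows "norm (\<phi> z) \<le> norm z"
proof -
  have *: "q * norm (\<phi> z) \<le> norm z" if q: "0 < q" "q < 1" for q :: real
  proof -
    have "norm (of_real q * \<phi> z) \<le> norm z"
    proof (rule Schwarz_Lemma(1)[of "\<lambda>z. of_real q * \<phi> z"])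
      show "(\<lambda>z. of_real q * \<phi> z) holomorphic_on ball 0 1" by (intro holomorphic_intros \<phi>)
      fix w :: complex assume "norm w < 1"
      hence "q * norm (\<phi> w) \<le> q * 1" using le q by (intro mult_left_mono) auto
      also have "q * 1 < 1" using q by simp
      finally show "norm (of_real q * \<phi> w) < 1" using q by (simp add: norm_mult)
    qed (use \<phi> z in auto)
    thus ?thesis using q by (simp add: norm_mult)
  qed
  have "((\<lambda>q. q * norm (\<phi> z)) \<longlongrightarrow> 1 * norm (\<phi> z)) (at_left 1)"
    by (intro tendsto_intros)
  moreover have "eventually (\<lambda>q. q * norm (\<phi> z) \<le> norm z) (at_left (1::real))"
    unfolding eventually_at_left_field using * by (intro exI[of _ 0]) auto
  ultimately show ?thesis by (simp add: tendsto_upperbound)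
qed

text \<open>Now \<phi> may reach the circle of radius \<open>r\<close>. The shrunk function q *
  \<phi> does not, and the integral depends continuously on \<open>q\<close> up to q = 1.\<close>

lemma littlewood_subordination:
  fixes L \<phi> :: "complex \<Rightarrow> complex" and r \<tau> :: real
  assumes L: "L holomorphic_on ball 0 1" and \<phi>: "\<phi> holomorphic_on ball 0 1" "\<phi> 0 = 0"
    and le: "\<And>z. norm z < 1 \<Longrightarrow> norm (\<phi> z) \<le> 1" and r: "0 < r" "r < 1"
  shows "integral {0..2*pi} (\<lambda>t. max (Re (L (\<phi> (r * cis t))) - \<tau>) 0)
       \<le> integral {0..2*pi} (\<lambda>t. max (Re (L (r * cis t)) - \<tau>) 0)"
proof -
  note S = Schwarz_bound[OF \<phi> le]
  define I where "I q = integral {0..2*pi} (\<lambda>t. max (Re (L (of_real q * \<phi> (r * cis t))) - \<tau>) 0)" for q :: real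
  have cL: "continuous_on (ball 0 1) L" "continuous_on (ball 0 1) \<phi>"
    using L \<phi> holomorphic_on_imp_continuous_on by auto
  have nr: "norm (of_real r * cis t) = r" for t using r by (simp add: norm_mult)
  have b: "norm (of_real q * \<phi> (r * cis t)) < 1" if "q \<in> {0..1}" for q t
  proof -
    have "q * norm (\<phi> (r * cis t)) \<le> 1 * r" using that S[of "r * cis t"] nr[of t] r by (intro mult_mono) auto
    thus ?thesis using that r by (simp add: norm_mult)
  qed
  have cI: "continuous_on {0..1} I"
    unfolding I_def
    using integral_continuous_on_param[of "{0..1}" 0 "2*pi" "\<lambda>q t. max (Re (L (of_real q * \<phi> (r * cis t))) - \<tau>) 0"]
    unfolding case_prod_unfold cbox_interval
    by (rule meta_mp) (intro continuous_intros continuous_on_compose2[OF cL(1)]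
          continuous_on_compose2[OF cL(2)], use b nr r in auto)
  have "I q \<le> integral {0..2*pi} (\<lambda>t. max (Re (L (r * cis t)) - \<tau>) 0)" if q: "0 < q" "q < 1" for q
    unfolding I_def
  proof (rule littlewood_subordination_strict[OF L])
    show "(\<lambda>z. of_real q * \<phi> z) holomorphic_on ball 0 1" by (intro holomorphic_intros \<phi>)
    fix z :: complex assume "norm z \<le> r"
    hence "q * norm (\<phi> z) \<le> q * r" using S[of z] r q by (intro mult_left_mono) auto
    also have "q * r < r" using q r by simp
    finally show "norm (of_real q * \<phi> z) < r" using q by (simp add: norm_mult)
  qed (use \<phi> r in auto)
  hence "eventually (\<lambda>q. I q \<le> integral {0..2*pi} (\<lambda>t. max (Re (L (r * cis t)) - \<tau>) 0)) (at_left 1)"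
    unfolding eventually_at_left_field by (intro exI[of _ 0]) auto
  moreover have "(I \<longlongrightarrow> I 1) (at_left 1)"
    using cI by (simp add: continuous_on_Icc_at_leftD)
  ultimately have "I 1 \<le> integral {0..2*pi} (\<lambda>t. max (Re (L (r * cis t)) - \<tau>) 0)"
    by (intro tendsto_upperbound) auto
  thus ?thesis by (simp add: I_def)
qed

section \<open>Majorization by symmetrically decreasing functions\<close>

text \<open>Majorizations do not add up in general. Here they do, since all majorants decrease with
  the distance to one centre \<open>c\<close>: the intervals about \<open>c\<close> are
  simultaneously the best sets of their length for every \<open>V j\<close>.\<close>

lemma sum_superlevel_integral_le:
  fixes u V :: "'j \<Rightarrow> real \<Rightarrow> real" and c R \<tau> :: real
  assumes R: "R \<ge> 0"
    and cu: "\<And>j. j \<in> J \<Longrightarrow> continuous_on {c-R..c+R} (u j)"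
    and cV: "\<And>j. j \<in> J \<Longrightarrow> continuous_on {0..R} (V j)"
    and anti: "\<And>j x y. j \<in> J \<Longrightarrow> 0 \<le> x \<Longrightarrow> x \<le> y \<Longrightarrow> y \<le> R \<Longrightarrow> V j y \<le> V j x"
    and maj: "\<And>j \<tau>. j \<in> J \<Longrightarrow> integral {c-R..c+R} (\<lambda>t. max (u j t - \<tau>) 0)
                 \<le> integral {c-R..c+R} (\<lambda>t. max (V j \<bar>t - c\<bar> - \<tau>) 0)"
  shows "integral {c-R..c+R} (\<lambda>t. max ((\<Sum>j\<in>J. u j t) - \<tau>) 0)
           \<le> integral {c-R..c+R} (\<lambda>t. max ((\<Sum>j\<in>J. V j \<bar>t - c\<bar>) - \<tau>) 0)"
proof -
  define I where "I = {c-R..c+R}"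
  define S where "S t = (\<Sum>j\<in>J. u j t)" for t
  define E where "E = {t\<in>I. S t > \<tau>}"
  \<comment> \<open>Testing each majorization at the level \<open>V j m\<close> turns it into a comparison of the integral over \<open>E\<close>
      with the integral over the centred interval of the same length.\<close>
  define m where "m = measure lebesgue E / 2"
  define A where "A = {c-m..c+m}"
  have cS: "continuous_on I S" unfolding S_def I_def by (intro continuous_intros cu)
  have cW: "continuous_on I (\<lambda>t. V j \<bar>t - c\<bar>)" if "j \<in> J" for j
    unfolding I_def by (rule continuous_on_compose2[OF cV[OF that]]) (auto intro!: continuous_intros)
  have "openin (top_of_set I) (I \<inter> S -` {\<tau><..})"
    using cS by (intro continuous_openin_preimage_gen) auto
  moreover have "I \<inter> S -` {\<tau><..} = E" by (auto simp: E_def)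
  ultimately obtain T where T: "open T" "E = I \<inter> T" by (auto simp: openin_open)
  have Em: "E \<in> lmeasurable" unfolding T(2) using T(1)
    by (intro fmeasurable_Int_fmeasurable) (auto simp: I_def)
  have EI: "E \<subseteq> I" by (auto simp: E_def)
  have m0: "m \<ge> 0" by (simp add: m_def)
  have "measure lebesgue E \<le> measure lebesgue I"
    by (rule measure_mono_fmeasurable[OF EI]) (use Em in \<open>auto simp: I_def\<close>)
  hence mR: "m \<le> R" using R by (simp add: m_def I_def)
  have AI: "A \<subseteq> I" using mR by (auto simp: A_def I_def)
  have intE: "f integrable_on E" if "continuous_on I f" for f :: "real \<Rightarrow> real"
  proof -
    have "f absolutely_integrable_on I" using that unfolding I_def by (rule absolutely_integrable_continuous_real)
    hence "f absolutely_integrable_on E" by (rule set_integrable_subset[OF _ fmeasurableD[OF Em] EI])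
    thus ?thesis by (simp add: absolutely_integrable_on_def)
  qed
  have intI: "f integrable_on I" if "continuous_on I f" for f :: "real \<Rightarrow> real"
    using that unfolding I_def by (rule integrable_continuous_interval)
  have intA: "f integrable_on A" if "continuous_on I f" for f :: "real \<Rightarrow> real"
    using continuous_on_subset[OF that AI] unfolding A_def by (rule integrable_continuous_interval)
  have constE: "integral E (\<lambda>t. q) = q * (2 * m)" for q :: real
    using lmeasure_integral[OF Em] integral_mult_right[of E q "\<lambda>_. 1"] by (simp add: m_def)
  have constA: "integral A (\<lambda>t. q) = q * (2 * m)" for q :: real
    using m0 by (simp add: A_def)
  have uj: "integral E (\<lambda>t. u j t - V j m) \<le> integral A (\<lambda>t. V j \<bar>t - c\<bar> - V j m)" if j: "j \<in> J" for j
  proof -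
    have cuj: "continuous_on I (u j)" using cu[OF j] by (simp add: I_def)
    have "integral E (\<lambda>t. u j t - V j m) \<le> integral E (\<lambda>t. max (u j t - V j m) 0)"
      by (intro integral_le intE continuous_intros cuj) auto
    also have "\<dots> \<le> integral I (\<lambda>t. max (u j t - V j m) 0)"
      by (intro integral_subset_le EI intE intI continuous_intros cuj) auto
    also have "\<dots> \<le> integral I (\<lambda>t. max (V j \<bar>t - c\<bar> - V j m) 0)"
      using maj[OF j] by (simp add: I_def)
    \<comment> \<open>By monotonicity \<open>V j\<close> is at least \<open>V j m\<close> on
      \<open>A\<close> and at most \<open>V j m\<close> off \<open>A\<close>, so taking the positive
      part amounts to restricting to \<open>A\<close>.\<close>
    also have "\<dots> = integral I (\<lambda>t. if t \<in> A then V j \<bar>t - c\<bar> - V j m else 0)"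
    proof (rule integral_cong)
      fix t assume t: "t \<in> I"
      show "max (V j \<bar>t - c\<bar> - V j m) 0 = (if t \<in> A then V j \<bar>t - c\<bar> - V j m else 0)"
      proof (cases "t \<in> A")
        case True
        hence "V j m \<le> V j \<bar>t - c\<bar>" using mR by (intro anti[OF j]) (auto simp: A_def)
        thus ?thesis using True by simp
      next
        case False
        hence "V j \<bar>t - c\<bar> \<le> V j m" using t m0 by (intro anti[OF j]) (auto simp: A_def I_def abs_if)
        thus ?thesis using False by simp
      qed
    qed
    also have "\<dots> = integral A (\<lambda>t. V j \<bar>t - c\<bar> - V j m)"
      using AI by (subst integral_restrict_Int) (simp add: Int_absorb2 Int_commute)
    finally show ?thesis .
  qed
  have "integral I (\<lambda>t. max (S t - \<tau>) 0) = integral I (\<lambda>t. if t \<in> E then S t - \<tau> else 0)"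
    by (rule integral_cong) (auto simp: E_def)
  also have "\<dots> = integral E (\<lambda>t. S t - \<tau>)"
    using EI by (subst integral_restrict_Int) (simp add: Int_absorb2 Int_commute)
  also have "\<dots> = integral E (\<lambda>t. (\<Sum>j\<in>J. u j t - V j m) + ((\<Sum>j\<in>J. V j m) - \<tau>))"
    by (simp add: S_def sum_subtractf)
  also have "\<dots> = integral E (\<lambda>t. \<Sum>j\<in>J. u j t - V j m) + integral E (\<lambda>t. (\<Sum>j\<in>J. V j m) - \<tau>)"
    by (intro integral_add intE continuous_intros) (use cu in \<open>auto simp: I_def\<close>)
  also have "integral E (\<lambda>t. \<Sum>j\<in>J. u j t - V j m) = (\<Sum>j\<in>J. integral E (\<lambda>t. u j t - V j m))"
    by (cases "finite J", intro integral_sum intE continuous_intros) (use cu in \<open>auto simp: I_def\<close>)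
  also have "\<dots> \<le> (\<Sum>j\<in>J. integral A (\<lambda>t. V j \<bar>t - c\<bar> - V j m))"
    by (intro sum_mono uj)
  also have "\<dots> = integral A (\<lambda>t. \<Sum>j\<in>J. V j \<bar>t - c\<bar> - V j m)"
    by (cases "finite J", intro integral_sum[symmetric] intA continuous_intros cW) auto
  \<comment> \<open>\<open>E\<close> and \<open>A\<close> have the same measure 2 * m, so the
    constant that restores the level \<tau> has the same integral over both.\<close>
  also have "integral E (\<lambda>t. (\<Sum>j\<in>J. V j m) - \<tau>) = integral A (\<lambda>t. (\<Sum>j\<in>J. V j m) - \<tau>)"
    by (simp only: constE constA)
  also have "integral A (\<lambda>t. \<Sum>j\<in>J. V j \<bar>t - c\<bar> - V j m) + integral A (\<lambda>t. (\<Sum>j\<in>J. V j m) - \<tau>)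
     = integral A (\<lambda>t. (\<Sum>j\<in>J. V j \<bar>t - c\<bar> - V j m) + ((\<Sum>j\<in>J. V j m) - \<tau>))"
    by (intro integral_add[symmetric] intA continuous_intros cW)
  also have "\<dots> = integral A (\<lambda>t. (\<Sum>j\<in>J. V j \<bar>t - c\<bar>) - \<tau>)"
    by (simp add: sum_subtractf)
  also have "\<dots> \<le> integral A (\<lambda>t. max ((\<Sum>j\<in>J. V j \<bar>t - c\<bar>) - \<tau>) 0)"
    by (intro integral_le intA continuous_intros cW) auto
  also have "\<dots> \<le> integral I (\<lambda>t. max ((\<Sum>j\<in>J. V j \<bar>t - c\<bar>) - \<tau>) 0)"
    by (intro integral_subset_le AI intA intI continuous_intros cW) auto
  finally show ?thesis by (simp add: I_def S_def)
qed

text \<open>Taylor's formula at \<open>B\<close> with integral remainder, the positive part making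
  the upper limit independent of \<open>x\<close>. For p >= 0 it expresses the exponential by a
  constant and a nonnegative combination of the test functions of majorization.\<close>

lemma exp_layer_cake:
  fixes p x A B :: real
  assumes x: "B \<le> x" "x \<le> A"
  shows "exp (p * x) = exp (p * B) + p * exp (p * B) * max (x - B) 0
           + integral {B..A} (\<lambda>t. p\<^sup>2 * exp (p * t) * max (x - t) 0)"
proof -
  have c: "(\<lambda>t. p\<^sup>2 * exp (p * t) * max (x - t) 0) integrable_on {B..A}"
    by (intro integrable_continuous_interval continuous_intros)
  have "((\<lambda>t. p\<^sup>2 * exp (p * t) * (x - t)) has_integral
     (p * exp (p * x) * (x - x) + exp (p * x)) - (p * exp (p * B) * (x - B) + exp (p * B))) {B..x}"
    by (rule fundamental_theorem_of_calculus[OF x(1)])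
       (auto intro!: derivative_eq_intros simp: has_real_derivative_iff_has_vector_derivative[symmetric]
             power2_eq_square algebra_simps)
  hence "((\<lambda>t. p\<^sup>2 * exp (p * t) * max (x - t) 0) has_integral
     (p * exp (p * x) * (x - x) + exp (p * x)) - (p * exp (p * B) * (x - B) + exp (p * B))) {B..x}"
    by (rule has_integral_eq[rotated]) auto
  moreover have "((\<lambda>t. p\<^sup>2 * exp (p * t) * max (x - t) 0) has_integral 0) {x..A}"
    by (rule has_integral_is_0) auto
  ultimately have "integral {B..A} (\<lambda>t. p\<^sup>2 * exp (p * t) * max (x - t) 0) =
     (p * exp (p * x) * (x - x) + exp (p * x)) - (p * exp (p * B) * (x - B) + exp (p * B)) + 0"
    using x by (intro integral_unique has_integral_combine[of B x A])
  thus ?thesis using x by simp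
qed

text \<open>After integrating the layer-cake formula and exchanging the integrals, the hypothesis
  applies under nonnegative weights. A common range {-M..M} for \<open>S\<close> and
  \<open>U\<close> makes the constant terms equal.\<close>

lemma integral_exp_mono_superlevel:
  fixes S U :: "real \<Rightarrow> real" and p a b :: real
  assumes S: "continuous_on {a..b} S" and U: "continuous_on {a..b} U" and p: "p \<ge> 0"
    and le: "\<And>\<tau>. integral {a..b} (\<lambda>t. max (S t - \<tau>) 0) \<le> integral {a..b} (\<lambda>t. max (U t - \<tau>) 0)"
  shows "integral {a..b} (\<lambda>t. exp (p * S t)) \<le> integral {a..b} (\<lambda>t. exp (p * U t))"
proof -
  have "bounded (S ` {a..b} \<union> U ` {a..b})"
    using S U by (intro bounded_Un[THEN iffD2] conjI compact_imp_bounded compact_continuous_image) auto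
  then obtain M where M: "\<And>x. x \<in> S ` {a..b} \<union> U ` {a..b} \<Longrightarrow> \<bar>x\<bar> \<le> M"
    unfolding bounded_iff by auto
  have rep: "integral {a..b} (\<lambda>t. exp (p * X t)) = integral {a..b} (\<lambda>t. exp (p * (-M)))
     + p * exp (p * (-M)) * integral {a..b} (\<lambda>t. max (X t - (-M)) 0)
     + integral {-M..M} (\<lambda>\<tau>. p\<^sup>2 * exp (p * \<tau>) * integral {a..b} (\<lambda>t. max (X t - \<tau>) 0))"
    if X: "continuous_on {a..b} X" and XM: "X ` {a..b} \<subseteq> {-M..M}" for X
  proof -
    have c2: "continuous_on (cbox (a,-M) (b,M)) (\<lambda>(t,\<tau>). p\<^sup>2 * exp (p * \<tau>) * max (X t - \<tau>) 0)"
      unfolding case_prod_unfold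
      by (intro continuous_intros continuous_on_compose2[OF X]) (auto simp: cbox_Pair_eq)
    have c1: "continuous_on {a..b} (\<lambda>t. integral {-M..M} (\<lambda>\<tau>. p\<^sup>2 * exp (p * \<tau>) * max (X t - \<tau>) 0))"
      using integral_continuous_on_param[of "{a..b}" "-M" M "\<lambda>t \<tau>. p\<^sup>2 * exp (p * \<tau>) * max (X t - \<tau>) 0"] c2
      by (simp add: cbox_Pair_eq)
    have "integral {a..b} (\<lambda>t. exp (p * X t)) = integral {a..b} (\<lambda>t. exp (p * (-M)) + p * exp (p * (-M)) * max (X t - (-M)) 0
           + integral {-M..M} (\<lambda>\<tau>. p\<^sup>2 * exp (p * \<tau>) * max (X t - \<tau>) 0))"
      using XM by (intro integral_cong exp_layer_cake) (auto simp: image_subset_iff)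
    also have "\<dots> = integral {a..b} (\<lambda>t. exp (p * (-M)) + p * exp (p * (-M)) * max (X t - (-M)) 0)
          + integral {a..b} (\<lambda>t. integral {-M..M} (\<lambda>\<tau>. p\<^sup>2 * exp (p * \<tau>) * max (X t - \<tau>) 0))"
      by (intro integral_add integrable_continuous_interval continuous_intros X c1)
    also have "integral {a..b} (\<lambda>t. exp (p * (-M)) + p * exp (p * (-M)) * max (X t - (-M)) 0)
         = integral {a..b} (\<lambda>t. exp (p * (-M))) + integral {a..b} (\<lambda>t. p * exp (p * (-M)) * max (X t - (-M)) 0)"
      by (intro integral_add integrable_continuous_interval continuous_intros X)
    also have "integral {a..b} (\<lambda>t. p * exp (p * (-M)) * max (X t - (-M)) 0) =
        p * exp (p * (-M)) * integral {a..b} (\<lambda>t. max (X t - (-M)) 0)" by simp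
    also have "integral {a..b} (\<lambda>t. integral {-M..M} (\<lambda>\<tau>. p\<^sup>2 * exp (p * \<tau>) * max (X t - \<tau>) 0))
       = integral {-M..M} (\<lambda>\<tau>. integral {a..b} (\<lambda>t. p\<^sup>2 * exp (p * \<tau>) * max (X t - \<tau>) 0))"
      using integral_swap_continuous[OF c2] by simp
    finally show ?thesis by simp
  qed
  have c: "continuous_on {-M..M} (\<lambda>\<tau>. integral {a..b} (\<lambda>t. max (X t - \<tau>) 0))"
    if X: "continuous_on {a..b} X" for X
    using integral_continuous_on_param[of "{-M..M}" a b "\<lambda>\<tau> t. max (X t - \<tau>) 0"]
    unfolding case_prod_unfold cbox_interval
    by (rule meta_mp) (intro continuous_intros continuous_on_compose2[OF X], auto)
  have "\<bar>S t\<bar> \<le> M" "\<bar>U t\<bar> \<le> M" if "t \<in> {a..b}" for t using M that by auto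
  hence bd: "S ` {a..b} \<subseteq> {-M..M}" "U ` {a..b} \<subseteq> {-M..M}"
    unfolding image_subset_iff atLeastAtMost_iff by (simp_all add: abs_le_iff minus_le_iff)
  show ?thesis
    unfolding rep[OF S bd(1)] rep[OF U bd(2)]
  proof (rule add_mono[OF add_mono[OF order_refl]])
    show "p * exp (p * - M) * integral {a..b} (\<lambda>t. max (S t - - M) 0)
            \<le> p * exp (p * - M) * integral {a..b} (\<lambda>t. max (U t - - M) 0)"
      by (rule mult_left_mono[OF le]) (use p in simp)
    have *: "(\<lambda>\<tau>. p\<^sup>2 * exp (p * \<tau>) * integral {a..b} (\<lambda>t. max (X t - \<tau>) 0)) integrable_on {-M..M}"
      if "continuous_on {a..b} X" for X
      by (intro integrable_continuous_interval continuous_intros c that)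
    show "integral {-M..M} (\<lambda>\<tau>. p\<^sup>2 * exp (p * \<tau>) * integral {a..b} (\<lambda>t. max (S t - \<tau>) 0))
            \<le> integral {-M..M} (\<lambda>\<tau>. p\<^sup>2 * exp (p * \<tau>) * integral {a..b} (\<lambda>t. max (U t - \<tau>) 0))"
      by (rule integral_le[OF *[OF S] *[OF U]]) (rule mult_left_mono[OF le], simp)
  qed
qed

section \<open>Boundary continuity of bounded convex harmonic quasiconformal maps\<close>

lemma has_derivative_harm:
  assumes "(H has_field_derivative a) (at w)" "(G has_field_derivative b) (at w)"
  shows "(harm H G has_derivative (\<lambda>x. a * x + cnj (b * x))) (at w)"
  unfolding harm_def
  by (intro has_derivative_add has_derivative_cnj) (use assms in \<open>simp_all add: has_field_derivative_def\<close>)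

section \<open>The length-area estimate\<close>

text \<open>The measure of a differentiable image is computed in \<open>real^2\<close>, iterated
  integrals live on \<open>real \<times> real\<close>; this carries Fubini's theorem from one to the
  other.\<close>

lemma integral_vector2_continuous:
  fixes f :: "real^2 \<Rightarrow> real"
  assumes f: "continuous_on (cbox (vector [x0,y0]) (vector [x1,y1])) f"
  shows "integral (cbox (vector [x0,y0]) (vector [x1,y1])) f
           = integral {x0..x1} (\<lambda>x. integral {y0..y1} (\<lambda>y. f (vector [x,y])))"
proof -
  define pr :: "real \<times> real \<Rightarrow> real^2" where "pr z = vector [fst z, snd z]" for z
  define prj :: "real^2 \<Rightarrow> real \<times> real" where "prj v = (vec_nth v 1, vec_nth v 2)" for v
  have inv: "prj (pr z) = z" "pr (prj v) = v" for z v
    by (auto simp: prj_def pr_def vec_eq_iff forall_2)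
  have blp: "bounded_linear pr"
    by (rule linear_conv_bounded_linear[THEN iffD1])
       (auto intro!: linearI simp: pr_def vec_eq_iff forall_2)
  have prbox: "pr ` cbox (a,c) (b,d) = cbox (vector [a,c]) (vector [b,d])" for a b c d
  proof (intro set_eqI iffI)
    fix v assume v: "v \<in> cbox (vector [a,c]) (vector [b,d] :: real^2)"
    hence "prj v \<in> cbox (a,c) (b,d)" by (auto simp: mem_box_cart forall_2 prj_def cbox_Pair_eq)
    thus "v \<in> pr ` cbox (a,c) (b,d)" using inv by (metis image_eqI)
  qed (auto simp: mem_box_cart forall_2 pr_def cbox_Pair_eq)
  have pibox: "prj ` cbox u v = cbox (prj u) (prj v)" for u v
  proof -
    have "u = vector [fst (prj u), snd (prj u)]" "v = vector [fst (prj v), snd (prj v)]"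
      by (auto simp: prj_def vec_eq_iff forall_2)
    hence "cbox u v = pr ` cbox (prj u) (prj v)" using prbox[of "fst (prj u)" "snd (prj u)" "fst (prj v)" "snd (prj v)"]
      by simp
    thus ?thesis by (simp add: image_image inv)
  qed
  have cont: "measure lborel (pr ` cbox u v) = 1 * measure lborel (cbox u v)" for u v
  proof -
    obtain a c b d where uv: "u = (a,c)" "v = (b,d)" by (cases u, cases v)
    have "measure lborel (cbox (vector [a,c]) (vector [b,d] :: real^2)) = measure lborel (cbox a b) * measure lborel (cbox c d)"
    proof (cases "a \<le> b \<and> c \<le> d")
      case True
      hence "cbox (vector [a,c]) (vector [b,d] :: real^2) \<noteq> {}"
        by (simp add: interval_ne_empty_cart forall_2)
      from content_cbox_cart[OF this] show ?thesis using True by (simp add: UNIV_2)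
    next
      case False
      hence "cbox (vector [a,c]) (vector [b,d] :: real^2) = {}"
        using interval_ne_empty_cart(1)[of "vector [a,c]" "vector [b,d] :: real^2"] by (auto simp: forall_2)
      thus ?thesis using False by (auto simp: not_le)
    qed
    thus ?thesis unfolding uv prbox by (simp add: content_Pair)
  qed
  have "(f has_integral integral (cbox (vector [x0,y0]) (vector [x1,y1])) f) (cbox (vector [x0,y0]) (vector [x1,y1]))"
    by (intro integrable_integral integrable_continuous f)
  moreover have "\<exists>w z. pr ` cbox u v = cbox w z" for u v
    using prbox[of "fst u" "snd u" "fst v" "snd v"] by auto
  moreover have "\<exists>w z. prj ` cbox u v = cbox w z" for u v using pibox by blast
  ultimately
  have "((\<lambda>z. f (pr z)) has_integral integral (cbox (vector [x0,y0]) (vector [x1,y1])) f)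
     (prj ` cbox (vector [x0,y0]) (vector [x1,y1]))"
    using has_integral_twiddle[of 1, OF _ inv _ _ _ cont, of f] linear_continuous_at[OF blp] by auto
  moreover have "prj ` cbox (vector [x0,y0]) (vector [x1,y1]) = cbox (x0,y0) (x1,y1)"
    unfolding pibox by (simp add: prj_def)
  ultimately have "integral (cbox (x0,y0) (x1,y1)) (\<lambda>z. f (pr z)) = integral (cbox (vector [x0,y0]) (vector [x1,y1])) f"
    by (simp add: integral_unique)
  moreover have "continuous_on (cbox (x0,y0) (x1,y1)) (\<lambda>z. f (pr z))"
    by (rule continuous_on_compose2[OF f linear_continuous_on[OF blp]]) (simp add: prbox)
  ultimately show ?thesis
    by (subst (asm) integral_prod_continuous) (auto simp: pr_def)
qed

text \<open>By injectivity the integral of the Jacobian |H'|^2 - |G'|^2 is the area of the image,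
  which lies in a square of side 2 * M; the dilatation bound compares the Jacobian with
  |H'|^2.\<close>

lemma harm_area_le:
  fixes H G :: "complex \<Rightarrow> complex" and x0 x1 y0 y1 M k :: real
  assumes S: "open S" "H holomorphic_on S" "G holomorphic_on S" "inj_on (harm H G) S"
    and bnd: "\<And>z. z \<in> S \<Longrightarrow> norm (harm H G z) \<le> M"
    and dil: "\<And>z. z \<in> S \<Longrightarrow> norm (deriv G z) \<le> k * norm (deriv H z)" and k: "0 \<le> k" "k < 1"
    and rect: "\<And>x y. x \<in> {x0..x1} \<Longrightarrow> y \<in> {y0..y1} \<Longrightarrow> Complex x y \<in> S"
  shows "(1 - k\<^sup>2) * integral {x0..x1} (\<lambda>x. integral {y0..y1} (\<lambda>y. (norm (deriv H (Complex x y)))\<^sup>2)) \<le> (2 * M)\<^sup>2"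
proof -
  define toC :: "real^2 \<Rightarrow> complex" where "toC v = Complex (vec_nth v 1) (vec_nth v 2)" for v
  define ofC :: "complex \<Rightarrow> real^2" where "ofC z = vector [Re z, Im z]" for z
  define f where "f = harm H G"
  define F where "F v = ofC (f (toC v))" for v
  define F' where "F' v x = ofC (deriv H (toC v) * toC x + cnj (deriv G (toC v) * toC x))" for v x
  define R where "R = cbox (vector [x0,y0] :: real^2) (vector [x1,y1])"
  have blC: "bounded_linear toC"
    unfolding toC_def Complex_eq
    by (intro bounded_linear_add bounded_linear_compose[OF bounded_linear_mult_right] bounded_linear_compose[OF bounded_linear_of_real] bounded_linear_vec_nth)
  have ofCtoC: "toC (ofC z) = z" "ofC (toC v) = v" for z v
    by (auto simp: toC_def ofC_def vec_eq_iff forall_2)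
  have blO: "bounded_linear ofC"
    by (rule linear_conv_bounded_linear[THEN iffD1])
       (auto intro!: linearI simp: ofC_def vec_eq_iff forall_2)
  have RS: "toC v \<in> S" if "v \<in> R" for v
    using that rect[of "vec_nth v 1" "vec_nth v 2"] by (auto simp: R_def toC_def mem_box_cart forall_2)
  have derH: "(H has_field_derivative deriv H z) (at z)" if "z \<in> S" for z
    using S that holomorphic_derivI by blast
  have derG: "(G has_field_derivative deriv G z) (at z)" if "z \<in> S" for z
    using S that holomorphic_derivI by blast
  have der: "(F has_derivative F' v) (at v within R)" if "v \<in> R" for v
  proof -
    have "(f has_derivative (\<lambda>x. deriv H (toC v) * x + cnj (deriv G (toC v) * x))) (at (toC v))"
      unfolding f_def by (intro has_derivative_harm derH derG RS that)
    from bounded_linear.has_derivative[OF blO has_derivative_compose[OF bounded_linear_imp_has_derivative[OF blC] this]]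
    show ?thesis unfolding F_def[abs_def] F'_def[abs_def] .
  qed
  have inj: "inj_on F R"
  proof (rule inj_onI)
    fix v w assume "v \<in> R" "w \<in> R" "F v = F w"
    hence "f (toC v) = f (toC w)" using ofCtoC by (metis F_def)
    hence "toC v = toC w" using S(4) RS \<open>v \<in> R\<close> \<open>w \<in> R\<close> by (auto simp: f_def inj_on_def)
    thus "v = w" using ofCtoC by metis
  qed
  have det: "\<bar>det (matrix (F' v))\<bar> = (norm (deriv H (toC v)))\<^sup>2 - (norm (deriv G (toC v)))\<^sup>2" if "v \<in> R" for v
  proof -
    have "det (matrix (F' v)) = (norm (deriv H (toC v)))\<^sup>2 - (norm (deriv G (toC v)))\<^sup>2"
      unfolding det_2 matrix_def F'_def cmod_power2
      by (simp add: toC_def ofC_def axis_def algebra_simps power2_eq_square)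
    moreover have "norm (deriv G (toC v)) \<le> norm (deriv H (toC v))"
      using dil[OF RS[OF that]] k mult_right_mono[of k 1 "norm (deriv H (toC v))"] by simp
    ultimately show ?thesis by (simp add: power_mono)
  qed
  have cH: "continuous_on S (deriv H)" "continuous_on S (deriv G)"
    using S by (auto intro!: holomorphic_on_imp_continuous_on holomorphic_deriv)
  have ctoC: "continuous_on A toC" for A using blC linear_continuous_on by blast
  have cR: "continuous_on R (\<lambda>v. \<bar>det (matrix (F' v))\<bar>)"
    by (subst continuous_on_cong[OF refl det])
       (auto intro!: continuous_intros continuous_on_compose2[OF cH(1) ctoC] continuous_on_compose2[OF cH(2) ctoC] RS)
  have int: "((\<lambda>v. \<bar>det (matrix (F' v))\<bar>) has_integral integral R (\<lambda>v. \<bar>det (matrix (F' v))\<bar>)) R"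
    using cR unfolding R_def by (intro integrable_integral integrable_continuous)
  have "R \<in> sets lebesgue" by (simp add: R_def)
  from has_measure_differentiable_image[OF this der inj, THEN iffD2, OF _ int]
  have FR: "F ` R \<in> lmeasurable" "measure lebesgue (F ` R) = integral R (\<lambda>v. \<bar>det (matrix (F' v))\<bar>)"
    by auto
  have "F ` R \<subseteq> cbox (vector [-M,-M]) (vector [M,M])"
  proof safe
    fix v assume v: "v \<in> R"
    have "\<bar>Re (f (toC v))\<bar> \<le> M" "\<bar>Im (f (toC v))\<bar> \<le> M"
      using bnd[OF RS[OF v]] abs_Re_le_cmod abs_Im_le_cmod order_trans unfolding f_def by blast+
    thus "F v \<in> cbox (vector [-M,-M]) (vector [M,M])"
      by (auto simp: mem_box_cart forall_2 F_def ofC_def)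
  qed
  hence "measure lebesgue (F ` R) \<le> measure lebesgue (cbox (vector [-M,-M]) (vector [M,M]) :: (real^2) set)"
    by (rule measure_mono_fmeasurable) (use FR in auto)
  also have "\<dots> \<le> (2 * M)\<^sup>2"
  proof (cases "cbox (vector [-M,-M]) (vector [M,M] :: real^2) = {}")
    case True thus ?thesis by simp
  next
    case False
    thus ?thesis using content_cbox_cart[OF False] by (simp add: UNIV_2 power2_eq_square measure_completion)
  qed
  finally have le: "integral R (\<lambda>v. \<bar>det (matrix (F' v))\<bar>) \<le> (2 * M)\<^sup>2" using FR by simp
  have "(1 - k\<^sup>2) * integral R (\<lambda>v. (norm (deriv H (toC v)))\<^sup>2) = integral R (\<lambda>v. (1 - k\<^sup>2) * (norm (deriv H (toC v)))\<^sup>2)"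
    by simp
  also have "\<dots> \<le> integral R (\<lambda>v. \<bar>det (matrix (F' v))\<bar>)"
  proof (rule integral_le)
    show "(\<lambda>v. (1 - k\<^sup>2) * (norm (deriv H (toC v)))\<^sup>2) integrable_on R"
      unfolding R_def by (intro integrable_continuous continuous_intros continuous_on_compose2[OF cH(1) ctoC])
         (use RS in \<open>auto simp: R_def\<close>)
    fix v assume v: "v \<in> R"
    have "(norm (deriv G (toC v)))\<^sup>2 \<le> (k * norm (deriv H (toC v)))\<^sup>2"
      by (intro power_mono dil RS v) auto
    thus "(1 - k\<^sup>2) * (norm (deriv H (toC v)))\<^sup>2 \<le> \<bar>det (matrix (F' v))\<bar>"
      unfolding det[OF v] by (simp add: algebra_simps power_mult_distrib)
  qed (use int in auto)
  also note le
  also have "integral R (\<lambda>v. (norm (deriv H (toC v)))\<^sup>2)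
     = integral {x0..x1} (\<lambda>x. integral {y0..y1} (\<lambda>y. (norm (deriv H (toC (vector [x,y]))))\<^sup>2))"
    unfolding R_def by (intro integral_vector2_continuous continuous_intros continuous_on_compose2[OF cH(1) ctoC])
         (use RS in \<open>auto simp: R_def\<close>)
  finally show ?thesis by (simp add: toC_def)
qed

text \<open>If the integral of |H'|^2 exceeded \<epsilon>^2 along every vertical segment,
  integrating over an interval of abscissas this long would exceed the available area. On a segment
  where it does not, the image curve is short.\<close>

lemma short_vertical_crosscut:
  fixes H G :: "complex \<Rightarrow> complex" and x0 x1 b M k \<epsilon> :: real
  defines "S \<equiv> {w. \<bar>Im w\<bar> < b}"
  assumes hol: "H holomorphic_on S" "G holomorphic_on S" and inj: "inj_on (harm H G) S"
    and bnd: "\<And>z. z \<in> S \<Longrightarrow> norm (harm H G z) \<le> M"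
    and dil: "\<And>z. z \<in> S \<Longrightarrow> norm (deriv G z) \<le> k * norm (deriv H z)" and k: "0 \<le> k" "k < 1"
    and \<epsilon>: "\<epsilon> > 0" and len: "(2 * M)\<^sup>2 / ((1 - k\<^sup>2) * \<epsilon>\<^sup>2) < x1 - x0" and b: "b > 0"
  shows "\<exists>x\<in>{x0..x1}. \<forall>y y'. \<bar>y\<bar> < b \<longrightarrow> \<bar>y'\<bar> < b \<longrightarrow>
            norm (harm H G (Complex x y) - harm H G (Complex x y')) \<le> (2 * b + 1) * \<epsilon>"
proof -
  have oS: "open S" unfolding S_def by (intro open_Collect_less continuous_intros)
  have k2: "1 - k\<^sup>2 > 0" using k by (simp add: power_less_one_iff)
  have lenpos: "x0 < x1" using len k2 \<epsilon> by (smt (verit) divide_nonneg_nonneg zero_le_power2 mult_nonneg_nonneg)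
  define B where "B Y x = integral {-Y..Y} (\<lambda>y. (norm (deriv H (Complex x y)))\<^sup>2)" for Y x
  have cH: "continuous_on S (deriv H)" "continuous_on S (deriv G)"
    using oS hol by (auto intro!: holomorphic_on_imp_continuous_on holomorphic_deriv)
  have cC: "continuous_on A (\<lambda>y. Complex x y)" for A x
    unfolding Complex_eq by (intro continuous_intros)
  have cHx: "continuous_on A (\<lambda>y. deriv H (Complex x y))" "continuous_on A (\<lambda>y. deriv G (Complex x y))"
    if "A \<subseteq> {-b<..<b}" for A x
    using that by (auto intro!: continuous_on_compose2[OF cH(1) cC] continuous_on_compose2[OF cH(2) cC] simp: S_def abs_less_iff)
  have cB: "continuous_on {x0..x1} (B Y)" if "Y < b" for Y
  proof -
    have "continuous_on ({x0..x1} \<times> {-Y..Y}) (\<lambda>z. (norm (deriv H (Complex (fst z) (snd z))))\<^sup>2)"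
      unfolding Complex_eq using that by (intro continuous_intros continuous_on_compose2[OF cH(1)]) (auto simp: S_def)
    thus ?thesis unfolding B_def[abs_def]
      using integral_continuous_on_param[of "{x0..x1}" "-Y" Y "\<lambda>x y. (norm (deriv H (Complex x y)))\<^sup>2"]
      by (simp add: case_prod_unfold)
  qed
  have ex: "\<exists>x\<in>{x0..x1}. B Y x \<le> \<epsilon>\<^sup>2" if Y: "Y < b" for Y
  proof (rule ccontr)
    assume "\<not> ?thesis"
    hence gt: "\<epsilon>\<^sup>2 \<le> B Y x" if "x \<in> {x0..x1}" for x using that by force
    have "(x1 - x0) * \<epsilon>\<^sup>2 = integral {x0..x1} (\<lambda>x. \<epsilon>\<^sup>2)" using lenpos by simp
    also have "\<dots> \<le> integral {x0..x1} (B Y)"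
      using gt by (intro integral_le integrable_continuous_interval cB Y) auto
    finally have "(1 - k\<^sup>2) * ((x1 - x0) * \<epsilon>\<^sup>2) \<le> (1 - k\<^sup>2) * integral {x0..x1} (B Y)"
      using k2 by (intro mult_left_mono) auto
    also have "\<dots> \<le> (2 * M)\<^sup>2"
      unfolding B_def[abs_def] by (rule harm_area_le[OF oS hol inj bnd dil k]) (use Y in \<open>auto simp: S_def\<close>)
    finally show False using len k2 \<epsilon> by (simp add: field_simps)
  qed
  define Y where "Y n = b * (1 - 1 / real (n + 2))" for n
  have Yb: "Y n < b" for n using b by (simp add: Y_def field_simps)
  have Ymono: "Y m \<le> Y n" if "m \<le> n" for m n
    unfolding Y_def using b that by (intro mult_left_mono) (auto simp: field_simps)
  have Blim: "B (Y m) x \<le> B (Y n) x" if "m \<le> n" for m n x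
    unfolding B_def using Ymono[OF that] Yb[of m] Yb[of n]
    by (intro integral_subset_le integrable_continuous_interval continuous_intros cHx) auto
  \<comment> \<open>One abscissa has to serve all heights below \<open>b\<close> at once, hence the compactness argument.\<close>
  define F where "F n = {x\<in>{x0..x1}. B (Y n) x \<le> \<epsilon>\<^sup>2}" for n
  have "\<Inter> (range F) \<noteq> {}"
  proof (rule compact_nest)
    fix n
    have "closed (F n)" unfolding F_def
      by (intro continuous_on_closed_Collect_le cB Yb continuous_intros closed_atLeastAtMost)
    hence "compact ({x0..x1} \<inter> F n)" by (intro compact_Int_closed) auto
    moreover have "{x0..x1} \<inter> F n = F n" by (auto simp: F_def)
    ultimately show "compact (F n)" by simp
    show "F n \<noteq> {}" using ex[OF Yb[of n]] by (auto simp: F_def)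
  next
    fix m n :: nat assume "m \<le> n"
    thus "F n \<subseteq> F m" unfolding F_def using Blim order_trans by blast
  qed
  then obtain x where x: "\<And>n. x \<in> F n" by blast
  have main: "norm (harm H G (Complex x y2) - harm H G (Complex x y1)) \<le> (2 * b + 1) * \<epsilon>"
    if y: "-b < y1" "y1 \<le> y2" "y2 < b" for y1 y2
  proof -
    have "(Y \<longlonglongrightarrow> b * (1 - 0))" unfolding Y_def
      by (intro tendsto_intros LIMSEQ_ignore_initial_segment[of "\<lambda>n. 1 / real n", of 0 2] lim_1_over_n)
    hence "eventually (\<lambda>n. Y n > max \<bar>y1\<bar> \<bar>y2\<bar>) sequentially"
      using y by (intro order_tendstoD(1)) auto
    then obtain n where n: "Y n > \<bar>y1\<bar>" "Y n > \<bar>y2\<bar>" by (auto simp: eventually_sequentially)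
    define d where "d t = deriv H (Complex x t) * \<i> + cnj (deriv G (Complex x t) * \<i>)" for t
    have "((\<lambda>t. harm H G (Complex x t)) has_vector_derivative d t) (at t within {y1..y2})" if t: "t \<in> {y1..y2}" for t
    proof -
      have tS: "Complex x t \<in> S" using t y by (auto simp: S_def)
      have "((\<lambda>t. Complex x t) has_derivative (\<lambda>s. of_real s * \<i>)) (at t within {y1..y2})"
        unfolding Complex_eq by (auto intro!: derivative_eq_intros simp: mult.commute)
      from has_derivative_compose[OF this has_derivative_harm[OF holomorphic_derivI[OF hol(1) oS tS] holomorphic_derivI[OF hol(2) oS tS]]]
      show ?thesis unfolding has_vector_derivative_def d_def
        by (simp add: scaleR_conv_of_real algebra_simps)
    qed
    from fundamental_theorem_of_calculus[OF y(2) this]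
    have FTC: "(d has_integral (harm H G (Complex x y2) - harm H G (Complex x y1))) {y1..y2}" by simp
    have sub: "{y1..y2} \<subseteq> {-b<..<b}" using y by auto
    have "norm (integral {y1..y2} d) \<le> integral {y1..y2} (\<lambda>t. \<epsilon> + (norm (deriv H (Complex x t)))\<^sup>2 / \<epsilon>)"
    proof (rule integral_norm_bound_integral)
      show "(\<lambda>t. \<epsilon> + (norm (deriv H (Complex x t)))\<^sup>2 / \<epsilon>) integrable_on {y1..y2}"
        using \<epsilon> by (intro integrable_continuous_interval continuous_intros cHx sub) auto
      fix t assume t: "t \<in> {y1..y2}"
      define a where "a = norm (deriv H (Complex x t))"
      have "Complex x t \<in> S" using t y by (auto simp: S_def)
      hence "norm (deriv G (Complex x t)) \<le> k * a" using dil by (simp add: a_def)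
      also have "\<dots> \<le> 1 * a" using k by (intro mult_right_mono) (auto simp: a_def)
      finally have "norm (d t) \<le> 2 * a"
        unfolding d_def by (intro order_trans[OF norm_triangle_ineq]) (simp add: norm_mult a_def)
      \<comment> \<open>Weighted AM-GM in the role of Cauchy-Schwarz. In the factor 2 * b + 1 the
        constant term contributes the length 2 * b of the segment, and the square contributes 1
        because its integral is at most \<epsilon>^2.\<close>
      also have "0 \<le> (a - \<epsilon>)\<^sup>2 / \<epsilon>" using \<epsilon> by simp
      hence "2 * a \<le> \<epsilon> + a\<^sup>2 / \<epsilon>" using \<epsilon> by (simp add: field_simps power2_eq_square)
      finally show "norm (d t) \<le> \<epsilon> + (norm (deriv H (Complex x t)))\<^sup>2 / \<epsilon>" unfolding a_def .
    qed (use FTC in auto)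
    also have "\<dots> = integral {y1..y2} (\<lambda>t. \<epsilon>) + integral {y1..y2} (\<lambda>t. (norm (deriv H (Complex x t)))\<^sup>2 / \<epsilon>)"
      using \<epsilon> by (intro integral_add integrable_continuous_interval continuous_intros cHx sub) auto
    also have "\<dots> = \<epsilon> * (y2 - y1) + integral {y1..y2} (\<lambda>t. (norm (deriv H (Complex x t)))\<^sup>2) / \<epsilon>"
      using y by simp
    also have "integral {y1..y2} (\<lambda>t. (norm (deriv H (Complex x t)))\<^sup>2) \<le> B (Y n) x"
      unfolding B_def using n Yb[of n]
      by (intro integral_subset_le integrable_continuous_interval continuous_intros cHx sub) auto
    also have "B (Y n) x \<le> \<epsilon>\<^sup>2" using x[of n] by (simp add: F_def)
    also have "\<epsilon> * (y2 - y1) \<le> \<epsilon> * (2 * b)" using \<epsilon> y by (intro mult_left_mono) auto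
    also have "\<epsilon> * (2 * b) + \<epsilon>\<^sup>2 / \<epsilon> = (2 * b + 1) * \<epsilon>" using \<epsilon> by (simp add: field_simps power2_eq_square)
    finally show ?thesis using FTC \<epsilon> by (simp add: integral_unique divide_right_mono)
  qed
  show ?thesis
  proof (intro bexI[of _ x] allI impI)
    show "x \<in> {x0..x1}" using x[of 0] by (simp add: F_def)
    fix y y' assume "\<bar>y\<bar> < b" "\<bar>y'\<bar> < b"
    thus "norm (harm H G (Complex x y) - harm H G (Complex x y')) \<le> (2 * b + 1) * \<epsilon>"
      using main[of y y'] main[of y' y] by (cases "y \<le> y'") (auto simp: norm_minus_commute abs_less_iff)
  qed
qed

text \<open>The derivatives are not normalized at 0, so that the assumptions persist when
  \<open>h\<close> and \<open>g\<close> are composed with a Riemann map; this is used to truncate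
  unbounded images.\<close>

locale convex_harm =
  fixes h g :: "complex \<Rightarrow> complex" and k :: real
  assumes hol_h: "h holomorphic_on ball 0 1" and hol_g: "g holomorphic_on ball 0 1"
    and inj: "inj_on (harm h g) (ball 0 1)" and cvx: "convex (harm h g ` ball 0 1)"
    and zero: "harm h g 0 = 0"
    and dil: "\<And>z. z \<in> ball 0 1 \<Longrightarrow> norm (deriv g z) \<le> k * norm (deriv h z)"
    and k01: "0 \<le> k" "k < 1"
begin

abbreviation f :: "complex \<Rightarrow> complex" where "f \<equiv> harm h g"

lemma f_continuous: "continuous_on (ball 0 1) f"
  unfolding harm_def
  by (intro continuous_intros holomorphic_on_imp_continuous_on hol_h hol_g)

lemma f_open_image: "open A \<Longrightarrow> A \<subseteq> ball 0 1 \<Longrightarrow> open (f ` A)"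
  using f_continuous inj by (intro invariance_of_domain) (auto intro: continuous_on_subset inj_on_subset)

lemma f_homeo:
  obtains f' where "homeomorphism (ball 0 1) (f ` ball 0 1) f f'"
  using invariance_of_domain_homeomorphism[OF open_ball f_continuous _ inj] by auto

end

locale bounded_convex_harm = convex_harm +
  assumes bdd: "bounded (harm h g ` ball 0 1)"

section \<open>Crosscuts around a boundary point\<close>

text \<open>This Moebius map takes the disc to the right half-plane and \<zeta> to 0. Its modulus
  serves below as distance to \<zeta>; the level sets are the circular crosscuts orthogonal to the
  unit circle.\<close>

lemma disc_half_plane:
  assumes "norm \<zeta> = 1" "norm z < (1::real)"
  shows "Re ((\<zeta> - z) / (\<zeta> + z)) > 0" "\<zeta> + z \<noteq> 0"
proof -
  show "Re ((\<zeta> - z) / (\<zeta> + z)) > 0" using poisson_kernel_pos[of "-z" \<zeta>] assms by simp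
  show "\<zeta> + z \<noteq> 0" using assms by (metis add_eq_0_iff2 norm_minus_cancel less_irrefl)
qed

text \<open>\<open>exp\<close> takes the strip onto the right half-plane and the second map inverts
  the one of \<open>disc_half_plane\<close>, so vertical segments of the strip become the crosscuts
  around \<zeta>.\<close>

lemma cayley_strip:
  fixes \<zeta> w :: complex
  assumes \<zeta>: "norm \<zeta> = 1" and w: "\<bar>Im w\<bar> < pi / 2"
  shows "1 + exp w \<noteq> 0" "norm (\<zeta> * (1 - exp w) / (1 + exp w)) < 1"
proof -
  have "cos (Im w) > 0" using w by (intro cos_gt_zero_pi) linarith+
  hence pos: "Re (exp w) > 0" by (simp add: Re_exp)
  hence "Re (1 + exp w) > 0" by simp
  thus ne: "1 + exp w \<noteq> 0" by (metis less_irrefl zero_complex.simps(1))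
  have "(norm (1 - exp w))\<^sup>2 < (norm (1 + exp w))\<^sup>2"
    using pos unfolding cmod_power2 by (simp add: power2_eq_square algebra_simps)
  hence "norm (1 - exp w) < norm (1 + exp w)" by (rule power2_less_imp_less) simp
  thus "norm (\<zeta> * (1 - exp w) / (1 + exp w)) < 1" using \<zeta> ne by (simp add: norm_mult norm_divide)
qed

text \<open>
  In \<open>cap_oscillation\<close> below, a point \<open>p\<close> cut off by a crosscut with image near \<open>w\<close> is joined to the centre
  via \<open>e\<close> or \<open>-e\<close>; both routes are blocked only if \<open>p\<close> is itself near \<open>w\<close>.
\<close>

lemma both_segments_meet_ball:
  fixes p w e :: complex
  assumes e: "e = \<i> * p / norm p * of_real r0" and p: "p \<noteq> 0" and r0: "r0 > 0"
    and x1: "x1 \<in> closed_segment p e" "norm (x1 - w) \<le> \<epsilon>"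
    and x2: "x2 \<in> closed_segment p (-e)" "norm (x2 - w) \<le> \<epsilon>"
  shows "norm (p - w) \<le> \<epsilon> + 2 * \<epsilon> / r0 * (norm p + r0)"
proof -
  obtain s where s: "0 \<le> s" "s \<le> 1" "x1 = (1 - s) *\<^sub>R p + s *\<^sub>R e"
    using x1(1) by (auto simp: closed_segment_def)
  obtain t where t: "0 \<le> t" "t \<le> 1" "x2 = (1 - t) *\<^sub>R p + t *\<^sub>R (-e)"
    using x2(1) by (auto simp: closed_segment_def)
  have ne: "norm e = r0" using p r0 by (simp add: e norm_mult norm_divide)
  define q where "q = p / norm p"
  have q: "norm q = 1" "p = q * norm p" "e = q * (\<i> * r0)" using p by (auto simp: q_def e norm_divide)
  \<comment> \<open>Since \<open>e\<close> is perpendicular to \<open>p\<close>, the two points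
    differ by (s + t) * r0 in the direction of \<open>e\<close>. Both lie in one ball of radius
    \<epsilon>, so \<open>s\<close> is small and \<open>x1\<close> is close to
    \<open>p\<close>.\<close>
  have "x1 - x2 = (t - s) *\<^sub>R p + (s + t) *\<^sub>R e" unfolding s t by (simp add: algebra_simps)
  also have "\<dots> = q * Complex ((t - s) * norm p) ((s + t) * r0)"
    by (subst q(2), subst q(3)) (simp add: Complex_eq scaleR_conv_of_real algebra_simps)
  finally have "norm (x1 - x2) = norm (Complex ((t - s) * norm p) ((s + t) * r0))"
    using q by (simp add: norm_mult)
  hence "(s + t) * r0 \<le> norm (x1 - x2)"
    using abs_Im_le_cmod[of "Complex ((t - s) * norm p) ((s + t) * r0)"] by simp
  also have "\<dots> \<le> 2 * \<epsilon>"
    using norm_triangle_ineq4[of "x1 - w" "x2 - w"] x1 x2 by simp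
  finally have "(s + t) * r0 \<le> 2 * \<epsilon>" .
  moreover have "s * r0 \<le> (s + t) * r0" using t r0 by (intro mult_right_mono) auto
  ultimately have "s \<le> 2 * \<epsilon> / r0" using r0 by (simp add: field_simps)
  have "norm (p - w) \<le> norm (p - x1) + norm (x1 - w)" by (metis dist_norm dist_triangle)
  also have "p - x1 = s *\<^sub>R (p - e)" unfolding s by (simp add: algebra_simps)
  also have "norm (s *\<^sub>R (p - e)) \<le> (2 * \<epsilon> / r0) * (norm p + r0)"
    using s \<open>s \<le> 2 * \<epsilon> / r0\<close> norm_triangle_ineq4[of p e] ne by (simp only: norm_scaleR abs_of_nonneg) (intro mult_mono, auto)
  finally show ?thesis using x1(2) by simp
qed

context bounded_convex_harm
begin

text \<open>The bound \<open>X\<close> is the same for all \<zeta>; this is what later yields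
  uniform continuity rather than mere continuity at each boundary point.\<close>

lemma short_crosscut:
  assumes \<epsilon>: "\<epsilon> > 0"
  shows "\<exists>X. \<forall>\<zeta>. norm \<zeta> = 1 \<longrightarrow> (\<exists>\<rho>. exp X \<le> \<rho> \<and> \<rho> \<le> exp (-2) \<and>
           (\<forall>z\<in>ball 0 1. \<forall>z'\<in>ball 0 1. norm ((\<zeta> - z) / (\<zeta> + z)) = \<rho> \<longrightarrow>
              norm ((\<zeta> - z') / (\<zeta> + z')) = \<rho> \<longrightarrow> norm (f z - f z') \<le> \<epsilon>))"
proof -
  obtain M where M: "\<And>z. z \<in> ball 0 1 \<Longrightarrow> norm (f z) \<le> M"
    using bdd unfolding bounded_iff by (metis imageI)
  \<comment> \<open>Cancels the factor 2 * b + 1 of \<open>short_vertical_crosscut\<close> for the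
    half-width b = pi / 2.\<close>
  define \<eta> where "\<eta> = \<epsilon> / (2 * (pi / 2) + 1)"
  have \<eta>: "\<eta> > 0" using \<epsilon> by (auto simp: \<eta>_def intro!: divide_pos_pos add_pos_pos)
  have e\<eta>: "(2 * (pi / 2) + 1) * \<eta> = \<epsilon>"
  proof -
    have "pi + 1 \<noteq> 0" using pi_gt_zero by linarith
    thus ?thesis by (simp add: \<eta>_def)
  qed
  \<comment> \<open>The interval {X..-2} of logarithmic radii is one unit longer than the area bound
    requires. Its upper end gives radii of at most 1/3, small enough to keep the crosscut away from
    the centre.\<close>
  define X where "X = -3 - (2 * M)\<^sup>2 / ((1 - k\<^sup>2) * \<eta>\<^sup>2)"
  show ?thesis
  proof (rule exI[of _ X], intro allI impI)
    fix \<zeta> :: complex assume \<zeta>: "norm \<zeta> = 1"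
    have \<zeta>0: "\<zeta> \<noteq> 0" using \<zeta> by auto
    define S where "S = {w. \<bar>Im w\<bar> < pi / 2}"
    \<comment> \<open>\<open>E\<close> maps the strip conformally onto the disc and its left end to \<open>\<zeta>\<close>.\<close>
    define E where "E w = \<zeta> * (1 - exp w) / (1 + exp w)" for w
    have oS: "open S" unfolding S_def by (intro open_Collect_less continuous_intros)
    have ES: "E w \<in> ball 0 1" if "w \<in> S" for w using cayley_strip[OF \<zeta>, of w] that by (simp add: S_def E_def)
    have holE: "E holomorphic_on S" unfolding E_def
      using cayley_strip(1)[OF \<zeta>] by (intro holomorphic_intros) (auto simp: S_def)
    have injE: "inj_on E S"
    proof (rule inj_onI)
      fix w w' assume w: "w \<in> S" "w' \<in> S" "E w = E w'"
      have "1 + exp w \<noteq> 0" "1 + exp w' \<noteq> 0" using w cayley_strip(1)[OF \<zeta>] by (auto simp: S_def)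
      hence "exp w = exp w'" using w(3) \<zeta>0 unfolding E_def by (simp add: divide_simps) (simp add: algebra_simps)
      hence "Ln (exp w) = Ln (exp w')" by simp
      thus "w = w'" using w by (simp add: S_def abs_less_iff)
    qed
    have harmE: "harm (h \<circ> E) (g \<circ> E) w = f (E w)" for w by (simp add: harm_def)
    have img: "E ` S \<subseteq> ball 0 1" using ES by auto
    have "\<exists>x\<in>{X..-2}. \<forall>y y'. \<bar>y\<bar> < pi/2 \<longrightarrow> \<bar>y'\<bar> < pi/2 \<longrightarrow>
            norm (harm (h \<circ> E) (g \<circ> E) (Complex x y) - harm (h \<circ> E) (g \<circ> E) (Complex x y')) \<le> (2 * (pi/2) + 1) * \<eta>"
    proof (rule short_vertical_crosscut[where M = M and k = k])
      show "h \<circ> E holomorphic_on {w. \<bar>Im w\<bar> < pi / 2}" "g \<circ> E holomorphic_on {w. \<bar>Im w\<bar> < pi / 2}"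
        using holomorphic_on_compose_gen[OF holE hol_h img] holomorphic_on_compose_gen[OF holE hol_g img] by (auto simp: S_def)
      show "(2 * M)\<^sup>2 / ((1 - k\<^sup>2) * \<eta>\<^sup>2) < -2 - X" by (simp add: X_def)
      show "inj_on (harm (h \<circ> E) (g \<circ> E)) {w. \<bar>Im w\<bar> < pi / 2}"
        using injE inj ES unfolding inj_on_def harmE S_def by blast
      fix z assume z: "z \<in> {w. \<bar>Im w\<bar> < pi / 2}"
      hence zS: "z \<in> S" by (simp add: S_def)
      show "norm (harm (h \<circ> E) (g \<circ> E) z) \<le> M" unfolding harmE by (intro M ES zS)
      have dE: "E field_differentiable at z" using holE oS zS holomorphic_on_imp_differentiable_at by blast
      have dh: "h field_differentiable at (E z)" "g field_differentiable at (E z)"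
        using hol_h hol_g ES[OF zS] holomorphic_on_imp_differentiable_at open_ball by blast+
      show "norm (deriv (g \<circ> E) z) \<le> k * norm (deriv (h \<circ> E) z)"
        unfolding deriv_chain[OF dE dh(1)] deriv_chain[OF dE dh(2)] norm_mult mult.assoc[symmetric]
        by (intro mult_right_mono dil ES zS) auto
    qed (use k01 \<eta> in auto)
    then obtain x where x: "x \<in> {X..-2}"
      "\<And>y y'. \<bar>y\<bar> < pi/2 \<Longrightarrow> \<bar>y'\<bar> < pi/2 \<Longrightarrow> norm (f (E (Complex x y)) - f (E (Complex x y'))) \<le> \<epsilon>"
      unfolding e\<eta> harmE by blast
    have param: "\<exists>y. \<bar>y\<bar> < pi/2 \<and> z = E (Complex x y)" if z: "z \<in> ball 0 1" "norm ((\<zeta> - z) / (\<zeta> + z)) = exp x" for z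
    proof -
      define u where "u = (\<zeta> - z) / (\<zeta> + z)"
      have u: "Re u > 0" "\<zeta> + z \<noteq> 0" using disc_half_plane[OF \<zeta>, of z] z by (auto simp: u_def)
      have u0: "u \<noteq> 0" using u by auto
      have imu: "\<bar>Im (Ln u)\<bar> < pi/2" using Re_Ln_pos_lt[OF u0] u by simp
      have "Re (Ln u) = x" using u0 z by (simp add: u_def[symmetric])
      hence "Complex x (Im (Ln u)) = Ln u" by (simp add: complex_eq_iff)
      hence Eu: "E (Complex x (Im (Ln u))) = \<zeta> * (1 - u) / (1 + u)" using u0 by (simp add: E_def)
      have "\<zeta> * (1 - u) / (1 + u) = z"
      proof -
        have "1 - u = 2 * z / (\<zeta> + z)" "1 + u = 2 * \<zeta> / (\<zeta> + z)" using u by (auto simp: u_def field_simps)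
        thus ?thesis using u \<zeta>0 by simp
      qed
      thus ?thesis using imu Eu by metis
    qed
    show "\<exists>\<rho>. exp X \<le> \<rho> \<and> \<rho> \<le> exp (-2) \<and>
           (\<forall>z\<in>ball 0 1. \<forall>z'\<in>ball 0 1. norm ((\<zeta> - z) / (\<zeta> + z)) = \<rho> \<longrightarrow>
              norm ((\<zeta> - z') / (\<zeta> + z')) = \<rho> \<longrightarrow> norm (f z - f z') \<le> \<epsilon>)"
    proof (intro exI[of _ "exp x"] conjI ballI impI)
      show "exp X \<le> exp x" "exp x \<le> exp (-2)" using x(1) by auto
      fix z z' assume "z \<in> ball 0 1" "z' \<in> ball 0 1" "norm ((\<zeta> - z) / (\<zeta> + z)) = exp x" "norm ((\<zeta> - z') / (\<zeta> + z')) = exp x"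
      thus "norm (f z - f z') \<le> \<epsilon>" using param x(2) by metis
    qed
  qed
qed

text \<open>The crosscut is a level set of the continuous function \<open>u\<close>, so any
  connected set that joins a point of the cap to 0 meets it. By convexity the segments used for this
  stay in the image and can be pulled back to the disc.\<close>

lemma cap_oscillation:
  assumes \<eta>: "\<eta> > 0"
  shows "\<exists>\<delta>>0. \<forall>\<zeta>. norm \<zeta> = 1 \<longrightarrow> (\<forall>z\<in>ball 0 1. \<forall>z'\<in>ball 0 1.
           norm ((\<zeta> - z) / (\<zeta> + z)) < \<delta> \<longrightarrow> norm ((\<zeta> - z') / (\<zeta> + z')) < \<delta> \<longrightarrow> norm (f z - f z') \<le> \<eta>)"
proof -
  obtain M where M: "\<And>z. z \<in> ball 0 1 \<Longrightarrow> norm (f z) \<le> M"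
    using bdd unfolding bounded_iff by (metis imageI)
  have M0: "M \<ge> 0" using M[of 0] zero by simp
  obtain f' where f': "homeomorphism (ball 0 1) (f ` ball 0 1) f f'" using f_homeo .
  have cf': "continuous_on (f ` ball 0 1) f'" and f'f: "\<And>z. z \<in> ball 0 1 \<Longrightarrow> f' (f z) = z"
    using f' by (auto simp: homeomorphism_def)
  have "open (f ` ball 0 (1/2))" by (rule f_open_image) auto
  moreover have "0 \<in> f ` ball 0 (1/2)" using zero by (intro image_eqI[of _ _ 0]) auto
  ultimately obtain r0 where r0: "r0 > 0" "cball 0 r0 \<subseteq> f ` ball 0 (1/2)"
    by (meson open_contains_cball)
  \<comment> \<open>With \<open>norm p\<close> replaced by \<open>M\<close>, the bound of
    \<open>both_segments_meet_ball\<close> is C * \<epsilon>. Two points of the cap are compared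
    through \<open>f z0\<close>, hence the 2 in \<epsilon>.\<close>
  define C where "C = 1 + 2 / r0 * (M + r0)"
  have C: "C > 0" using r0 M0 by (auto simp: C_def intro!: add_pos_nonneg)
  define \<epsilon> where "\<epsilon> = \<eta> / (2 * C)"
  have \<epsilon>: "\<epsilon> > 0" using \<eta> C by (simp add: \<epsilon>_def)
  obtain X where X: "\<And>\<zeta>. norm \<zeta> = 1 \<Longrightarrow> (\<exists>\<rho>. exp X \<le> \<rho> \<and> \<rho> \<le> exp (-2) \<and>
           (\<forall>z\<in>ball 0 1. \<forall>z'\<in>ball 0 1. norm ((\<zeta> - z) / (\<zeta> + z)) = \<rho> \<longrightarrow>
              norm ((\<zeta> - z') / (\<zeta> + z')) = \<rho> \<longrightarrow> norm (f z - f z') \<le> \<epsilon>))"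
    using short_crosscut[OF \<epsilon>] by blast
  show ?thesis
  proof (intro exI[of _ "exp X"] conjI allI impI ballI)
    fix \<zeta> z z' :: complex
    assume \<zeta>: "norm \<zeta> = 1" and zz: "z \<in> ball 0 1" "z' \<in> ball 0 1"
      and uz: "norm ((\<zeta> - z) / (\<zeta> + z)) < exp X" "norm ((\<zeta> - z') / (\<zeta> + z')) < exp X"
    define u where "u z = norm ((\<zeta> - z) / (\<zeta> + z))" for z
    obtain \<rho> where \<rho>: "exp X \<le> \<rho>" "\<rho> \<le> exp (-2)"
      "\<And>z z'. z \<in> ball 0 1 \<Longrightarrow> z' \<in> ball 0 1 \<Longrightarrow> u z = \<rho> \<Longrightarrow> u z' = \<rho> \<Longrightarrow> norm (f z - f z') \<le> \<epsilon>"
      using X[OF \<zeta>] unfolding u_def by blast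
    have \<rho>0: "\<rho> > 0" using \<rho>(1) exp_gt_zero[of X] by linarith
    have "1 + 2 \<le> exp (2::real)" by (rule exp_ge_add_one_self)
    hence "exp (-2) \<le> (1/3::real)" by (simp add: exp_minus field_simps)
    hence \<rho>3: "\<rho> \<le> 1/3" using \<rho>(2) by linarith
    have cu: "continuous_on (ball 0 1) u"
      unfolding u_def using disc_half_plane(2)[OF \<zeta>] by (intro continuous_intros) auto
    have "\<zeta> \<noteq> 0" using \<zeta> by auto
    hence u0: "u 0 = 1" by (simp add: u_def)
    \<comment> \<open>A radius of at most 1/3 keeps the crosscut outside
      \<open>ball 0 (1/2)\<close>, whose image contains \<open>cball 0 r0\<close>. The crossing
      found below is therefore not on the last leg from \<open>q\<close> to 0.\<close>
    have far: "f v \<notin> cball 0 r0" if v: "v \<in> ball 0 1" "u v = \<rho>" for v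
    proof
      assume "f v \<in> cball 0 r0"
      then obtain v' where v': "norm v' < 1/2" "f v = f v'" using r0(2) by auto
      hence "v = v'" using inj v by (auto simp: inj_on_def)
      hence nv: "norm v < 1/2" using v' by simp
      have "norm (\<zeta> - v) = \<rho> * norm (\<zeta> + v)"
        using v disc_half_plane(2)[OF \<zeta>, of v] by (auto simp: u_def norm_divide field_simps)
      also have "\<dots> \<le> 1/3 * norm (\<zeta> + v)" using \<rho>3 by (intro mult_right_mono) auto
      also have "\<dots> \<le> 1/3 * (1 + norm v)" using norm_triangle_ineq[of \<zeta> v] \<zeta> by simp
      also have "\<dots> < 1 - norm v" using nv by simp
      also have "\<dots> \<le> norm (\<zeta> - v)" using norm_triangle_ineq2[of \<zeta> v] \<zeta> by simp
      finally show False by simp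
    qed
    \<comment> \<open>The point where the crosscut meets the radius to \<zeta>; its image is the
      reference value for the whole cap.\<close>
    define z0 where "z0 = \<zeta> * of_real ((1 - \<rho>) / (1 + \<rho>))"
    have "\<bar>(1 - \<rho>) / (1 + \<rho>)\<bar> < 1" using \<rho>0 \<rho>3 by (simp add: field_simps)
    hence z0: "z0 \<in> ball 0 1" using \<zeta> by (simp only: z0_def mem_ball dist_0_norm norm_mult norm_of_real mult_1)
    have "(\<zeta> - z0) / (\<zeta> + z0) = of_real \<rho>"
    proof -
      have "(1 + complex_of_real \<rho>) \<noteq> 0" using \<rho>0 by (metis of_real_1 of_real_add of_real_eq_0_iff add_pos_pos zero_less_one less_irrefl)
      hence "\<zeta> - z0 = \<zeta> * (2 * of_real \<rho> / (1 + of_real \<rho>))" "\<zeta> + z0 = \<zeta> * (2 / (1 + of_real \<rho>))"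
        by (auto simp: z0_def field_simps)
      moreover have "\<zeta> \<noteq> 0" using \<zeta> by auto
      ultimately show ?thesis using \<open>1 + complex_of_real \<rho> \<noteq> 0\<close> by simp
    qed
    hence uz0: "u z0 = \<rho>" using \<rho>0 by (simp add: u_def)
    have near: "norm (f v - f z0) \<le> C * \<epsilon>" if v: "v \<in> ball 0 1" "u v < \<rho>" for v
    proof -
      define p where "p = f v"
      have "v \<noteq> 0" using u0 v \<rho>3 by auto
      hence p0: "p \<noteq> 0" using inj v zero by (auto simp: p_def inj_on_def)
      define e where "e = \<i> * p / norm p * of_real r0"
      have ne: "norm e = r0" using p0 r0 by (simp add: e_def norm_mult norm_divide)
      have avoid: "\<exists>x\<in>closed_segment p q. norm (x - f z0) \<le> \<epsilon>" if q: "norm q = r0" for q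
      proof (rule ccontr)
        assume no: "\<not> ?thesis"
        define A where "A = closed_segment p q \<union> closed_segment q 0"
        have sub0: "closed_segment q 0 \<subseteq> cball 0 r0" using q r0 by (intro closed_segment_subset) auto
        have r0D: "cball 0 r0 \<subseteq> f ` ball 0 1" using r0(2) by (rule order_trans) auto
        have "q \<in> f ` ball 0 1" using r0D q by auto
        hence "closed_segment p q \<subseteq> f ` ball 0 1" using cvx v by (intro closed_segment_subset) (auto simp: p_def)
        hence AD: "A \<subseteq> f ` ball 0 1" using sub0 r0D by (auto simp: A_def)
        have "connected A" unfolding A_def by (intro connected_Un connected_segment) auto
        hence "connected (f' ` A)" using continuous_on_subset[OF cf' AD] connected_continuous_image by blast
        moreover have sD: "f' ` A \<subseteq> ball 0 1" using AD f'f by auto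
        ultimately have con: "connected (u ` f' ` A)"
          using continuous_on_subset[OF cu] connected_continuous_image by blast
        have "p \<in> A" "0 \<in> A" by (auto simp: A_def)
        moreover have "f' p = v" "f' 0 = 0" using f'f[OF v(1)] f'f[of 0] zero by (auto simp: p_def)
        ultimately have "u v \<in> u ` f' ` A" "u 0 \<in> u ` f' ` A" by (metis imageI)+
        from connectedD_interval[OF con this] have "\<rho> \<in> u ` f' ` A" using v(2) u0 \<rho>3 by simp
        then obtain y where y: "y \<in> A" "u (f' y) = \<rho>" by auto
        then obtain x where x: "x \<in> ball 0 1" "y = f x" using AD by auto
        hence ux: "u x = \<rho>" using y f'f by auto
        have "y \<notin> cball 0 r0" using far[OF x(1) ux] x by simp
        hence "y \<in> closed_segment p q" using y sub0 by (auto simp: A_def)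
        moreover have "norm (y - f z0) \<le> \<epsilon>" using \<rho>(3)[OF x(1) z0 ux uz0] x by simp
        ultimately show False using no by blast
      qed
      obtain x1 x2 where x: "x1 \<in> closed_segment p e" "norm (x1 - f z0) \<le> \<epsilon>"
        "x2 \<in> closed_segment p (-e)" "norm (x2 - f z0) \<le> \<epsilon>"
        using avoid[of e] avoid[of "-e"] ne by auto
      have "norm (p - f z0) \<le> \<epsilon> + 2 * \<epsilon> / r0 * (norm p + r0)"
        by (rule both_segments_meet_ball[OF e_def p0 r0(1) x])
      also have "\<dots> \<le> \<epsilon> + 2 * \<epsilon> / r0 * (M + r0)"
        using M[OF v(1)] \<epsilon> r0 by (intro add_left_mono mult_left_mono) (auto simp: p_def)
      also have "\<dots> = C * \<epsilon>" by (simp add: C_def algebra_simps)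
      finally show ?thesis by (simp add: p_def)
    qed
    have "norm (f z - f z') \<le> norm (f z - f z0) + norm (f z' - f z0)"
      using norm_triangle_ineq4[of "f z - f z0" "f z' - f z0"] by simp
    also have "\<dots> \<le> C * \<epsilon> + C * \<epsilon>" using zz uz \<rho>(1) by (intro add_mono near) (auto simp: u_def)
    also have "\<dots> = \<eta>" using C by (simp add: \<epsilon>_def)
    finally show "norm (f z - f z') \<le> \<eta>" .
  qed simp
qed

text \<open>A point of modulus above 1 - \<delta>/2 lies together with its neighbours in a cap about
  its radial projection, and the size of the caps does not depend on that projection. All other
  points stay with their neighbours in a compact smaller disc.\<close>

lemma f_uniformly_continuous: "uniformly_continuous_on (ball 0 1) f"
  unfolding uniformly_continuous_on_def
proof (intro allI impI)
  fix \<eta> :: real assume "\<eta> > 0"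
  hence "\<eta> / 2 > 0" by simp
  from cap_oscillation[OF this] obtain \<delta>0 where \<delta>0: "\<delta>0 > 0"
    "\<And>\<zeta> z z'. norm \<zeta> = 1 \<Longrightarrow> z \<in> ball 0 1 \<Longrightarrow> z' \<in> ball 0 1 \<Longrightarrow> norm ((\<zeta> - z) / (\<zeta> + z)) < \<delta>0 \<Longrightarrow>
       norm ((\<zeta> - z') / (\<zeta> + z')) < \<delta>0 \<Longrightarrow> norm (f z - f z') \<le> \<eta> / 2" by blast
  define \<delta> where "\<delta> = min 1 \<delta>0"
  have \<delta>: "0 < \<delta>" "\<delta> \<le> 1" "\<delta> \<le> \<delta>0" using \<delta>0 by (auto simp: \<delta>_def)
  have small: "norm ((\<zeta> - z) / (\<zeta> + z)) < \<delta>0" if "norm \<zeta> = 1" "norm (\<zeta> - z) < \<delta>" for \<zeta> z :: complex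
  proof -
    have "2 = norm ((\<zeta> + z) + (\<zeta> - z))" using that by (simp add: norm_mult flip: mult_2)
    also have "\<dots> \<le> norm (\<zeta> + z) + norm (\<zeta> - z)" by (rule norm_triangle_ineq)
    finally have "norm (\<zeta> + z) \<ge> 1" using that \<delta> by linarith
    hence "norm (\<zeta> - z) / norm (\<zeta> + z) \<le> norm (\<zeta> - z) / 1" by (intro divide_left_mono) auto
    thus ?thesis using that \<delta> by (simp add: norm_divide)
  qed
  have "uniformly_continuous_on (cball 0 (1 - \<delta>/4)) f"
    using \<delta> by (intro compact_uniformly_continuous continuous_on_subset[OF f_continuous]) auto
  then obtain d where d: "d > 0" "\<And>x y. x \<in> cball 0 (1 - \<delta>/4) \<Longrightarrow> y \<in> cball 0 (1 - \<delta>/4) \<Longrightarrow> dist y x < d \<Longrightarrow> dist (f y) (f x) < \<eta>"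
    using \<open>\<eta> > 0\<close> unfolding uniformly_continuous_on_def by meson
  show "\<exists>d>0. \<forall>x\<in>ball 0 1. \<forall>x'\<in>ball 0 1. dist x' x < d \<longrightarrow> dist (f x') (f x) < \<eta>"
  proof (intro exI[of _ "min d (\<delta>/4)"] conjI ballI impI)
    fix x x' :: complex assume x: "x \<in> ball 0 1" "x' \<in> ball 0 1" "dist x' x < min d (\<delta>/4)"
    show "dist (f x') (f x) < \<eta>"
    proof (cases "norm x \<le> 1 - \<delta>/2")
      case True
      have "norm x' \<le> norm x + norm (x' - x)" by (metis add.commute diff_add_cancel norm_triangle_ineq)
      thus ?thesis using True x \<delta> by (intro d) (auto simp: dist_norm)
    next
      case False
      define \<zeta> where "\<zeta> = x / norm x"
      have nx: "norm x > 0" using False \<delta> by auto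
      have \<zeta>: "norm \<zeta> = 1" using nx by (simp add: \<zeta>_def norm_divide)
      have "\<zeta> - x = \<zeta> * of_real (1 - norm x)" using nx by (simp add: \<zeta>_def field_simps)
      hence "norm (\<zeta> - x) = \<bar>1 - norm x\<bar>" using \<zeta> by (simp only: norm_mult norm_of_real mult_1)
      hence n1: "norm (\<zeta> - x) < \<delta>/2" using False x by simp
      have "norm (\<zeta> - x') \<le> norm (\<zeta> - x) + norm (x - x')" using norm_triangle_ineq[of "\<zeta> - x" "x - x'"] by simp
      hence n2: "norm (\<zeta> - x') < \<delta>" using n1 x \<delta>(1) by (auto simp: dist_norm norm_minus_commute)
      have "norm (f x' - f x) \<le> \<eta> / 2"
        using n1 n2 \<delta> by (intro \<delta>0(2)[OF \<zeta>] x small[OF \<zeta>]) auto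
      thus ?thesis using \<open>\<eta> > 0\<close> by (simp add: dist_norm)
    qed
  qed (use d \<delta> in auto)
qed

end

section \<open>Crossing paths in the disc\<close>

text \<open>Both paths fit into a rectangle resting on the real axis, with interlacing end points on
  its base; this is the configuration of the Fashoda theorem.\<close>

lemma half_plane_paths_meet:
  fixes p q :: "real \<Rightarrow> complex"
  assumes pq: "path p" "path q" and im: "path_image p \<subseteq> {z. Im z \<ge> 0}" "path_image q \<subseteq> {z. Im z \<ge> 0}"
    and re: "Im (pathstart p) = 0" "Im (pathfinish p) = 0" "Im (pathstart q) = 0" "Im (pathfinish q) = 0"
    and ord: "Re (pathstart p) < Re (pathstart q)" "Re (pathstart q) < Re (pathfinish p)" "Re (pathfinish p) < Re (pathfinish q)"
  shows "path_image p \<inter> path_image q \<noteq> {}"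
proof -
  define V :: "complex \<Rightarrow> real^2" where "V z = vector [Re z, Im z]" for z
  have V: "vec_nth (V z) 1 = Re z" "vec_nth (V z) 2 = Im z" for z by (auto simp: V_def)
  have injV: "V z = V w \<Longrightarrow> z = w" for z w by (metis V complex_eqI)
  have "linear V" by (auto intro!: linearI simp: V_def vec_eq_iff forall_2)
  hence cV: "continuous_on A V" for A by (intro linear_continuous_on) (simp add: linear_conv_bounded_linear)
  obtain R where R: "\<And>z. z \<in> path_image p \<union> path_image q \<Longrightarrow> norm z \<le> R"
    using compact_imp_bounded[OF compact_Un[OF compact_path_image[OF pq(1)] compact_path_image[OF pq(2)]]]
    by (auto simp: bounded_iff)
  have box: "V z \<in> cbox (vector [-R,0]) (vector [R,R])" if "z \<in> path_image p \<union> path_image q" for z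
  proof -
    have "\<bar>Re z\<bar> \<le> R" "\<bar>Im z\<bar> \<le> R" "Im z \<ge> 0"
      using R[OF that] abs_Re_le_cmod[of z] abs_Im_le_cmod[of z] that im by auto
    thus ?thesis by (auto simp: mem_box_cart forall_2 V)
  qed
  obtain y where "y \<in> path_image (V \<circ> p)" "y \<in> path_image (V \<circ> q)"
  proof (rule fashoda_interlace[of "V \<circ> p" "V \<circ> q" "vector [-R,0]" "vector [R,R]"])
    show "path (V \<circ> p)" "path (V \<circ> q)" using pq cV by (auto intro: path_continuous_image)
    show "path_image (V \<circ> p) \<subseteq> cbox (vector [-R,0]) (vector [R,R])"
      "path_image (V \<circ> q) \<subseteq> cbox (vector [-R,0]) (vector [R,R])"
      using box by (auto simp: path_image_compose)
  qed (use re ord in \<open>auto simp: pathstart_compose pathfinish_compose V\<close>)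
  thus ?thesis using injV by (auto simp: path_image_compose)
qed

text \<open>The Cayley map with pole \<open>cis \<theta>\<close> unrolls the rest of the circle onto
  the real line. The coordinate -cot (\<phi> / 2) increases with the angle, so the order of points
  is preserved.\<close>

lemma half_plane_chart_cis:
  fixes \<theta> \<phi> :: real
  assumes \<phi>: "0 < \<phi>" "\<phi> < 2 * pi"
  shows "\<i> * (cis \<theta> + cis (\<theta> + \<phi>)) / (cis \<theta> - cis (\<theta> + \<phi>)) = of_real (- cot (\<phi> / 2))"
proof -
  define a where "a = \<phi> / 2"
  have s: "sin a > 0" using \<phi> by (intro sin_gt_zero) (auto simp: a_def)
  have c: "cis \<phi> = Complex (1 - 2 * (sin a)\<^sup>2) (2 * sin a * cos a)"
    using cos_double_sin[of a] sin_double[of a] by (simp add: a_def complex_eq_iff)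
  have ne: "1 - cis \<phi> \<noteq> 0" using s by (auto simp: c complex_eq_iff)
  have "\<i> * (1 + cis \<phi>) = of_real (- cot a) * (1 - cis \<phi>)"
    unfolding c using s
    by (auto simp: complex_eq_iff cot_def divide_simps power2_eq_square) (simp_all add: algebra_simps sin_squared_eq flip: power2_eq_square)
  hence "\<i> * (1 + cis \<phi>) / (1 - cis \<phi>) = of_real (- cot a)" using ne by (simp add: field_simps)
  moreover have "\<i> * (cis \<theta> + cis (\<theta> + \<phi>)) / (cis \<theta> - cis (\<theta> + \<phi>)) = (cis \<theta> * (\<i> * (1 + cis \<phi>))) / (cis \<theta> * (1 - cis \<phi>))"
    by (simp add: algebra_simps flip: cis_mult)
  ultimately show ?thesis by (simp add: a_def)
qed

lemma cot_strict_antimono: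
  fixes a b :: real
  assumes "0 < a" "a < b" "b < pi"
  shows "cot b < cot a"
proof -
  have s: "sin a > 0" "sin b > 0" "sin (b - a) > 0" using assms by (auto intro!: sin_gt_zero)
  have "cot a - cot b = sin (b - a) / (sin a * sin b)"
    using s by (simp add: cot_def sin_diff field_simps)
  also have "\<dots> > 0" using s by simp
  finally show ?thesis by simp
qed

lemma disc_paths_meet:
  fixes p q :: "real \<Rightarrow> complex"
  assumes pq: "path p" "path q"
    and ends: "pathstart p = cis s1" "pathfinish p = cis s3" "pathstart q = cis s2" "pathfinish q = cis s4"
    and s: "s1 < s2" "s2 < s3" "s3 < s4" "s4 < s1 + 2 * pi"
    and im: "path_image p \<subseteq> ball 0 1 \<union> {cis s1, cis s3}" "path_image q \<subseteq> ball 0 1 \<union> {cis s2, cis s4}"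
  shows "path_image p \<inter> path_image q \<noteq> {}"
proof -
  \<comment> \<open>The pole is the midpoint of the arc from \<open>s4\<close> to
    \<open>s1 + 2 * pi\<close>, which contains no end point of the paths. Subtracting 2 * pi puts it
    below \<open>s1\<close>, and all four angles then lie within one turn after it.\<close>
  define \<theta> where "\<theta> = (s4 + s1 + 2 * pi) / 2 - 2 * pi"
  define e where "e = cis \<theta>"
  have \<theta>: "0 < s - \<theta>" "s - \<theta> < 2 * pi" if "s1 \<le> s" "s \<le> s4" for s using s that by (auto simp: \<theta>_def field_simps)
  define m where "m z = \<i> * (e + z) / (e - z)" for z
  define c where "c s = - cot ((s - \<theta>) / 2)" for s
  have mcis: "m (cis s) = of_real (c s)" if "s1 \<le> s" "s \<le> s4" for s
    using half_plane_chart_cis[OF \<theta>[OF that], of \<theta>] by (simp add: m_def e_def c_def)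
  have ne: "cis s \<noteq> e" if s': "s1 \<le> s" "s \<le> s4" for s
  proof
    assume "cis s = e"
    hence "cis (s - \<theta>) = 1" by (simp add: e_def flip: cis_divide)
    hence "cos (s - \<theta>) = 1" by (simp add: complex_eq_iff)
    moreover define a where "a = (s - \<theta>) / 2"
    have "s - \<theta> = 2 * a" by (simp add: a_def)
    ultimately have "1 - 2 * (sin a)\<^sup>2 = 1" using cos_double_sin[of a] by metis
    hence "sin a = 0" by simp
    moreover have "sin a > 0" using \<theta>[OF s'] by (intro sin_gt_zero) (auto simp: a_def)
    ultimately show False by simp
  qed
  have good: "z \<noteq> e \<and> norm z \<le> 1" if "z \<in> path_image p \<union> path_image q" for z
  proof -
    from that im have "norm z < 1 \<or> z \<in> {cis s1, cis s2, cis s3, cis s4}" by auto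
    thus ?thesis using ne[of s1] ne[of s2] ne[of s3] ne[of s4] s by (auto simp: e_def)
  qed
  have cm: "continuous_on (path_image p \<union> path_image q) m"
    unfolding m_def using good by (intro continuous_intros) auto
  have im0: "Im (m z) \<ge> 0" if "z \<in> path_image p \<union> path_image q" for z
  proof -
    have z: "z \<noteq> e" "norm z \<le> 1" using good[OF that] by auto
    have "Im (m z) = Re ((e + z) / (e - z))" by (simp add: m_def times_divide_eq_right[symmetric] del: times_divide_eq_right)
    also have "\<dots> = Re ((e + z) * cnj (e - z)) / (norm (e - z))\<^sup>2"
      by (simp add: Re_divide cmod_power2 field_simps)
    also have "Re ((e + z) * cnj (e - z)) = (norm e)\<^sup>2 - (norm z)\<^sup>2"
      unfolding cmod_power2 by (simp add: algebra_simps power2_eq_square)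
    finally show ?thesis using z by (simp add: e_def power_le_one)
  qed
  have cmono: "c s < c t" if "s1 \<le> s" "s < t" "t \<le> s4" for s t
    unfolding c_def using \<theta>[of s] \<theta>[of t] that by (intro iffD2[OF neg_less_iff_less] cot_strict_antimono) auto
  have mi: "m z = m w \<Longrightarrow> z = w" if "z \<noteq> e" "w \<noteq> e" for z w
  proof -
    assume "m z = m w"
    hence "(e + z) * (e - w) = (e + w) * (e - z)" using that by (auto simp: m_def field_simps)
    hence "2 * e * (z - w) = 0" by (simp add: algebra_simps)
    thus "z = w" by (simp add: e_def)
  qed
  have "path_image (m \<circ> p) \<inter> path_image (m \<circ> q) \<noteq> {}"
  proof (rule half_plane_paths_meet)
    show "path (m \<circ> p)" "path (m \<circ> q)" using pq cm by (auto intro!: path_continuous_image intro: continuous_on_subset)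
  qed (use im0 mcis s cmono in \<open>auto simp: path_image_compose pathstart_compose pathfinish_compose ends\<close>)
  then obtain z w where "z \<in> path_image p" "w \<in> path_image q" "m z = m w" by (auto simp: path_image_compose)
  thus ?thesis using mi[of z w] good by blast
qed

section \<open>Boundary values in a fixed direction\<close>

text \<open>The modulus of exp (\<i> * \<Psi>) is exp (- Im \<Psi>), so an interior minimum of
  \<open>V\<close> is a maximum of a modulus. Then \<open>V\<close> is constant in the disc and, by
  continuity, takes the same value at the boundary point 1.\<close>

lemma Im_min_principle:
  fixes \<Psi> :: "complex \<Rightarrow> complex" and V :: "complex \<Rightarrow> real"
  assumes hol: "\<Psi> holomorphic_on ball 0 1" and cV: "continuous_on (cball 0 1) V"
    and eq: "\<And>z. norm z < 1 \<Longrightarrow> V z = Im (\<Psi> z)" and bd: "\<And>z. norm z = 1 \<Longrightarrow> V z \<ge> m"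
    and z: "norm z \<le> 1"
  shows "V z \<ge> m"
proof -
  obtain z0 where z0: "z0 \<in> cball 0 1" "\<And>w. w \<in> cball 0 1 \<Longrightarrow> V z0 \<le> V w"
    using continuous_attains_inf[OF compact_cball _ cV] by (auto simp: ex_in_conv[symmetric])
  have "V z0 \<ge> m"
  proof (rule ccontr)
    assume less: "\<not> V z0 \<ge> m"
    hence z0b: "norm z0 < 1" using bd[of z0] z0 by force
    have "(\<lambda>z. exp (\<i> * \<Psi> z)) constant_on ball 0 1"
    proof (rule maximum_modulus_principle[where \<xi> = z0 and U = "ball 0 1"])
      show "(\<lambda>z. exp (\<i> * \<Psi> z)) holomorphic_on ball 0 1" by (intro holomorphic_intros hol)
      fix w :: complex assume "w \<in> ball 0 1"
      thus "norm (exp (\<i> * \<Psi> w)) \<le> norm (exp (\<i> * \<Psi> z0))"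
        using z0(2)[of w] eq[of w] eq[OF z0b] by simp
    qed (use z0b in auto)
    then obtain y where y: "\<And>w. norm w < 1 \<Longrightarrow> exp (\<i> * \<Psi> w) = y" by (auto simp: constant_on_def)
    have "V w = V z0" if "norm w < 1" for w
    proof -
      have "norm (exp (\<i> * \<Psi> w)) = norm (exp (\<i> * \<Psi> z0))" using y[OF that] y[OF z0b] by simp
      thus ?thesis using eq[OF that] eq[OF z0b] by simp
    qed
    hence "V 1 = V z0"
      using continuous_constant_on_closure[of "ball 0 1" V "V z0" 1] cV by auto
    thus False using bd[of 1] less by simp
  qed
  thus ?thesis using z0(2)[of z] z by auto
qed

section \<open>The hyperbolic flow of the disc\<close>

text \<open>The map is the disc automorphism with fixed points \<open>a\<close> and
  \<open>-a\<close> that pushes towards \<open>a\<close>. Everything rests on |1 + s cnj a z|^2 - |z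
  + s a|^2 = (1 - s^2) (1 - |z|^2).\<close>

lemma norm_hyperbolic_flow_le:
  fixes z a :: complex and s :: real
  assumes a: "norm a = 1" and z: "norm z \<le> 1" and s: "0 \<le> s" "s < 1"
  shows "1 + s * cnj a * z \<noteq> 0" "norm ((z + s * a) / (1 + s * cnj a * z)) \<le> 1"
    "norm z < 1 \<Longrightarrow> norm ((z + s * a) / (1 + s * cnj a * z)) < 1"
proof -
  have "norm (s * cnj a * z) = s * norm z" using a s by (simp add: norm_mult)
  also have "\<dots> \<le> s * 1" using s z by (intro mult_left_mono) auto
  finally have "norm (s * cnj a * z) < 1" using s by simp
  thus ne: "1 + s * cnj a * z \<noteq> 0" by (metis add_eq_0_iff2 norm_minus_cancel norm_one less_irrefl)
  have a2: "(Re a)\<^sup>2 + (Im a)\<^sup>2 = 1" using a by (metis cmod_power2 one_power2)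
  have "(norm (1 + s * cnj a * z))\<^sup>2 - (norm (z + s * a))\<^sup>2 = (1 + s\<^sup>2 * ((Re a)\<^sup>2 + (Im a)\<^sup>2) * (norm z)\<^sup>2) - ((norm z)\<^sup>2 + s\<^sup>2 * ((Re a)\<^sup>2 + (Im a)\<^sup>2))"
    unfolding cmod_power2 by (simp add: power2_eq_square algebra_simps)
  also have "\<dots> = (1 - s\<^sup>2) * (1 - (norm z)\<^sup>2)" unfolding a2 by (simp add: algebra_simps)
  finally have e: "(norm (1 + s * cnj a * z))\<^sup>2 - (norm (z + s * a))\<^sup>2 = (1 - s\<^sup>2) * (1 - (norm z)\<^sup>2)" .
  have s2: "1 - s\<^sup>2 > 0" using s by (simp add: power_less_one_iff)
  have "(norm (z + s * a))\<^sup>2 \<le> (norm (1 + s * cnj a * z))\<^sup>2"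
  proof -
    have "(1 - s\<^sup>2) * (1 - (norm z)\<^sup>2) \<ge> 0" using s2 z by (intro mult_nonneg_nonneg) (auto simp: power_le_one)
    thus ?thesis using e by linarith
  qed
  hence "norm (z + s * a) \<le> norm (1 + s * cnj a * z)" by (rule power2_le_imp_le) simp
  thus "norm ((z + s * a) / (1 + s * cnj a * z)) \<le> 1" using ne by (simp add: norm_divide)
  assume "norm z < 1"
  hence "(norm (z + s * a))\<^sup>2 < (norm (1 + s * cnj a * z))\<^sup>2"
  proof -
    have "(1 - s\<^sup>2) * (1 - (norm z)\<^sup>2) > 0" using s2 \<open>norm z < 1\<close> by (intro mult_pos_pos) (auto simp: power_less_one_iff)
    thus ?thesis using e by linarith
  qed
  hence "norm (z + s * a) < norm (1 + s * cnj a * z)" by (rule power2_less_imp_less) simp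
  thus "norm ((z + s * a) / (1 + s * cnj a * z)) < 1" using ne by (simp add: norm_divide)
qed

text \<open>The sign of \<open>Im\<close> distinguishes the two arcs between -1 and 1, and
  \<open>Re\<close> gives the position on an arc; so the flow with a = 1 keeps each arc and moves
  along it towards 1.\<close>

lemma hyperbolic_flow_circle:
  fixes w :: complex and s :: real
  assumes w: "norm w = 1" and s: "0 < s" "s < 1"
  defines "w' \<equiv> (w + s) / (1 + s * w)"
  shows "norm w' = 1" "Im w' = (1 - s\<^sup>2) * Im w / (norm (1 + s * w))\<^sup>2" "Im w \<noteq> 0 \<Longrightarrow> Re w < Re w'"
proof -
  have w2: "(Re w)\<^sup>2 + (Im w)\<^sup>2 = 1" using w by (metis cmod_power2 one_power2)
  have ne: "1 + s * w \<noteq> 0" using norm_hyperbolic_flow_le(1)[of 1 w s] w s by simp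
  hence npos: "(norm (1 + s * w))\<^sup>2 > 0" by simp
  have "(norm (w + s))\<^sup>2 = (norm (1 + s * w))\<^sup>2"
  proof -
    have "(norm (w + s))\<^sup>2 = ((Re w)\<^sup>2 + (Im w)\<^sup>2) + 2 * s * Re w + s\<^sup>2"
      unfolding cmod_power2 by (simp add: power2_eq_square algebra_simps)
    moreover have "(norm (1 + s * w))\<^sup>2 = 1 + 2 * s * Re w + s\<^sup>2 * ((Re w)\<^sup>2 + (Im w)\<^sup>2)"
      unfolding cmod_power2 by (simp add: power2_eq_square algebra_simps)
    ultimately show ?thesis unfolding w2 by simp
  qed
  hence "norm (w + s) = norm (1 + s * w)" by simp
  thus "norm w' = 1" using ne by (simp add: w'_def norm_divide)
  have den: "(Re (1 + s * w))\<^sup>2 + (Im (1 + s * w))\<^sup>2 = (norm (1 + s * w))\<^sup>2" by (simp only: cmod_power2)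
  show "Im w' = (1 - s\<^sup>2) * Im w / (norm (1 + s * w))\<^sup>2"
    unfolding w'_def Im_divide den by (simp add: algebra_simps power2_eq_square)
  have "Re w' = (s * (1 + ((Re w)\<^sup>2 + (Im w)\<^sup>2)) + Re w * (1 + s\<^sup>2)) / (norm (1 + s * w))\<^sup>2"
    unfolding w'_def Re_divide den by (simp add: algebra_simps power2_eq_square)
  hence re': "Re w' = (2 * s + Re w * (1 + s\<^sup>2)) / (norm (1 + s * w))\<^sup>2" unfolding w2 by simp
  have dd: "(norm (1 + s * w))\<^sup>2 = 1 + 2 * s * Re w + s\<^sup>2 * ((Re w)\<^sup>2 + (Im w)\<^sup>2)"
    unfolding cmod_power2 by (simp add: power2_eq_square algebra_simps)
  assume "Im w \<noteq> 0"
  hence "1 - (Re w)\<^sup>2 > 0" using w2 by (smt (verit) zero_less_power2)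
  hence "2 * s * (1 - (Re w)\<^sup>2) > 0" using s by simp
  moreover have "(2 * s + Re w * (1 + s\<^sup>2)) - Re w * (norm (1 + s * w))\<^sup>2 = 2 * s * (1 - (Re w)\<^sup>2)"
    unfolding dd w2 by (simp add: algebra_simps power2_eq_square)
  ultimately have "Re w * (norm (1 + s * w))\<^sup>2 < 2 * s + Re w * (1 + s\<^sup>2)" by linarith
  thus "Re w < Re w'" unfolding re' using npos by (simp add: pos_less_divide_eq)
qed

lemma cis_arccos:
  fixes w :: complex
  assumes "norm w = 1"
  shows "Im w \<ge> 0 \<Longrightarrow> w = cis (arccos (Re w))" "Im w \<le> 0 \<Longrightarrow> w = cis (- arccos (Re w))"
proof -
  have w2: "(Re w)\<^sup>2 + (Im w)\<^sup>2 = 1" using assms by (metis cmod_power2 one_power2)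
  have r: "\<bar>Re w\<bar> \<le> 1" using abs_Re_le_cmod[of w] assms by simp
  have "1 - (Re w)\<^sup>2 = (Im w)\<^sup>2" using w2 by simp
  hence "sin (arccos (Re w)) = sqrt ((Im w)\<^sup>2)" using r by (subst sin_arccos) auto
  hence s: "sin (arccos (Re w)) = \<bar>Im w\<bar>" by simp
  have c: "cos (arccos (Re w)) = Re w" using r by (intro cos_arccos) auto
  show "Im w \<ge> 0 \<Longrightarrow> w = cis (arccos (Re w))" "Im w \<le> 0 \<Longrightarrow> w = cis (- arccos (Re w))"
    using s c by (auto simp: complex_eq_iff)
qed

context bounded_convex_harm
begin

definition f_ext :: "complex \<Rightarrow> complex" where
  "f_ext = (SOME F. continuous_on (cball 0 1) F \<and> (\<forall>z\<in>ball 0 1. F z = f z))"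

lemma f_ext: "continuous_on (cball 0 1) f_ext" "norm z < 1 \<Longrightarrow> f_ext z = f z"
proof -
  obtain F where "uniformly_continuous_on (closure (ball 0 1)) F" "\<And>x. x \<in> ball 0 1 \<Longrightarrow> f x = F x"
    using uniformly_continuous_on_extension_on_closure[OF f_uniformly_continuous] by metis
  hence "\<exists>F. continuous_on (cball 0 1) F \<and> (\<forall>z\<in>ball 0 1. F z = f z)"
    using uniformly_continuous_imp_continuous by (intro exI[of _ F]) auto
  from someI_ex[OF this] show "continuous_on (cball 0 1) f_ext" "norm z < 1 \<Longrightarrow> f_ext z = f z"
    unfolding f_ext_def by auto
qed

definition v :: "complex \<Rightarrow> complex \<Rightarrow> real" where "v c z = Im (c * f_ext z)"

lemma v_minus: "v (-c) z = - v c z" by (simp add: v_def)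

lemma v_continuous: "continuous_on (cball 0 1) (v c)"
  unfolding v_def by (intro continuous_intros f_ext)

lemma v_eq: "norm z < 1 \<Longrightarrow> v c z = Im (c * h z - cnj c * g z)"
  by (simp add: v_def f_ext harm_def algebra_simps)

lemma direction_part_holomorphic: "(\<lambda>z. c * h z - cnj c * g z) holomorphic_on ball 0 1"
  by (intro holomorphic_intros hol_h hol_g)

lemma superlevel_path_connected: "path_connected {z\<in>ball 0 1. v c z > \<gamma>}"
proof -
  obtain f' where f': "homeomorphism (ball 0 1) (f ` ball 0 1) f f'" using f_homeo .
  have cf': "continuous_on (f ` ball 0 1) f'" and f'f: "\<And>z. z \<in> ball 0 1 \<Longrightarrow> f' (f z) = z"
    using f' by (auto simp: homeomorphism_def)
  have "convex {w. Im (c * w) > \<gamma>}"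
  proof -
    have "{w. Im (c * w) > \<gamma>} = {w. inner (Complex (Im c) (Re c)) w > \<gamma>}"
      by (auto simp: inner_complex_def algebra_simps)
    thus ?thesis using convex_halfspace_gt by simp
  qed
  hence "path_connected (f ` ball 0 1 \<inter> {w. Im (c * w) > \<gamma>})"
    by (intro convex_imp_path_connected convex_Int cvx)
  hence "path_connected (f' ` (f ` ball 0 1 \<inter> {w. Im (c * w) > \<gamma>}))"
    by (intro path_connected_continuous_image continuous_on_subset[OF cf']) auto
  moreover have "f' ` (f ` ball 0 1 \<inter> {w. Im (c * w) > \<gamma>}) = {z\<in>ball 0 1. v c z > \<gamma>}"
  proof safe
    fix z assume "z \<in> ball 0 1" "Im (c * f z) > \<gamma>"
    thus "f' (f z) \<in> ball 0 1" "v c (f' (f z)) > \<gamma>" using f'f[of z] by (auto simp: v_def f_ext)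
  next
    fix z assume z: "z \<in> ball 0 1" "v c z > \<gamma>"
    show "z \<in> f' ` (f ` ball 0 1 \<inter> {w. Im (c * w) > \<gamma>})"
      using z f'f[of z] by (intro image_eqI[of _ _ "f z"]) (auto simp: v_def f_ext)
  qed
  ultimately show ?thesis by simp
qed

section \<open>Boundary values do not alternate\<close>

text \<open>By continuity a short radial segment from \<open>a\<close> stays in the superlevel set,
  so a path can leave the boundary point and run inside the open disc from then on.\<close>

lemma boundary_point_reached:
  assumes a: "norm a = 1" "v c a > \<gamma>"
  obtains b where "norm b < 1" "v c b > \<gamma>" "path_component (insert a {z\<in>ball 0 1. v c z > \<gamma>}) a b"
proof -
  have "\<exists>d>0. \<forall>x\<in>cball 0 1. dist x a < d \<longrightarrow> dist (v c x) (v c a) < v c a - \<gamma>"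
    using v_continuous[of c, unfolded continuous_on_iff] a by (metis diff_gt_0_iff_gt mem_cball_0 order_refl)
  then obtain d where d0: "d > 0" "\<forall>x\<in>cball 0 1. dist x a < d \<longrightarrow> dist (v c x) (v c a) < v c a - \<gamma>" by blast
  have d: "d > 0" "v c x > \<gamma>" if "norm x \<le> 1" "dist x a < d" for x
    using d0 that by (auto simp: dist_real_def abs_less_iff)
  define e where "e = min (d/2) (1/2)"
  have e: "0 < e" "e \<le> 1/2" "e < d" using d0 by (auto simp: e_def)
  define b where "b = of_real (1 - e) * a"
  have seg: "x \<in> insert a {z\<in>ball 0 1. v c z > \<gamma>}" if x: "x \<in> closed_segment a b" for x
  proof -
    obtain t where t: "0 \<le> t" "t \<le> 1" "x = (1 - t) *\<^sub>R a + t *\<^sub>R b" using x by (auto simp: closed_segment_def)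
    have xe: "x = of_real (1 - t * e) * a" by (simp add: t b_def scaleR_conv_of_real algebra_simps)
    have te: "0 \<le> t * e" "t * e \<le> e" using t e by (auto simp: mult_left_le_one_le)
    have "1 - t * e \<ge> 0" using te e by linarith
    hence nx: "norm x = 1 - t * e" using a by (simp only: xe norm_mult norm_of_real abs_of_nonneg mult_1_right)
    have "x - a = of_real (- (t * e)) * a" by (simp add: xe algebra_simps)
    hence "dist x a = t * e" using te a by (simp only: dist_norm norm_mult norm_of_real abs_minus_cancel abs_of_nonneg mult_1_right)
    hence "v c x > \<gamma>" using d(2)[of x] nx te e by simp
    moreover have "t = 0 \<or> norm x < 1" using nx t e by (auto simp: zero_less_mult_iff)
    ultimately show ?thesis using t by auto
  qed
  have nb: "norm b = 1 - e" using e a by (simp only: b_def norm_mult norm_of_real) simp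
  have "b \<in> insert a {z\<in>ball 0 1. v c z > \<gamma>}" using seg by auto
  moreover have "b \<noteq> a" using nb e a by auto
  ultimately have "norm b < 1" "v c b > \<gamma>" by auto
  moreover have "path_component (insert a {z\<in>ball 0 1. v c z > \<gamma>}) a b"
    unfolding path_component_def using seg by (intro exI[of _ "linepath a b"]) auto
  ultimately show ?thesis using that by blast
qed

lemma boundary_path:
  assumes a: "norm a = 1" "v c a > \<gamma>" and b: "norm b = 1" "v c b > \<gamma>"
  obtains p where "path p" "pathstart p = a" "pathfinish p = b"
    "path_image p \<subseteq> insert a (insert b {z\<in>ball 0 1. v c z > \<gamma>})"
proof -
  let ?U = "{z\<in>ball 0 1. v c z > \<gamma>}"
  obtain a' where a': "norm a' < 1" "v c a' > \<gamma>" "path_component (insert a ?U) a a'"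
    using boundary_point_reached[OF a] .
  obtain b' where b': "norm b' < 1" "v c b' > \<gamma>" "path_component (insert b ?U) b b'"
    using boundary_point_reached[OF b] .
  have "path_component ?U a' b'" using superlevel_path_connected[of \<gamma> c] a' b' by (auto simp: path_connected_component)
  hence "path_component (insert a (insert b ?U)) a' b'" by (rule path_component_of_subset[rotated]) auto
  moreover have "path_component (insert a (insert b ?U)) a a'"
    by (rule path_component_of_subset[OF _ a'(3)]) auto
  moreover have "path_component (insert a (insert b ?U)) b b'"
    by (rule path_component_of_subset[OF _ b'(3)]) auto
  ultimately have "path_component (insert a (insert b ?U)) a b"
    by (meson path_component_sym path_component_trans)
  thus ?thesis using that unfolding path_component_def by blast
qed

text \<open>A path joining the first and third point above the level \<gamma> would have to cross a
  path joining the second and fourth below it.\<close>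

lemma no_alternation:
  assumes s: "s1 < s2" "s2 < s3" "s3 < s4" "s4 < s1 + 2 * pi"
    and hi: "v c (cis s1) > \<gamma>" "v c (cis s3) > \<gamma>" and lo: "v c (cis s2) < \<gamma>" "v c (cis s4) < \<gamma>"
  shows False
proof -
  obtain p where p: "path p" "pathstart p = cis s1" "pathfinish p = cis s3"
    "path_image p \<subseteq> insert (cis s1) (insert (cis s3) {z\<in>ball 0 1. v c z > \<gamma>})"
    using boundary_path[of "cis s1" \<gamma> c "cis s3"] hi by auto
  obtain q where q: "path q" "pathstart q = cis s2" "pathfinish q = cis s4"
    "path_image q \<subseteq> insert (cis s2) (insert (cis s4) {z\<in>ball 0 1. v (-c) z > -\<gamma>})"
    using boundary_path[of "cis s2" "-\<gamma>" "-c" "cis s4"] lo by (auto simp: v_minus)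
  have "path_image p \<inter> path_image q \<noteq> {}"
    by (rule disc_paths_meet[OF p(1) q(1) p(2,3) q(2,3) s]) (use p(4) q(4) in auto)
  then obtain z where z: "z \<in> path_image p" "z \<in> path_image q" by blast
  have "v c z > \<gamma>" using z(1) p(4) hi by auto
  moreover have "v c z < \<gamma>" using z(2) q(4) lo by (auto simp: v_minus)
  ultimately show False by simp
qed

end

context bounded_convex_harm
begin

lemma no_alternation':
  assumes "s1 < s2" "s2 < s3" "s3 < s4" "s4 < s1 + 2 * pi"
    and "v c (cis s1) < \<gamma>" "v c (cis s3) < \<gamma>" "v c (cis s2) > \<gamma>" "v c (cis s4) > \<gamma>"
  shows False
  using no_alternation[OF assms(1-4), of "-\<gamma>" "-c"] assms(5-8) by (simp add: v_minus)

text \<open>By the minimum principle for \<open>c\<close> and \<open>-c\<close>, constant boundary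
  values would make Im (c f) constant in the disc, and the image of \<open>f\<close> would lie on a
  line although it is open.\<close>

lemma v_not_constant:
  assumes "c \<noteq> 0" "\<And>z. norm z = 1 \<Longrightarrow> v c z = m"
  shows False
proof -
  have lo: "v c z \<ge> m" if "norm z < 1" for z
    by (rule Im_min_principle[OF direction_part_holomorphic v_continuous v_eq]) (use assms that in auto)
  have hi: "v (-c) z \<ge> -m" if "norm z < 1" for z
    by (rule Im_min_principle[OF direction_part_holomorphic v_continuous v_eq]) (use assms that in \<open>auto simp: v_minus\<close>)
  have eq: "Im (c * f z) = m" if "z \<in> ball 0 1" for z
  proof -
    have "norm z < 1" using that by simp
    from lo[OF this] hi[OF this] show ?thesis using f_ext(2)[OF \<open>norm z < 1\<close>] by (simp add: v_minus v_def)
  qed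
  have m: "m = 0" using eq[of 0] zero by simp
  have "open (f ` ball 0 1)" by (rule f_open_image) auto
  moreover have "0 \<in> f ` ball 0 1" using zero by (intro image_eqI[of _ _ 0]) auto
  ultimately obtain d where d: "d > 0" "cball 0 d \<subseteq> f ` ball 0 1" by (meson open_contains_cball)
  \<comment> \<open>The point at distance \<open>d\<close> from 0 where \<open>Im (c * w)\<close> is
    largest; its value there is d * norm c.\<close>
  define w where "w = of_real (d / norm c) * (\<i> * cnj c)"
  have "norm w = d" using d assms(1) by (simp add: w_def norm_mult norm_divide)
  hence "w \<in> f ` ball 0 1" using d by auto
  hence "Im (c * w) = 0" using eq m by auto
  moreover have "c * w = of_real (d / norm c) * \<i> * of_real ((norm c)\<^sup>2)"
    unfolding w_def complex_norm_square by (simp only: mult_ac)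
  hence "Im (c * w) = d / norm c * (norm c)\<^sup>2" by simp
  ultimately show False using d assms(1) by simp
qed

section \<open>Extremal boundary points\<close>

text \<open>Minimum points are \<open>max_points (-c)\<close>, by \<open>v_minus\<close>, so one
  notion covers both extremes.\<close>

definition max_points :: "complex \<Rightarrow> complex set" where
  "max_points c = {z. norm z = 1 \<and> (\<forall>w. norm w = 1 \<longrightarrow> v c w \<le> v c z)}"

lemma max_points_nonempty: "max_points c \<noteq> {}"
proof -
  have "\<exists>x\<in>sphere 0 1. \<forall>y\<in>sphere 0 1. v c y \<le> v c x"
    by (rule continuous_attains_sup) (auto intro: continuous_on_subset[OF v_continuous])
  thus ?thesis by (auto simp: max_points_def)
qed

lemma max_points_disjoint:
  assumes "c \<noteq> 0" shows "max_points c \<inter> max_points (-c) = {}"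
proof (rule ccontr)
  assume "max_points c \<inter> max_points (-c) \<noteq> {}"
  then obtain z where z: "z \<in> max_points c" "z \<in> max_points (-c)" by blast
  have "v c w = v c z" if "norm w = 1" for w
    using z that by (auto simp: max_points_def v_minus intro: antisym)
  thus False using v_not_constant[OF assms] by blast
qed

text \<open>Cut the circle at a minimum point. A non-maximal angle between two maximal ones would,
  together with the cut, give values low, high, low, high.\<close>

lemma max_points_connected:
  assumes c: "c \<noteq> 0" shows "connected (max_points c)"
proof -
  obtain x0 where x0: "x0 \<in> max_points (-c)" using max_points_nonempty by blast
  have nx0: "norm x0 = 1" using x0 by (simp add: max_points_def)
  have x0M: "x0 \<notin> max_points c" using max_points_disjoint[OF c] x0 by blast
  define t0 where "t0 = Arg2pi x0"
  have ct0: "cis t0 = x0" using nx0 Arg2pi_eq[of x0] by (simp add: t0_def cis_conv_exp mult.commute)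
  define I where "I = {t \<in> {t0<..<t0 + 2 * pi}. cis t \<in> max_points c}"
  have lt: "v c (cis t) < v c z" if "z \<in> max_points c" "cis t \<notin> max_points c" for z t
  proof -
    from that(2) obtain w where w: "norm w = 1" "v c w > v c (cis t)" by (auto simp: max_points_def not_le)
    moreover have "v c w \<le> v c z" using that(1) w by (auto simp: max_points_def)
    ultimately show ?thesis by simp
  qed
  have "is_interval I"
    unfolding is_interval_1
  proof (intro ballI allI impI)
    fix t1 t3 t2 assume t: "t1 \<in> I" "t3 \<in> I" "t1 \<le> t2 \<and> t2 \<le> t3"
    show "t2 \<in> I"
    proof (rule ccontr)
      assume "t2 \<notin> I"
      hence nt2: "cis t2 \<notin> max_points c" using t by (auto simp: I_def)
      have "t2 \<noteq> t1" "t2 \<noteq> t3" using nt2 t by (auto simp: I_def)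
      hence t': "t0 < t1" "t1 < t2" "t2 < t3" "t3 < t0 + 2 * pi" using t by (auto simp: I_def)
      have M: "cis t1 \<in> max_points c" "cis t3 \<in> max_points c" using t by (auto simp: I_def)
      have eq: "v c (cis t1) = v c (cis t3)" using M by (auto simp: max_points_def intro: antisym)
      define \<gamma> where "\<gamma> = (max (v c (cis t0)) (v c (cis t2)) + v c (cis t1)) / 2"
      have "v c (cis t0) < v c (cis t1)" "v c (cis t2) < v c (cis t1)"
        using lt[OF M(1)] nt2 x0M ct0 by auto
      hence "v c (cis t0) < \<gamma>" "v c (cis t2) < \<gamma>" "v c (cis t1) > \<gamma>" "v c (cis t3) > \<gamma>"
        using eq by (auto simp: \<gamma>_def max_def field_simps)
      thus False using no_alternation'[OF t', of c \<gamma>] by blast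
    qed
  qed
  hence "connected I" by (simp add: is_interval_connected)
  hence "connected (cis ` I)" by (intro connected_continuous_image continuous_intros)
  moreover have "cis ` I = max_points c"
  proof safe
    fix z assume z: "z \<in> max_points c"
    hence nz: "norm z = 1" by (simp add: max_points_def)
    define \<tau> where "\<tau> = Arg2pi (z / x0)"
    have "cis \<tau> = z / x0" using nz nx0 Arg2pi_eq[of "z / x0"] by (simp add: \<tau>_def cis_conv_exp mult.commute norm_divide)
    hence cz: "cis (t0 + \<tau>) = z" using ct0 nx0 by (auto simp flip: cis_mult)
    have "\<tau> \<noteq> 0" using cz ct0 z x0M by auto
    moreover have "0 \<le> \<tau>" "\<tau> < 2 * pi" using Arg2pi[of "z / x0"] by (auto simp: \<tau>_def)
    ultimately have "t0 + \<tau> \<in> I" using cz z by (auto simp: I_def)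
    thus "z \<in> cis ` I" using cz by (metis imageI)
  qed (auto simp: I_def)
  ultimately show ?thesis by simp
qed

text \<open>Extremal points need not be unique, so they are treated as a relation. It is closed
  jointly in direction and points because \<open>v\<close> is continuous, and its projection to the
  directions is then compact.\<close>

lemma compact_extremal_pairs:
  "compact {(c, a, b). norm c = 1 \<and> a \<in> max_points c \<and> b \<in> max_points (-c) \<and> Im (a * cnj b) \<ge> 0}"
proof -
  let ?S = "sphere (0::complex) 1"
  let ?T = "?S \<times> ?S \<times> ?S"
  have cf_ext: "continuous_on ?S f_ext" by (rule continuous_on_subset[OF f_ext(1)]) auto
  have cT: "closed ?T" by (intro closed_Times closed_sphere)
  have "closed ({x\<in>?T. 0 \<le> Im (fst (snd x) * cnj (snd (snd x)))} \<inter>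
     (\<Inter>w\<in>?S. {x\<in>?T. v (fst x) w \<le> v (fst x) (fst (snd x))}) \<inter> (\<Inter>w\<in>?S. {x\<in>?T. v (fst x) (snd (snd x)) \<le> v (fst x) w}))"
    (is "closed ?K")
    unfolding v_def
    by (intro closed_Int closed_INT ballI continuous_on_closed_Collect_le cT continuous_intros continuous_on_compose2[OF cf_ext]) auto
  hence "compact (?T \<inter> ?K)" by (intro compact_Int_closed compact_Times compact_sphere)
  moreover have "?T \<inter> ?K = {(c, a, b). norm c = 1 \<and> a \<in> max_points c \<and> b \<in> max_points (-c) \<and> Im (a * cnj b) \<ge> 0}"
  proof (rule set_eqI)
    fix x :: "complex \<times> complex \<times> complex"
    obtain c a b where x: "x = (c, a, b)" by (cases x)
    have "x \<in> ?T \<inter> ?K \<longleftrightarrow> c \<in> ?S \<and> a \<in> ?S \<and> b \<in> ?S \<and> 0 \<le> Im (a * cnj b) \<and>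
            (\<forall>w\<in>?S. v c w \<le> v c a) \<and> (\<forall>w\<in>?S. v c b \<le> v c w)"
      unfolding x by (simp only: Int_iff mem_Times_iff INT_iff mem_Collect_eq fst_conv snd_conv) blast
    also have "\<dots> \<longleftrightarrow> norm c = 1 \<and> a \<in> max_points c \<and> b \<in> max_points (-c) \<and> Im (a * cnj b) \<ge> 0"
      by (simp only: max_points_def v_minus neg_le_iff_le mem_Collect_eq mem_sphere_0 Ball_def) blast
    finally show "x \<in> ?T \<inter> ?K \<longleftrightarrow> x \<in> {(c, a, b). norm c = 1 \<and> a \<in> max_points c \<and> b \<in> max_points (-c) \<and> Im (a * cnj b) \<ge> 0}"
      unfolding x by simp
  qed
  ultimately show ?thesis by simp
qed

text \<open>Two closed sets of directions, one for each sign of \<open>Im (a * cnj b)\<close>, cover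
  the circle and hence share some \<open>c\<close>. Over this \<open>c\<close> the connected set
  \<open>max_points c \<times> max_points (-c)\<close> carries both signs, so the expression
  vanishes at some pair. Then b = a or b = -a, and the former would make a maximum point a minimum
  point.\<close>

lemma exists_antipodal_extrema:
  obtains c a where "norm c = 1" "a \<in> max_points c" "-a \<in> max_points (-c)"
proof -
  \<comment> \<open>Replacing \<open>c\<close> by \<open>-c\<close> swaps maxima and minima and flips the sign of \<open>Im (a * cnj b)\<close>.\<close>
  define P where "P = fst ` {(c, a, b). norm c = 1 \<and> a \<in> max_points c \<and> b \<in> max_points (-c) \<and> Im (a * cnj b) \<ge> 0}"
  have Pmem: "c \<in> P \<longleftrightarrow> norm c = 1 \<and> (\<exists>a\<in>max_points c. \<exists>b\<in>max_points (-c). Im (a * cnj b) \<ge> 0)" for c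
    by (force simp: P_def)
  have "compact P" unfolding P_def by (intro compact_continuous_image compact_extremal_pairs continuous_intros)
  hence clP: "closed P" "closed (uminus ` P)"
    by (auto intro!: compact_imp_closed compact_continuous_image continuous_intros)
  have Nmem: "c \<in> uminus ` P \<longleftrightarrow> norm c = 1 \<and> (\<exists>a\<in>max_points c. \<exists>b\<in>max_points (-c). Im (a * cnj b) \<le> 0)" for c
  proof -
    have "c \<in> uminus ` P \<longleftrightarrow> -c \<in> P" by (metis image_iff minus_minus)
    also have "\<dots> \<longleftrightarrow> norm c = 1 \<and> (\<exists>a\<in>max_points (-c). \<exists>b\<in>max_points c. Im (a * cnj b) \<ge> 0)" by (simp add: Pmem)
    also have "\<dots> \<longleftrightarrow> norm c = 1 \<and> (\<exists>a\<in>max_points c. \<exists>b\<in>max_points (-c). Im (a * cnj b) \<le> 0)"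
    proof -
      have "Im (a * cnj b) \<ge> 0 \<longleftrightarrow> Im (b * cnj a) \<le> 0" for a b by (auto simp: algebra_simps)
      thus ?thesis by blast
    qed
    finally show ?thesis .
  qed
  have cover: "sphere 0 1 \<subseteq> P \<union> uminus ` P"
  proof
    fix c :: complex assume c: "c \<in> sphere 0 1"
    obtain a b where "a \<in> max_points c" "b \<in> max_points (-c)" using max_points_nonempty by blast
    thus "c \<in> P \<union> uminus ` P" unfolding Un_iff Pmem Nmem using c linear[of 0 "Im (a * cnj b)"] by auto
  qed
  have "1 \<in> sphere (0::complex) 1" by simp
  hence "1 \<in> P \<union> uminus ` P" using cover by blast
  hence ne: "P \<noteq> {}" by auto
  have sub: "P \<subseteq> sphere 0 1" by (auto simp: Pmem)
  have sub': "uminus ` P \<subseteq> sphere 0 1" using sub by auto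
  have conS: "connected (sphere (0::complex) 1)" by (rule connected_sphere) auto
  have "P \<inter> uminus ` P \<noteq> {}"
  proof
    assume "P \<inter> uminus ` P = {}"
    hence "P \<inter> uminus ` P \<inter> sphere 0 1 = {}" by blast
    from connected_closedD[OF conS this cover clP] have "P = {} \<or> uminus ` P = {}" using sub sub' by blast
    thus False using ne by blast
  qed
  then obtain c where "c \<in> P" "c \<in> uminus ` P" by blast
  then obtain a1 b1 a2 b2 where c: "norm c = 1" and ab: "a1 \<in> max_points c" "b1 \<in> max_points (-c)" "Im (a1 * cnj b1) \<ge> 0"
     "a2 \<in> max_points c" "b2 \<in> max_points (-c)" "Im (a2 * cnj b2) \<le> 0"
    unfolding Pmem Nmem by blast
  have c0: "c \<noteq> 0" using c by auto
  have "connected (max_points c \<times> max_points (-c))" using max_points_connected[OF c0] max_points_connected[of "-c"] c0 by (intro connected_Times) auto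
  hence con: "connected ((\<lambda>x. Im (fst x * cnj (snd x))) ` (max_points c \<times> max_points (-c)))"
    by (intro connected_continuous_image continuous_intros)
  have "0 \<in> (\<lambda>x. Im (fst x * cnj (snd x))) ` (max_points c \<times> max_points (-c))"
    by (rule connectedD_interval[OF con, of "Im (a2 * cnj b2)" "Im (a1 * cnj b1)"]) (use ab in force)+
  then obtain a b where ab: "a \<in> max_points c" "b \<in> max_points (-c)" "Im (a * cnj b) = 0" by force
  have nab: "norm a = 1" "norm b = 1" using ab by (auto simp: max_points_def)
  have "norm (a * cnj b) = 1" using nab by (simp add: norm_mult)
  hence "\<bar>Re (a * cnj b)\<bar> = 1" using ab(3) by (simp add: cmod_eq_Re)
  hence "a * cnj b = 1 \<or> a * cnj b = -1" using ab(3) by (auto simp: complex_eq_iff abs_if split: if_splits)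
  moreover have "cnj b * b = 1" using nab by (metis complex_norm_square mult.commute of_real_1 one_power2)
  hence "a = (a * cnj b) * b" by (simp add: mult.assoc)
  ultimately have "a = b \<or> a = -b" by (metis mult_1 mult_minus1)
  hence "b = -a" using max_points_disjoint[OF c0] ab by auto
  thus ?thesis using that c ab by blast
qed

section \<open>Monotonicity along the flow\<close>

text \<open>If the value dropped from \<open>a * w\<close> to \<open>a * w'\<close>, these two
  points together with the maximum \<open>a\<close> and the minimum \<open>-a\<close> would
  alternate around the circle about some level \<gamma>.\<close>

lemma v_flow_circle:
  assumes c: "a \<in> max_points c" "-a \<in> max_points (-c)" and z: "norm z = 1" and s: "0 < s" "s < (1::real)"
  shows "v c z \<le> v c ((z + s * a) / (1 + s * cnj a * z))"
proof -
  have a: "norm a = 1" using c by (simp add: max_points_def)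
  define \<alpha> where "\<alpha> = Arg2pi a"
  have ca: "cis \<alpha> = a" using a Arg2pi_eq[of a] by (simp add: \<alpha>_def cis_conv_exp mult.commute)
  have hi: "v c y \<le> v c a" if "norm y = 1" for y using c that by (simp add: max_points_def)
  have lo: "v c (-a) \<le> v c y" if "norm y = 1" for y using c that by (simp add: max_points_def v_minus)
  define w where "w = cnj a * z"
  define w' where "w' = (w + s) / (1 + s * w)"
  have aa: "a * cnj a = 1" using a by (metis complex_norm_square of_real_1 one_power2)
  have zw: "z = a * w" using aa by (simp add: w_def flip: mult.assoc)
  have zw': "(z + s * a) / (1 + s * cnj a * z) = a * w'"
    unfolding w'_def zw using aa by (simp add: algebra_simps)
  have nw: "norm w = 1" using a z by (simp add: w_def norm_mult)
  note F = hyperbolic_flow_circle[OF nw s, folded w'_def]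
  have r: "\<bar>Re w\<bar> \<le> 1" "\<bar>Re w'\<bar> \<le> 1" using abs_Re_le_cmod[of w] abs_Re_le_cmod[of w'] nw F(1) by auto
  have den: "(norm (1 + s * w))\<^sup>2 > 0" using norm_hyperbolic_flow_le(1)[of 1 w s] nw s by simp
  have s2: "1 - s\<^sup>2 > 0" using s by (simp add: power_less_one_iff)
  consider "Im w = 0" | "Im w > 0" | "Im w < 0" by linarith
  hence "v c (a * w) \<le> v c (a * w')"
  proof cases
    case 1
    have "w = 1 \<or> w = -1" using 1 nw by (auto simp: complex_eq_iff cmod_eq_Re abs_if split: if_splits)
    moreover have "1 + complex_of_real s \<noteq> 0" "1 - complex_of_real s \<noteq> 0" using s
      by (auto simp: complex_eq_iff)
    ultimately have "w' = w" unfolding w'_def by (auto simp: field_simps)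
    thus ?thesis by simp
  next
    case 2
    define \<theta> \<theta>' where "\<theta> = arccos (Re w)" and "\<theta>' = arccos (Re w')"
    have im': "Im w' > 0" unfolding F(2) using 2 den s2 by simp
    have w: "w = cis \<theta>" "w' = cis \<theta>'" using cis_arccos(1)[OF nw] cis_arccos(1)[OF F(1)] 2 im' by (auto simp: \<theta>_def \<theta>'_def)
    have "\<theta>' < \<theta>" unfolding \<theta>_def \<theta>'_def using F(3) 2 r by (intro arccos_less_arccos) auto
    moreover have "\<theta>' \<noteq> 0" "\<theta> \<noteq> pi" using im' 2 unfolding w by auto
    moreover have "0 \<le> \<theta>'" "\<theta> \<le> pi" unfolding \<theta>_def \<theta>'_def using r by (auto intro!: arccos_lbound arccos_ubound)
    ultimately have ord: "\<alpha> < \<alpha> + \<theta>'" "\<alpha> + \<theta>' < \<alpha> + \<theta>" "\<alpha> + \<theta> < \<alpha> + pi" "\<alpha> + pi < \<alpha> + 2 * pi" by auto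
    have cs: "cis (\<alpha> + \<theta>') = a * w'" "cis (\<alpha> + \<theta>) = a * w" "cis (\<alpha> + pi) = -a"
      by (auto simp: ca w simp flip: cis_mult)
    show ?thesis
    proof (rule ccontr)
      assume "\<not> v c (a * w) \<le> v c (a * w')"
      then obtain \<gamma> where \<gamma>: "v c (a * w') < \<gamma>" "\<gamma> < v c (a * w)" using dense by (auto simp: not_le)
      have "v c (a * w) \<le> v c a" "v c (-a) \<le> v c (a * w')" using hi[of "a * w"] lo[of "a * w'"] a nw F(1) by (auto simp: norm_mult)
      hence "v c a > \<gamma>" "v c (-a) < \<gamma>" using \<gamma> by linarith+
      thus False using no_alternation[OF ord, of \<gamma> c, unfolded cs ca] \<gamma> by blast
    qed
  next
    case 3
    define \<theta> \<theta>' where "\<theta> = - arccos (Re w)" and "\<theta>' = - arccos (Re w')"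
    have im': "Im w' < 0" unfolding F(2) using 3 den s2 by (simp add: divide_neg_pos mult_pos_neg)
    have w: "w = cis \<theta>" "w' = cis \<theta>'" using cis_arccos(2)[OF nw] cis_arccos(2)[OF F(1)] 3 im' by (auto simp: \<theta>_def \<theta>'_def)
    have "\<theta> < \<theta>'" unfolding \<theta>_def \<theta>'_def using F(3) 3 r by (intro iffD2[OF neg_less_iff_less] arccos_less_arccos) auto
    moreover have "\<theta>' \<noteq> 0" "\<theta> \<noteq> -pi" using im' 3 unfolding w by auto
    moreover have "\<theta>' \<le> 0" "-pi \<le> \<theta>" unfolding \<theta>_def \<theta>'_def using r by (auto intro!: arccos_lbound arccos_ubound)
    \<comment> \<open>On this arc the cyclic order is started at \<open>-a\<close>, so the values
      run low, high, low, high and \<open>no_alternation'\<close> is the matching form.\<close>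
    ultimately have ord: "\<alpha> - pi < \<alpha> + \<theta>" "\<alpha> + \<theta> < \<alpha> + \<theta>'" "\<alpha> + \<theta>' < \<alpha>" "\<alpha> < \<alpha> - pi + 2 * pi" by auto
    have cs: "cis (\<alpha> + \<theta>') = a * w'" "cis (\<alpha> + \<theta>) = a * w" "cis (\<alpha> - pi) = -a"
      by (auto simp: ca w simp flip: cis_mult cis_divide)
    show ?thesis
    proof (rule ccontr)
      assume "\<not> v c (a * w) \<le> v c (a * w')"
      then obtain \<gamma> where \<gamma>: "v c (a * w') < \<gamma>" "\<gamma> < v c (a * w)" using dense by (auto simp: not_le)
      have "v c (a * w) \<le> v c a" "v c (-a) \<le> v c (a * w')" using hi[of "a * w"] lo[of "a * w'"] a nw F(1) by (auto simp: norm_mult)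
      hence "v c a > \<gamma>" "v c (-a) < \<gamma>" using \<gamma> by linarith+
      thus False using no_alternation'[OF ord, of c \<gamma>, unfolded cs ca] \<gamma> by blast
    qed
  qed
  thus ?thesis using zw zw' by metis
qed

lemma half_plane_condition_bounded:
  "\<exists>c a. norm c = 1 \<and> norm a = 1 \<and>
     (\<forall>z\<in>ball 0 1. Im ((c * deriv h z - cnj c * deriv g z) * (a - cnj a * z\<^sup>2)) \<ge> 0)"
proof -
  obtain c a where c: "norm c = 1" "a \<in> max_points c" "-a \<in> max_points (-c)" using exists_antipodal_extrema .
  have a: "norm a = 1" using c by (simp add: max_points_def)
  define \<Psi> where "\<Psi> z = c * h z - cnj c * g z" for z
  define \<phi> where "\<phi> s z = (z + of_real s * a) / (1 + of_real s * cnj a * z)" for s :: real and z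
  have hol\<Psi>: "\<Psi> holomorphic_on ball 0 1" unfolding \<Psi>_def by (rule direction_part_holomorphic)
  have mono: "Im (\<Psi> z) \<le> Im (\<Psi> (\<phi> s z))" if z: "norm z < 1" and s: "0 < s" "s < 1" for z s
  proof -
    have n: "1 + of_real s * cnj a * y \<noteq> 0" "norm (\<phi> s y) \<le> 1" if "norm y \<le> 1" for y
      using norm_hyperbolic_flow_le[OF a that, of s] s by (auto simp: \<phi>_def)
    have n1: "norm (\<phi> s y) < 1" if "norm y < 1" for y
      using norm_hyperbolic_flow_le[OF a _ _ s(2), of y] s that by (auto simp: \<phi>_def)
    have "v c (\<phi> s z) - v c z \<ge> 0"
    proof (rule Im_min_principle[of "\<lambda>z. \<Psi> (\<phi> s z) - \<Psi> z"])
      have "(\<Psi> \<circ> \<phi> s) holomorphic_on ball 0 1"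
      proof (rule holomorphic_on_compose_gen[OF _ hol\<Psi>])
        show "\<phi> s holomorphic_on ball 0 1" unfolding \<phi>_def using n(1) by (intro holomorphic_intros) auto
      qed (use n1 in auto)
      thus "(\<lambda>z. \<Psi> (\<phi> s z) - \<Psi> z) holomorphic_on ball 0 1" using hol\<Psi> by (auto intro!: holomorphic_intros simp: o_def)
      have "continuous_on (cball 0 1) (\<phi> s)" unfolding \<phi>_def using n(1) by (intro continuous_intros) auto
      thus "continuous_on (cball 0 1) (\<lambda>z. v c (\<phi> s z) - v c z)"
        using n(2) by (intro continuous_intros v_continuous continuous_on_compose2[OF v_continuous]) auto
    qed (use z n1 v_flow_circle[OF c(2,3) _ s] in \<open>auto simp: v_eq \<Psi>_def \<phi>_def\<close>)
    thus ?thesis using z n1[OF z] by (simp add: v_eq \<Psi>_def)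
  qed
  have "Im (deriv \<Psi> z * (a - cnj a * z\<^sup>2)) \<ge> 0" if z: "z \<in> ball 0 1" for z
  proof (rule ccontr)
    assume neg: "\<not> Im (deriv \<Psi> z * (a - cnj a * z\<^sup>2)) \<ge> 0"
    have d\<phi>: "((\<lambda>s. \<phi> s z) has_vector_derivative (a - cnj a * z\<^sup>2)) (at 0)"
      unfolding \<phi>_def has_vector_derivative_def
      by (auto intro!: derivative_eq_intros simp: scaleR_conv_of_real power2_eq_square algebra_simps)
    have "(\<Psi> has_field_derivative deriv \<Psi> z) (at (\<phi> 0 z))"
      using holomorphic_derivI[OF hol\<Psi> open_ball z] by (simp add: \<phi>_def)
    from field_vector_diff_chain_at[OF d\<phi> this]
    have "((\<lambda>s. \<Psi> (\<phi> s z)) has_vector_derivative (a - cnj a * z\<^sup>2) * deriv \<Psi> z) (at 0)" by (simp add: o_def)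
    hence "((\<lambda>s. Im (\<Psi> (\<phi> s z))) has_real_derivative Im ((a - cnj a * z\<^sup>2) * deriv \<Psi> z)) (at 0)"
      unfolding has_real_derivative_iff_has_vector_derivative
      by (rule bounded_linear.has_vector_derivative[OF bounded_linear_Im])
    \<comment> \<open>Monotonicity is known for s > 0 only, so the contradiction must come from the
      right of 0.\<close>
    from DERIV_neg_dec_right[OF this] neg obtain d where d: "d > 0"
      "\<And>s. 0 < s \<Longrightarrow> s < d \<Longrightarrow> Im (\<Psi> (\<phi> (0 + s) z)) < Im (\<Psi> (\<phi> 0 z))" by (auto simp: mult.commute not_le)
    define s where "s = min (d/2) (1/2)"
    have s: "0 < s" "s < d" "s < 1" using d(1) by (auto simp: s_def)
    show False using d(2)[OF s(1,2)] mono[OF _ s(1,3), of z] z by (simp add: \<phi>_def)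
  qed
  moreover have "deriv \<Psi> z = c * deriv h z - cnj c * deriv g z" if "z \<in> ball 0 1" for z
    unfolding \<Psi>_def using holomorphic_derivI[OF hol_h open_ball that] holomorphic_derivI[OF hol_g open_ball that]
    by (intro DERIV_imp_deriv) (auto intro!: derivative_eq_intros)
  ultimately have "\<forall>z\<in>ball 0 1. Im ((c * deriv h z - cnj c * deriv g z) * (a - cnj a * z\<^sup>2)) \<ge> 0" by metis
  thus ?thesis using c(1) a by blast
qed

end

section \<open>Removing the boundedness assumption\<close>

text \<open>A disc automorphism moves the Riemann image of 0 back to 0. The argument of the
  derivative at 0 stays free, which is why the limit of such maps will be a rotation.\<close>

lemma simply_connected_uniformization:
  assumes S: "open S" "simply_connected S" "0 \<in> S" "S \<noteq> UNIV"
  shows "\<exists>\<phi> \<psi>. \<phi> holomorphic_on ball 0 1 \<and> \<psi> holomorphic_on S \<and> \<phi> 0 = 0 \<and> \<psi> 0 = 0 \<and>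
           (\<forall>z\<in>ball 0 1. \<phi> z \<in> S \<and> \<psi> (\<phi> z) = z) \<and> (\<forall>z\<in>S. \<psi> z \<in> ball 0 1 \<and> \<phi> (\<psi> z) = z)"
proof -
  obtain F G where FG: "F holomorphic_on S" "G holomorphic_on ball 0 1"
    "\<And>z. z \<in> S \<Longrightarrow> F z \<in> ball 0 1 \<and> G (F z) = z" "\<And>z. z \<in> ball 0 1 \<Longrightarrow> G z \<in> S \<and> F (G z) = z"
    using Riemann_mapping_theorem[of S] S by blast
  have "F 0 \<in> ball 0 1" using FG S by blast
  then obtain m m' where m: "m (F 0) = 0" "m holomorphic_on ball 0 1" "m ` ball 0 1 \<subseteq> ball 0 1"
      "m' holomorphic_on ball 0 1" "m' ` ball 0 1 \<subseteq> ball 0 1"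
      "\<And>z. z \<in> ball 0 1 \<Longrightarrow> m (m' z) = z" "\<And>z. z \<in> ball 0 1 \<Longrightarrow> m' (m z) = z"
    using ball_biholomorphism_exists by metis
  show ?thesis
  proof (rule exI[of _ "G \<circ> m'"], rule exI[of _ "m \<circ> F"], intro conjI ballI)
    show "G \<circ> m' holomorphic_on ball 0 1" by (rule holomorphic_on_compose_gen[OF m(4) FG(2) m(5)])
    show "m \<circ> F holomorphic_on S" by (rule holomorphic_on_compose_gen[OF FG(1) m(2)]) (use FG in auto)
    have "m' 0 = F 0" using m(7)[OF \<open>F 0 \<in> ball 0 1\<close>] m(1) by simp
    thus "(G \<circ> m') 0 = 0" using FG(3)[OF S(3)] by simp
    show "(m \<circ> F) 0 = 0" using m by simp
  next
    fix z :: complex assume z: "z \<in> ball 0 1"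
    hence "m' z \<in> ball 0 1" using m(5) by blast
    thus "(G \<circ> m') z \<in> S" "(m \<circ> F) ((G \<circ> m') z) = z" using FG(4)[of "m' z"] m(6)[OF z] by auto
  next
    fix z assume z: "z \<in> S"
    hence "F z \<in> ball 0 1" using FG(3) by blast
    moreover from this have "m (F z) \<in> ball 0 1" using m(3) by blast
    ultimately show "(m \<circ> F) z \<in> ball 0 1" "(G \<circ> m') ((m \<circ> F) z) = z" using FG(3)[OF z] m(7)[of "F z"] by auto
  qed
qed

context convex_harm
begin

text \<open>\<open>f\<close> is not conformal, but simple connectivity is topological:
  \<open>f\<close> maps \<open>S\<close> homeomorphically onto the convex intersection of its image
  with \<open>ball 0 R\<close>.\<close>

lemma truncation:
  fixes R :: real
  assumes R: "R > 0"
  defines "S \<equiv> {z\<in>ball 0 1. norm (f z) < R}"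
  shows "\<exists>\<phi> \<psi>. \<phi> holomorphic_on ball 0 1 \<and> \<psi> holomorphic_on S \<and> \<phi> 0 = 0 \<and> \<psi> 0 = 0 \<and>
           (\<forall>z\<in>ball 0 1. \<phi> z \<in> S \<and> \<psi> (\<phi> z) = z) \<and> (\<forall>z\<in>S. \<psi> z \<in> ball 0 1 \<and> \<phi> (\<psi> z) = z)"
proof (rule simply_connected_uniformization)
  have Seq: "S = ball 0 1 \<inter> f -` ball 0 R" by (auto simp: S_def)
  show "open S" unfolding Seq by (intro continuous_open_preimage f_continuous) auto
  show "0 \<in> S" using zero R by (simp add: S_def)
  show "S \<noteq> UNIV" by (auto simp: S_def dest!: arg_cong[of _ _ "\<lambda>A. 1 \<in> A"])
  obtain f' where hom: "homeomorphism (ball 0 1) (f ` ball 0 1) f f'" using f_homeo .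
  have fS: "f ` S = f ` ball 0 1 \<inter> ball 0 R" by (auto simp: S_def)
  have "homeomorphism S (f ` ball 0 1 \<inter> ball 0 R) f f'"
    by (rule homeomorphism_of_subsets[OF hom _ order_refl fS]) (auto simp: S_def)
  hence "S homeomorphic (f ` ball 0 1 \<inter> ball 0 R)" by (auto simp: homeomorphic_def)
  moreover have "simply_connected (f ` ball 0 1 \<inter> ball 0 R)"
    by (intro convex_imp_simply_connected convex_Int cvx convex_ball)
  ultimately show "simply_connected S" using homeomorphic_simply_connected_eq by blast
qed

text \<open>Composition with \<phi> multiplies both derivatives by the same factor, so the
  dilatation bound persists, while the image becomes convex and bounded.\<close>

lemma truncated_condition:
  assumes \<phi>: "\<phi> holomorphic_on ball 0 1" "\<phi> 0 = 0"
    "\<And>z. z \<in> ball 0 1 \<Longrightarrow> \<phi> z \<in> S \<and> \<psi> (\<phi> z) = z" "\<And>z. z \<in> S \<Longrightarrow> \<psi> z \<in> ball 0 1 \<and> \<phi> (\<psi> z) = z"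
  and S: "S = {z\<in>ball 0 1. norm (f z) < R}"
  shows "\<exists>c a. norm c = 1 \<and> norm a = 1 \<and>
     (\<forall>z\<in>ball 0 1. Im ((c * deriv h (\<phi> z) - cnj c * deriv g (\<phi> z)) * deriv \<phi> z * (a - cnj a * z\<^sup>2)) \<ge> 0)"
proof -
  have sub: "\<phi> z \<in> ball 0 1" if "z \<in> ball 0 1" for z using \<phi>(3)[OF that] S by auto
  have im: "\<phi> ` ball 0 1 \<subseteq> ball 0 1" using sub by auto
  have chain: "deriv (h \<circ> \<phi>) z = deriv h (\<phi> z) * deriv \<phi> z" "deriv (g \<circ> \<phi>) z = deriv g (\<phi> z) * deriv \<phi> z"
    if z: "z \<in> ball 0 1" for z
  proof -
    have "\<phi> field_differentiable at z" "h field_differentiable at (\<phi> z)" "g field_differentiable at (\<phi> z)"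
      using \<phi>(1) hol_h hol_g sub[OF z] z holomorphic_on_imp_differentiable_at open_ball by blast+
    thus "deriv (h \<circ> \<phi>) z = deriv h (\<phi> z) * deriv \<phi> z" "deriv (g \<circ> \<phi>) z = deriv g (\<phi> z) * deriv \<phi> z"
      by (auto intro!: deriv_chain)
  qed
  have hc: "harm (h \<circ> \<phi>) (g \<circ> \<phi>) = f \<circ> \<phi>" by (auto simp: harm_def)
  have "\<phi> ` ball 0 1 = S"
  proof
    show "S \<subseteq> \<phi> ` ball 0 1" using \<phi>(4) by (metis imageI subsetI)
  qed (use \<phi>(3) in blast)
  hence img: "harm (h \<circ> \<phi>) (g \<circ> \<phi>) ` ball 0 1 = f ` ball 0 1 \<inter> ball 0 R"
    unfolding hc image_comp[symmetric] by (auto simp: S)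
  interpret B: bounded_convex_harm "h \<circ> \<phi>" "g \<circ> \<phi>" k
  proof
    show "h \<circ> \<phi> holomorphic_on ball 0 1" "g \<circ> \<phi> holomorphic_on ball 0 1"
      using holomorphic_on_compose_gen[OF \<phi>(1) hol_h im] holomorphic_on_compose_gen[OF \<phi>(1) hol_g im] by auto
    show "inj_on (harm (h \<circ> \<phi>) (g \<circ> \<phi>)) (ball 0 1)" unfolding hc
    proof (rule comp_inj_on)
      show "inj_on \<phi> (ball 0 1)" using \<phi>(3) by (metis inj_onI)
      show "inj_on f (\<phi> ` ball 0 1)" using inj im by (rule inj_on_subset)
    qed
    show "convex (harm (h \<circ> \<phi>) (g \<circ> \<phi>) ` ball 0 1)" unfolding img by (intro convex_Int cvx convex_ball)
    show "bounded (harm (h \<circ> \<phi>) (g \<circ> \<phi>) ` ball 0 1)" unfolding img by (rule bounded_subset[OF bounded_ball]) auto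
    show "harm (h \<circ> \<phi>) (g \<circ> \<phi>) 0 = 0" using zero \<phi>(2) by (simp add: hc)
    show "norm (deriv (g \<circ> \<phi>) z) \<le> k * norm (deriv (h \<circ> \<phi>) z)" if "z \<in> ball 0 1" for z
      unfolding chain[OF that] norm_mult mult.assoc[symmetric] by (intro mult_right_mono dil sub that) auto
  qed (use k01 in auto)
  obtain c a where ca: "norm c = 1" "norm a = 1"
     "\<And>z. z \<in> ball 0 1 \<Longrightarrow> Im ((c * deriv (h \<circ> \<phi>) z - cnj c * deriv (g \<circ> \<phi>) z) * (a - cnj a * z\<^sup>2)) \<ge> 0"
    using B.half_plane_condition_bounded by blast
  have "Im ((c * deriv h (\<phi> z) - cnj c * deriv g (\<phi> z)) * deriv \<phi> z * (a - cnj a * z\<^sup>2)) \<ge> 0" if z: "z \<in> ball 0 1" for z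
    using ca(3)[OF z] unfolding chain[OF z] by (simp add: algebra_simps)
  thus ?thesis using ca by blast
qed

lemma half_plane_condition:
  "\<exists>c a. norm c = 1 \<and> norm a = 1 \<and>
     (\<forall>z\<in>ball 0 1. Im ((c * deriv h z - cnj c * deriv g z) * (a - cnj a * z\<^sup>2)) \<ge> 0)"
proof -
  define S where "S n = {z\<in>ball 0 1. norm (f z) < real (Suc n)}" for n
  have "\<forall>n. \<exists>\<phi> \<psi>. \<phi> holomorphic_on ball 0 1 \<and> \<psi> holomorphic_on S n \<and> \<phi> 0 = 0 \<and> \<psi> 0 = 0 \<and>
           (\<forall>z\<in>ball 0 1. \<phi> z \<in> S n \<and> \<psi> (\<phi> z) = z) \<and> (\<forall>z\<in>S n. \<psi> z \<in> ball 0 1 \<and> \<phi> (\<psi> z) = z)"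
    unfolding S_def by (intro allI truncation) auto
  then obtain \<phi> where "\<forall>n. \<exists>\<psi>. \<phi> n holomorphic_on ball 0 1 \<and> \<psi> holomorphic_on S n \<and> \<phi> n 0 = 0 \<and> \<psi> 0 = 0 \<and>
           (\<forall>z\<in>ball 0 1. \<phi> n z \<in> S n \<and> \<psi> (\<phi> n z) = z) \<and> (\<forall>z\<in>S n. \<psi> z \<in> ball 0 1 \<and> \<phi> n (\<psi> z) = z)"
    by (rule choice[THEN exE])
  then obtain \<psi> where "\<forall>n. \<phi> n holomorphic_on ball 0 1 \<and> \<psi> n holomorphic_on S n \<and> \<phi> n 0 = 0 \<and> \<psi> n 0 = 0 \<and>
           (\<forall>z\<in>ball 0 1. \<phi> n z \<in> S n \<and> \<psi> n (\<phi> n z) = z) \<and> (\<forall>z\<in>S n. \<psi> n z \<in> ball 0 1 \<and> \<phi> n (\<psi> n z) = z)"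
    by (rule choice[THEN exE])
  hence hol\<phi>: "\<And>n. \<phi> n holomorphic_on ball 0 1" and hol\<psi>: "\<And>n. \<psi> n holomorphic_on S n"
    and \<phi>0: "\<And>n. \<phi> n 0 = 0" and \<psi>0: "\<And>n. \<psi> n 0 = 0"
    and \<phi>S: "\<And>n z. z \<in> ball 0 1 \<Longrightarrow> \<phi> n z \<in> S n \<and> \<psi> n (\<phi> n z) = z"
    and \<psi>S: "\<And>n z. z \<in> S n \<Longrightarrow> \<psi> n z \<in> ball 0 1 \<and> \<phi> n (\<psi> n z) = z" by blast+
  have "\<exists>x. norm (fst x) = 1 \<and> norm (snd x) = 1 \<and>
     (\<forall>z\<in>ball 0 1. Im ((fst x * deriv h (\<phi> n z) - cnj (fst x) * deriv g (\<phi> n z)) * deriv (\<phi> n) z * (snd x - cnj (snd x) * z\<^sup>2)) \<ge> 0)" for n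
    using truncated_condition[OF hol\<phi> \<phi>0 \<phi>S \<psi>S, of n "real (Suc n)"] unfolding S_def by (auto simp del: of_nat_Suc)
  then obtain ca where ca: "\<And>n. norm (fst (ca n)) = 1 \<and> norm (snd (ca n)) = 1 \<and>
     (\<forall>z\<in>ball 0 1. Im ((fst (ca n) * deriv h (\<phi> n z) - cnj (fst (ca n)) * deriv g (\<phi> n z)) * deriv (\<phi> n) z * (snd (ca n) - cnj (snd (ca n)) * z\<^sup>2)) \<ge> 0)"
    by metis
  have nle: "norm (\<phi> n z) < 1" if "norm z < 1" for n z using \<phi>S[of z n] that by (auto simp: S_def)
  \<comment> \<open>The constants are made to converge first and Montel's theorem is applied along
    that subsequence, so that one subsequence \<open>R\<close> serves both.\<close>
  have "seq_compact (sphere (0::complex) 1 \<times> sphere (0::complex) 1)"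
    by (intro compact_imp_seq_compact compact_Times compact_sphere)
  moreover have "\<forall>n. ca n \<in> sphere 0 1 \<times> sphere 0 1" using ca by (auto simp: mem_Times_iff)
  ultimately obtain l r1 where r1: "strict_mono r1" "(ca \<circ> r1) \<longlonglongrightarrow> l" "l \<in> sphere 0 1 \<times> sphere 0 1"
    unfolding seq_compact_def by metis
  obtain \<xi> r2 where \<xi>: "\<xi> holomorphic_on ball 0 1" "strict_mono r2"
    "\<And>x. x \<in> ball 0 1 \<Longrightarrow> (\<lambda>n. (\<phi> \<circ> r1) (r2 n) x) \<longlonglongrightarrow> \<xi> x"
    "\<And>K. compact K \<Longrightarrow> K \<subseteq> ball 0 1 \<Longrightarrow> uniform_limit K ((\<phi> \<circ> r1) \<circ> r2) \<xi> sequentially"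
  proof (rule Montel[of "ball 0 1" "{\<phi>. \<phi> holomorphic_on ball 0 1 \<and> (\<forall>z\<in>ball 0 1. norm (\<phi> z) \<le> 1)}" "\<phi> \<circ> r1"])
    show "\<exists>B. \<forall>h\<in>{\<phi>. \<phi> holomorphic_on ball 0 1 \<and> (\<forall>z\<in>ball 0 1. norm (\<phi> z) \<le> 1)}. \<forall>z\<in>K. norm (h z) \<le> B"
      if "K \<subseteq> ball 0 1" for K using that by (intro exI[of _ 1]) auto
    show "range (\<phi> \<circ> r1) \<subseteq> {\<phi>. \<phi> holomorphic_on ball 0 1 \<and> (\<forall>z\<in>ball 0 1. norm (\<phi> z) \<le> 1)}"
      using hol\<phi> nle by (auto simp: less_imp_le)
  qed auto
  define R where "R = r1 \<circ> r2"
  have R: "strict_mono R" using r1(1) \<xi>(2) by (simp add: R_def strict_mono_o)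
  have limca: "(\<lambda>n. ca (R n)) \<longlonglongrightarrow> l" using LIMSEQ_subseq_LIMSEQ[OF r1(2) \<xi>(2)] by (simp add: R_def o_def)
  have lim\<phi>: "(\<lambda>n. \<phi> (R n) z) \<longlonglongrightarrow> \<xi> z" if "z \<in> ball 0 1" for z using \<xi>(3)[OF that] by (simp add: R_def)
  have limd: "(\<lambda>n. deriv (\<phi> (R n)) z) \<longlonglongrightarrow> deriv \<xi> z" if z: "z \<in> ball 0 1" for z
  proof -
    obtain \<rho> where \<rho>: "norm z < \<rho>" "\<rho> < 1" using z dense by auto
    have "uniform_limit (cball 0 \<rho>) ((\<phi> \<circ> r1) \<circ> r2) \<xi> sequentially" using \<rho> by (intro \<xi>(4)) auto
    hence "uniform_limit (cball 0 \<rho>) (\<lambda>n. \<phi> (R n)) \<xi> sequentially" by (simp add: R_def o_def)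
    hence ul: "uniform_limit (ball 0 \<rho>) (\<lambda>n. \<phi> (R n)) \<xi> sequentially"
      by (rule uniform_limit_on_subset) auto
    have "\<forall>\<^sub>F n in sequentially. \<phi> (R n) holomorphic_on ball 0 \<rho>"
      using \<rho> by (intro always_eventually allI holomorphic_on_subset[OF hol\<phi>]) auto
    from higher_deriv_complex_uniform_limit[OF ul this, of z 1] show ?thesis using \<rho> by simp
  qed
  \<comment> \<open>The map z -> \<open>\<psi> n (\<rho> * z)\<close> is a self-map of the disc
    fixing 0, so the derivative of \<open>\<psi> n\<close> at 0 is at most 1 / \<rho> in modulus,
    and that of its inverse is at least \<rho>. As \<open>S n\<close> exhausts the disc, \<rho> may
    approach 1, which is the equality case of Schwarz's lemma for the limit.\<close>
  have der\<phi>0: "norm (deriv (\<phi> n) 0) \<ge> \<rho>" if \<rho>: "0 < \<rho>" "\<rho> < 1" and sub: "cball 0 \<rho> \<subseteq> S n" for n \<rho>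
  proof -
    have oS: "0 \<in> S n" using sub \<rho> by auto
    have opS: "open (S n)"
    proof -
      have "S n = ball 0 1 \<inter> f -` ball 0 (real (Suc n))" by (auto simp: S_def simp del: of_nat_Suc)
      thus ?thesis by (simp only:) (intro continuous_open_preimage f_continuous, auto)
    qed
    have d1: "(\<psi> n has_field_derivative deriv (\<psi> n) 0) (at 0)" using holomorphic_derivI[OF hol\<psi> opS oS] .
    have d2: "(\<phi> n has_field_derivative deriv (\<phi> n) 0) (at (\<psi> n 0))" using holomorphic_derivI[OF hol\<phi> open_ball] by (simp add: \<psi>0)
    have "((\<phi> n \<circ> \<psi> n) has_field_derivative deriv (\<phi> n) 0 * deriv (\<psi> n) 0) (at 0)" by (rule DERIV_chain[OF d2 d1])
    moreover have "((\<phi> n \<circ> \<psi> n) has_field_derivative 1) (at 0)"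
      by (rule has_field_derivative_transform_within_open[OF DERIV_ident opS oS]) (use \<psi>S in auto)
    ultimately have one: "deriv (\<phi> n) 0 * deriv (\<psi> n) 0 = 1" by (rule DERIV_unique)
    have inS: "of_real \<rho> * z \<in> S n" if "norm z < 1" for z
      using that \<rho> by (intro subsetD[OF sub]) (simp add: norm_mult mult_left_le)
    have "norm (deriv (\<lambda>z. \<psi> n (of_real \<rho> * z)) 0) \<le> 1"
    proof (rule Schwarz_Lemma(2)[of _ 0])
      have "\<psi> n \<circ> (\<lambda>z. of_real \<rho> * z) holomorphic_on ball 0 1"
        by (rule holomorphic_on_compose_gen[OF _ hol\<psi>[of n]]) (use inS in \<open>auto intro!: holomorphic_intros\<close>)
      thus "(\<lambda>z. \<psi> n (of_real \<rho> * z)) holomorphic_on ball 0 1" by (simp add: o_def)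
      show "norm (\<psi> n (of_real \<rho> * z)) < 1" if "norm z < 1" for z using \<psi>S[OF inS[OF that]] by simp
    qed (auto simp: \<psi>0)
    moreover have "deriv (\<lambda>z. \<psi> n (of_real \<rho> * z)) 0 = of_real \<rho> * deriv (\<psi> n) 0"
    proof (rule DERIV_imp_deriv)
      have "(\<psi> n has_field_derivative deriv (\<psi> n) 0) (at (of_real \<rho> * 0))" using d1 by simp
      moreover have "((\<lambda>z. of_real \<rho> * z) has_field_derivative of_real \<rho>) (at (0::complex))"
        by (auto intro!: derivative_eq_intros)
      ultimately have "((\<psi> n \<circ> (\<lambda>z. of_real \<rho> * z)) has_field_derivative deriv (\<psi> n) 0 * of_real \<rho>) (at 0)"
        by (rule DERIV_chain)
      thus "((\<lambda>z. \<psi> n (of_real \<rho> * z)) has_field_derivative of_real \<rho> * deriv (\<psi> n) 0) (at 0)"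
        by (simp add: o_def mult.commute)
    qed
    ultimately have "\<rho> * norm (deriv (\<psi> n) 0) \<le> 1" using \<rho> by (simp add: norm_mult)
    hence "norm (deriv (\<phi> n) 0) * (\<rho> * norm (deriv (\<psi> n) 0)) \<le> norm (deriv (\<phi> n) 0) * 1" by (intro mult_left_mono) auto
    moreover have "norm (deriv (\<phi> n) 0) * norm (deriv (\<psi> n) 0) = 1" using one by (metis norm_mult norm_one)
    ultimately show ?thesis by (simp add: mult.left_commute)
  qed
  have ge: "norm (deriv \<xi> 0) \<ge> \<rho>" if \<rho>: "0 < \<rho>" "\<rho> < 1" for \<rho>
  proof -
    have "compact (f ` cball 0 \<rho>)" using \<rho> by (intro compact_continuous_image continuous_on_subset[OF f_continuous]) auto
    then obtain M where M: "\<And>z. z \<in> cball 0 \<rho> \<Longrightarrow> norm (f z) \<le> M" using compact_imp_bounded bounded_iff by (metis imageI)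
    obtain N where N: "M < real N" using reals_Archimedean2 by blast
    have "cball 0 \<rho> \<subseteq> S (R n)" if "n \<ge> N" for n
    proof
      fix z :: complex assume z: "z \<in> cball 0 \<rho>"
      have "real N \<le> real (R n)" using that seq_suble[OF R, of n] by simp
      thus "z \<in> S (R n)" using z M[OF z] N \<rho> by (auto simp: S_def)
    qed
    hence "eventually (\<lambda>n. norm (deriv (\<phi> (R n)) 0) \<ge> \<rho>) sequentially"
      unfolding eventually_sequentially using der\<phi>0[OF \<rho>] by blast
    moreover have "(\<lambda>n. norm (deriv (\<phi> (R n)) 0)) \<longlonglongrightarrow> norm (deriv \<xi> 0)" by (intro tendsto_norm limd) auto
    ultimately show ?thesis by (intro tendsto_lowerbound) auto
  qed
  have "norm (deriv \<xi> 0) \<ge> 1" by (rule dense_le_bounded[of 0]) (use ge in auto)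
  have \<xi>0: "\<xi> 0 = 0" using lim\<phi>[of 0] by (simp add: \<phi>0 LIMSEQ_const_iff)
  have "norm (\<xi> z) \<le> 1" if "norm z < 1" for z
    using lim\<phi>[of z] that nle[OF that] by (intro tendsto_upperbound[OF tendsto_norm[OF lim\<phi>[of z]]]) (auto intro!: always_eventually less_imp_le)
  hence \<xi>1: "norm (\<xi> z) < 1" if "norm z < 1" for z using Schwarz_bound[OF \<xi>(1) \<xi>0 _ that] that by auto
  have "norm (deriv \<xi> 0) = 1" using Schwarz_Lemma(2)[OF \<xi>(1) \<xi>0 \<xi>1, of 0] \<open>norm (deriv \<xi> 0) \<ge> 1\<close> by simp
  then obtain \<eta> where \<eta>: "norm \<eta> = 1" "\<And>z. norm z < 1 \<Longrightarrow> \<xi> z = \<eta> * z"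
    using Schwarz_Lemma(3)[OF \<xi>(1) \<xi>0 \<xi>1, of 0] by auto
  have der\<xi>: "deriv \<xi> z = \<eta>" if "z \<in> ball 0 1" for z
  proof (rule DERIV_imp_deriv)
    have "((\<lambda>z. \<eta> * z) has_field_derivative \<eta>) (at z)" by (auto intro!: derivative_eq_intros)
    thus "(\<xi> has_field_derivative \<eta>) (at z)"
      by (rule has_field_derivative_transform_within_open[OF _ open_ball that]) (use \<eta>(2) in auto)
  qed
  define c a where "c = fst l" and "a = snd l"
  have nca: "norm c = 1" "norm a = 1" using r1(3) by (auto simp: c_def a_def mem_Times_iff)
  have ch: "isCont (deriv h) z" "isCont (deriv g) z" if "z \<in> ball 0 1" for z
    using holomorphic_deriv[OF hol_h open_ball] holomorphic_deriv[OF hol_g open_ball] that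
    by (auto intro: continuous_on_interior[OF holomorphic_on_imp_continuous_on])
  have lim: "Im ((c * deriv h (\<eta> * z) - cnj c * deriv g (\<eta> * z)) * \<eta> * (a - cnj a * z\<^sup>2)) \<ge> 0" if z: "z \<in> ball 0 1" for z
  proof (rule tendsto_lowerbound)
    have \<eta>z: "\<eta> * z \<in> ball 0 1" using z \<eta>(1) by (simp add: norm_mult)
    have l1: "(\<lambda>n. fst (ca (R n))) \<longlonglongrightarrow> c" "(\<lambda>n. snd (ca (R n))) \<longlonglongrightarrow> a"
      using limca by (auto simp: c_def a_def intro: tendsto_fst tendsto_snd)
    have l2: "(\<lambda>n. \<phi> (R n) z) \<longlonglongrightarrow> \<eta> * z" using lim\<phi>[OF z] \<eta>(2)[of z] z by simp
    have l3: "(\<lambda>n. deriv (\<phi> (R n)) z) \<longlonglongrightarrow> \<eta>" using limd[OF z] der\<xi>[OF z] by simp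
    show "((\<lambda>n. Im ((fst (ca (R n)) * deriv h (\<phi> (R n) z) - cnj (fst (ca (R n))) * deriv g (\<phi> (R n) z)) * deriv (\<phi> (R n)) z * (snd (ca (R n)) - cnj (snd (ca (R n))) * z\<^sup>2)))
       \<longlongrightarrow> Im ((c * deriv h (\<eta> * z) - cnj c * deriv g (\<eta> * z)) * \<eta> * (a - cnj a * z\<^sup>2))) sequentially"
      by (intro tendsto_intros l1 l3 isCont_tendsto_compose[OF ch(1)[OF \<eta>z] l2] isCont_tendsto_compose[OF ch(2)[OF \<eta>z] l2])
    show "eventually (\<lambda>n. 0 \<le> Im ((fst (ca (R n)) * deriv h (\<phi> (R n) z) - cnj (fst (ca (R n))) * deriv g (\<phi> (R n) z)) * deriv (\<phi> (R n)) z * (snd (ca (R n)) - cnj (snd (ca (R n))) * z\<^sup>2))) sequentially"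
      using ca z by (intro always_eventually allI) blast
  qed auto
  have \<eta>\<eta>: "\<eta> * cnj \<eta> = 1" using \<eta>(1) by (metis complex_norm_square of_real_1 one_power2)
  \<comment> \<open>Substituting cnj \<eta> * z for \<open>z\<close> undoes the limiting rotation
    and moves \<eta> into the second constant.\<close>
  have "Im ((c * deriv h z - cnj c * deriv g z) * (a * \<eta> - cnj (a * \<eta>) * z\<^sup>2)) \<ge> 0" if z: "z \<in> ball 0 1" for z
  proof -
    define z' where "z' = cnj \<eta> * z"
    have "z' \<in> ball 0 1" using z \<eta>(1) by (simp add: z'_def norm_mult)
    moreover have "\<eta> * z' = z" using \<eta>\<eta> by (simp add: z'_def flip: mult.assoc)
    moreover have "\<eta> * (a - cnj a * z'\<^sup>2) = a * \<eta> - (\<eta> * cnj \<eta>) * (cnj a * cnj \<eta> * z\<^sup>2)"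
      by (simp add: z'_def power2_eq_square algebra_simps)
    ultimately show ?thesis using lim[of z'] \<eta>\<eta> by (simp add: mult.assoc)
  qed
  moreover have "norm (a * \<eta>) = 1" using nca \<eta> by (simp add: norm_mult)
  ultimately show ?thesis using nca(1) by blast
qed

end

section \<open>The factorization of the derivative and the integral means\<close>

text \<open>The profile \<open>V j\<close> is measured from the angle pi, the common peak of all
  factors; the Schwarz functions may differ from one \<open>j\<close> to the next.\<close>

lemma integral_exp_subordinate_le:
  fixes L \<phi> :: "'j \<Rightarrow> complex \<Rightarrow> complex" and V :: "'j \<Rightarrow> real \<Rightarrow> real" and r p :: real
  assumes L: "\<And>j. j \<in> J \<Longrightarrow> L j holomorphic_on ball 0 1"
    and \<phi>: "\<And>j. j \<in> J \<Longrightarrow> \<phi> j holomorphic_on ball 0 1" "\<And>j. j \<in> J \<Longrightarrow> \<phi> j 0 = 0"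
    and le: "\<And>j z. j \<in> J \<Longrightarrow> norm z < 1 \<Longrightarrow> norm (\<phi> j z) \<le> 1"
    and V: "\<And>j. j \<in> J \<Longrightarrow> continuous_on {0..pi} (V j)"
    and anti: "\<And>j x y. j \<in> J \<Longrightarrow> 0 \<le> x \<Longrightarrow> x \<le> y \<Longrightarrow> y \<le> pi \<Longrightarrow> V j y \<le> V j x"
    and LV: "\<And>j t. j \<in> J \<Longrightarrow> Re (L j (r * cis t)) = V j \<bar>t - pi\<bar>"
    and r: "0 < r" "r < 1" and p: "p \<ge> 0"
  shows "integral {0..2*pi} (\<lambda>t. exp (p * (\<Sum>j\<in>J. Re (L j (\<phi> j (r * cis t))))))
       \<le> integral {0..2*pi} (\<lambda>t. exp (p * (\<Sum>j\<in>J. V j \<bar>t - pi\<bar>)))"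
proof (rule integral_exp_mono_superlevel[OF _ _ p])
  have nr: "norm (of_real r * cis t) = r" for t using r by (simp add: norm_mult)
  have c1: "continuous_on A (\<lambda>t. Re (L j (\<phi> j (r * cis t))))" if j: "j \<in> J" for j A
  proof -
    have "norm (\<phi> j (r * cis t)) < 1" for t
      using Schwarz_bound[OF \<phi>(1,2)[OF j] le[OF j], of "r * cis t"] nr[of t] r by simp
    thus ?thesis using r nr
      by (intro continuous_intros continuous_on_compose2[OF holomorphic_on_imp_continuous_on[OF L[OF j]]]
            continuous_on_compose2[OF holomorphic_on_imp_continuous_on[OF \<phi>(1)[OF j]]]) auto
  qed
  thus "continuous_on {0..2*pi} (\<lambda>t. \<Sum>j\<in>J. Re (L j (\<phi> j (r * cis t))))" by (rule continuous_on_sum)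
  show "continuous_on {0..2*pi} (\<lambda>t. \<Sum>j\<in>J. V j \<bar>t - pi\<bar>)"
    by (intro continuous_intros continuous_on_compose2[OF V]) auto
  fix \<tau> :: real
  have eq: "{pi - pi..pi + pi} = {0..2*pi}" by simp
  have "integral {pi - pi..pi + pi} (\<lambda>t. max ((\<Sum>j\<in>J. Re (L j (\<phi> j (r * cis t)))) - \<tau>) 0)
     \<le> integral {pi - pi..pi + pi} (\<lambda>t. max ((\<Sum>j\<in>J. V j \<bar>t - pi\<bar>) - \<tau>) 0)"
  proof (rule sum_superlevel_integral_le)
    fix j \<tau>' assume j: "j \<in> J"
    show "integral {pi - pi..pi + pi} (\<lambda>t. max (Re (L j (\<phi> j (r * cis t))) - \<tau>') 0)
        \<le> integral {pi - pi..pi + pi} (\<lambda>t. max (V j \<bar>t - pi\<bar> - \<tau>') 0)"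
      using littlewood_subordination[OF L[OF j] \<phi>(1,2)[OF j] le[OF j] r, of \<tau>'] unfolding eq LV[OF j] by simp
  qed (use c1 V anti in auto)
  thus "integral {0..2*pi} (\<lambda>t. max ((\<Sum>j\<in>J. Re (L j (\<phi> j (r * cis t)))) - \<tau>) 0)
     \<le> integral {0..2*pi} (\<lambda>t. max ((\<Sum>j\<in>J. V j \<bar>t - pi\<bar>) - \<tau>) 0)" unfolding eq .
qed

text \<open>Herglotz normalization with free argument at 0: \<phi> is the Cayley transform of
  \<open>P\<close> based at \<gamma> = P 0, and \<epsilon> = (cnj \<gamma>)^2 records the argument.
  If Re (P 0) = 0, the open mapping theorem makes \<open>P\<close> constant and \<phi> = 0
  serves.\<close>

lemma positive_real_part_subordination:
  fixes P :: "complex \<Rightarrow> complex"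
  assumes P: "P holomorphic_on ball 0 1" and pos: "\<And>z. norm z < 1 \<Longrightarrow> Re (P z) \<ge> 0" and P0: "norm (P 0) = 1"
  shows "\<exists>\<phi> \<epsilon>. \<phi> holomorphic_on ball 0 1 \<and> \<phi> 0 = 0 \<and> (\<forall>z. norm z < 1 \<longrightarrow> norm (\<phi> z) \<le> 1) \<and> norm \<epsilon> = 1 \<and>
           (\<forall>z. norm z < 1 \<longrightarrow> norm (P z) * norm (1 - \<phi> z) = norm (1 + \<epsilon> * \<phi> z))"
proof (cases "Re (P 0) = 0")
  case True
  have "P constant_on ball 0 1"
  proof (rule ccontr)
    assume "\<not> P constant_on ball 0 1"
    hence "open (P ` ball 0 1)" by (intro open_mapping_thm[OF P]) auto
    moreover have "P 0 \<in> P ` ball 0 1" by auto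
    ultimately obtain d where d: "d > 0" "cball (P 0) d \<subseteq> P ` ball 0 1" by (meson open_contains_cball)
    have "P 0 - of_real d \<in> cball (P 0) d" using d by (simp add: dist_norm)
    hence "P 0 - of_real d \<in> P ` ball 0 1" using d(2) by blast
    then obtain z where z: "z \<in> ball 0 1" "P 0 - of_real d = P z" by (rule imageE)
    have "Re (P z) = - d" unfolding z(2)[symmetric] using True by simp
    thus False using pos[of z] z(1) d(1) by simp
  qed
  then obtain y where "\<And>z. norm z < 1 \<Longrightarrow> P z = y" by (auto simp: constant_on_def)
  hence "norm (P z) = 1" if "norm z < 1" for z using P0 that by (metis norm_zero zero_less_one)
  thus ?thesis by (intro exI[of _ "\<lambda>_. 0"] exI[of _ 1]) auto
next
  case False
  define \<gamma> where "\<gamma> = P 0"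
  have \<gamma>: "Re \<gamma> > 0" "norm \<gamma> = 1" using False pos[of 0] P0 by (auto simp: \<gamma>_def)
  define \<phi> where "\<phi> z = (P z - \<gamma>) / (P z + cnj \<gamma>)" for z
  have "Re (P z + cnj \<gamma>) > 0" if "norm z < 1" for z using pos[OF that] \<gamma>(1) by simp
  hence ne: "P z + cnj \<gamma> \<noteq> 0" if "norm z < 1" for z using that by (metis less_irrefl zero_complex.simps(1))
  have gg: "\<gamma> * cnj \<gamma> = 1" using \<gamma>(2) by (metis complex_norm_square of_real_1 one_power2)
  define \<epsilon> where "\<epsilon> = cnj \<gamma> * cnj \<gamma>"
  show ?thesis
  proof (rule exI[of _ \<phi>], rule exI[of _ \<epsilon>], intro conjI allI impI)
    show "\<phi> holomorphic_on ball 0 1" unfolding \<phi>_def using ne by (intro holomorphic_intros P) auto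
    show "\<phi> 0 = 0" by (simp add: \<phi>_def \<gamma>_def)
    show "norm \<epsilon> = 1" using \<gamma> by (simp add: \<epsilon>_def norm_mult)
  next
    fix z :: complex assume z: "norm z < 1"
    have "(norm (P z + cnj \<gamma>))\<^sup>2 - (norm (P z - \<gamma>))\<^sup>2 = 4 * Re \<gamma> * Re (P z)"
      unfolding cmod_power2 by (simp add: power2_eq_square algebra_simps)
    also have "\<dots> \<ge> 0" using \<gamma>(1) pos[OF z] by simp
    finally have "(norm (P z - \<gamma>))\<^sup>2 \<le> (norm (P z + cnj \<gamma>))\<^sup>2" using \<gamma>(1) pos[OF z] by simp
    hence "norm (P z - \<gamma>) \<le> norm (P z + cnj \<gamma>)" by (rule power2_le_imp_le) simp
    thus "norm (\<phi> z) \<le> 1" using ne[OF z] by (simp add: \<phi>_def norm_divide)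
    have "1 - \<phi> z = (\<gamma> + cnj \<gamma>) / (P z + cnj \<gamma>)" using ne[OF z] by (simp add: \<phi>_def field_simps)
    moreover have "\<gamma> * (1 + \<epsilon> * \<phi> z) = \<gamma> + (\<gamma> * cnj \<gamma>) * cnj \<gamma> * \<phi> z" by (simp add: \<epsilon>_def algebra_simps)
    hence "\<gamma> * (1 + \<epsilon> * \<phi> z) = \<gamma> + cnj \<gamma> * \<phi> z" unfolding gg by simp
    hence "\<gamma> * (1 + \<epsilon> * \<phi> z) = P z * ((\<gamma> + cnj \<gamma>) / (P z + cnj \<gamma>))"
      using ne[OF z] by (simp add: \<phi>_def field_simps)
    ultimately have "P z * (1 - \<phi> z) = \<gamma> * (1 + \<epsilon> * \<phi> z)" by simp
    thus "norm (P z) * norm (1 - \<phi> z) = norm (1 + \<epsilon> * \<phi> z)" using \<gamma>(2) by (metis mult_1 norm_mult)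
  qed
qed

section \<open>The factors of the extremal function on a circle\<close>

lemma norm_one_plus_cis:
  fixes q \<theta> :: real
  shows "norm (1 + of_real q * cis \<theta>) = sqrt (1 + 2 * q * cos \<theta> + q\<^sup>2)"
proof -
  have "(norm (1 + of_real q * cis \<theta>))\<^sup>2 = (1 + q * cos \<theta>)\<^sup>2 + (q * sin \<theta>)\<^sup>2"
    unfolding cmod_power2 by simp
  also have "\<dots> = 1 + 2 * q * cos \<theta> + q\<^sup>2 * ((sin \<theta>)\<^sup>2 + (cos \<theta>)\<^sup>2)" by algebra
  finally have "(norm (1 + of_real q * cis \<theta>))\<^sup>2 = 1 + 2 * q * cos \<theta> + q\<^sup>2" unfolding sin_cos_squared_add by simp
  thus ?thesis by (metis norm_ge_zero real_sqrt_unique)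
qed

lemma norm_one_plus_cis_pos:
  fixes q \<theta> :: real
  assumes "\<bar>q\<bar> < 1" shows "norm (1 + of_real q * cis \<theta>) > 0"
proof -
  have "norm (of_real q * cis \<theta>) < 1" using assms by (simp add: norm_mult)
  hence "1 + of_real q * cis \<theta> \<noteq> 0" by (metis add_eq_0_iff2 norm_minus_cancel norm_one less_irrefl)
  thus ?thesis by simp
qed

lemma norm_one_plus_cis_mono:
  fixes q x y :: real
  assumes "0 \<le> x" "x \<le> y" "y \<le> pi"
  shows "q \<ge> 0 \<Longrightarrow> norm (1 + of_real q * cis y) \<le> norm (1 + of_real q * cis x)"
    "q \<le> 0 \<Longrightarrow> norm (1 + of_real q * cis x) \<le> norm (1 + of_real q * cis y)"
proof -
  have "cos y \<le> cos x" using assms by (intro cos_monotone_0_pi_le) auto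
  thus "q \<ge> 0 \<Longrightarrow> norm (1 + of_real q * cis y) \<le> norm (1 + of_real q * cis x)"
    "q \<le> 0 \<Longrightarrow> norm (1 + of_real q * cis x) \<le> norm (1 + of_real q * cis y)"
    unfolding norm_one_plus_cis by (auto simp: mult_left_mono mult_left_mono_neg)
qed

lemma norm_one_plus_cis_abs:
  fixes q t :: real
  shows "norm (1 + of_real q * cis \<bar>t - pi\<bar>) = norm (1 - of_real q * cis t)"
proof -
  have "cos \<bar>t - pi\<bar> = - cos t" by (simp add: abs_if cos_diff)
  thus ?thesis using norm_one_plus_cis[of q "\<bar>t - pi\<bar>"] norm_one_plus_cis[of "-q" t] by simp
qed

text \<open>A shift by half a period. It undoes the reflection that centres the majorants at
  pi.\<close>

lemma integral_circle_antipodal: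
  fixes G :: "complex \<Rightarrow> real"
  assumes G: "continuous_on (sphere 0 r) G" and r: "r \<ge> 0"
  shows "integral {0..2*pi} (\<lambda>t. G (- (of_real r * cis t))) = integral {0..2*pi} (\<lambda>t. G (of_real r * cis t))"
proof -
  define K where "K t = G (of_real r * cis t)" for t
  have cK: "continuous_on A K" for A unfolding K_def
    using r by (intro continuous_on_compose2[OF G]) (auto intro!: continuous_intros simp: norm_mult)
  have int: "K integrable_on {x..y}" for x y by (intro integrable_continuous_interval cK)
  have per: "K (t + 2 * pi) = K t" for t by (simp add: K_def flip: cis_mult)
  have "integral {0..2*pi} (\<lambda>t. G (- (of_real r * cis t))) = integral {0..2*pi} (K \<circ> (+) pi)"
    by (rule integral_cong) (simp add: K_def flip: cis_mult)
  also have "\<dots> = integral {pi..3 * pi} K" by (subst integral_shift_Icc_real) (simp add: algebra_simps)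
  also have "\<dots> = integral {pi..2*pi} K + integral {2*pi..3*pi} K"
    using Henstock_Kurzweil_Integration.integral_combine[of pi "2*pi" "3*pi" K] int by simp
  also have "integral {2*pi..3*pi} K = integral {0..pi} (K \<circ> (+) (2*pi))"
    by (subst integral_shift_Icc_real) (simp add: algebra_simps)
  also have "\<dots> = integral {0..pi} K" by (rule integral_cong) (simp add: per add.commute[of "2*pi"])
  also have "integral {pi..2*pi} K + integral {0..pi} K = integral {0..2*pi} K"
    using Henstock_Kurzweil_Integration.integral_combine[of 0 pi "2*pi" K] int by simp
  finally show ?thesis by (simp add: K_def[abs_def])
qed

definition schwarz_function :: "(complex \<Rightarrow> complex) \<Rightarrow> bool" where
  "schwarz_function \<phi> \<longleftrightarrow> \<phi> holomorphic_on ball 0 1 \<and> \<phi> 0 = 0 \<and> (\<forall>z. norm z < 1 \<longrightarrow> norm (\<phi> z) \<le> 1)"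

text \<open>With all four functions equal to the identity the quotient is |H_k(-z)|. The logarithm
  of each factor is the real part of a holomorphic branch, since 1 - z, 1 + z and 1 + k z stay in
  the right half-plane.\<close>

lemma integral_schwarz_product_le:
  fixes r k p :: real and w0 w1 w2 w3 :: "complex \<Rightarrow> complex"
  assumes r: "0 < r" "r < 1" and k: "0 \<le> k" "k \<le> 1" and p: "0 \<le> p"
    and w: "schwarz_function w0" "schwarz_function w1" "schwarz_function w2" "schwarz_function w3"
  shows "integral {0..2*pi} (\<lambda>t. (norm (1 - w0 (r * cis t)) / (norm (1 + w1 (r * cis t)) *
             norm (1 + w2 (r * cis t)) * norm (1 + of_real k * w3 (r * cis t)))) powr p)
       \<le> integral {0..2*pi} (\<lambda>t. norm (H_ext k (r * cis t)) powr p)"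
proof -
  \<comment> \<open>The functions are reflected at the origin so that the symmetry axis of the majorants is the midpoint
      \<open>pi\<close> of the interval of integration.\<close>
  define L where "L j z = (if j = 0 then Ln (1 - z) else if j = 3 then - Ln (1 + of_real k * z) else - Ln (1 + z))"
    for j :: nat and z :: complex
  define W where "W j = (if j = 0 then w0 else if j = 1 then w1 else if j = 2 then w2 else w3)" for j :: nat
  \<comment> \<open>The signs make each \<open>V j\<close> decreasing on {0..pi}: r > 0 in the
    numerator, -r and -(k * r) in the denominator.\<close>
  define V where "V j x = (if j = 0 then ln (norm (1 + of_real r * cis x))
      else if j = 3 then - ln (norm (1 + of_real (- (k * r)) * cis x)) else - ln (norm (1 + of_real (- r) * cis x)))" for j :: nat and x
  define q where "q z0 z1 z2 z3 = norm (1 - z0) / (norm (1 + z1) * norm (1 + z2) * norm (1 + of_real k * z3))"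
    for z0 z1 z2 z3 :: complex
  have W: "schwarz_function (W j)" for j using w by (simp add: W_def)
  have Re1: "Re (1 + z) > 0" if "norm z < 1" for z using that abs_Re_le_cmod[of z] by (simp add: abs_le_iff)
  have nk: "norm (of_real k * z) < 1" if "norm z < 1" for z :: complex
    using that k mult_left_le_one_le[of "norm z" k] by (simp add: norm_mult)
  have pos: "Re (1 - z) > 0" "Re (1 + z) > 0" "Re (1 + of_real k * z) > 0" if "norm z < 1" for z
    using Re1[of "-z"] Re1[of z] Re1[OF nk[OF that]] that by auto
  have holL: "L j holomorphic_on ball 0 1" for j
  proof -
    have np: "z \<notin> \<real>\<^sub>\<le>\<^sub>0" if "Re z > 0" for z using that complex_nonpos_Reals_iff by auto
    have "(\<lambda>z. Ln (1 - z)) holomorphic_on ball 0 1" "(\<lambda>z. - Ln (1 + z)) holomorphic_on ball 0 1"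
      "(\<lambda>z. - Ln (1 + of_real k * z)) holomorphic_on ball 0 1"
      by (intro holomorphic_intros np pos; simp)+
    thus ?thesis unfolding L_def by (cases "j = 0"; cases "j = 3"; simp)
  qed
  have sumL: "(\<Sum>j\<in>{0,1,2,3}. Re (L j (z j))) = ln (q (z 0) (z 1) (z 2) (z 3)) \<and> q (z 0) (z 1) (z 2) (z 3) > 0"
    if z: "\<And>j. norm (z j) < 1" for z :: "nat \<Rightarrow> complex"
  proof -
    have nz: "1 - z 0 \<noteq> 0" "1 + z 1 \<noteq> 0" "1 + z 2 \<noteq> 0" "1 + of_real k * z 3 \<noteq> 0"
      using pos[OF z] by (metis less_irrefl zero_complex.simps(1))+
    thus ?thesis unfolding L_def q_def by (simp add: ln_div ln_mult)
  qed
  have LV: "Re (L j (r * cis t)) = V j \<bar>t - pi\<bar>" for j t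
  proof -
    have n: "norm (of_real r * cis t) < 1" using r by (simp add: norm_mult)
    have nz: "1 - of_real r * cis t \<noteq> 0" "1 + of_real r * cis t \<noteq> 0" "1 + of_real k * (of_real r * cis t) \<noteq> 0"
      using pos[OF n] by (metis less_irrefl zero_complex.simps(1))+
    thus ?thesis unfolding L_def V_def norm_one_plus_cis_abs by (simp add: mult.assoc)
  qed
  have kr: "\<bar>r\<bar> < 1" "\<bar>- r\<bar> < 1" "\<bar>- (k * r)\<bar> < 1"
  proof -
    have "k * r \<le> r" using k r by (intro mult_left_le_one_le) auto
    moreover have "\<bar>- (k * r)\<bar> = k * r" using k r by simp
    ultimately show "\<bar>r\<bar> < 1" "\<bar>- r\<bar> < 1" "\<bar>- (k * r)\<bar> < 1" using r by linarith+
  qed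
  have nr: "norm (of_real r * cis t) < 1" for t using r by (simp add: norm_mult)
  have nW: "norm (W j (r * cis t)) < 1" for j t
    using W[of j] Schwarz_bound[of "W j" "r * cis t"] nr[of t] unfolding schwarz_function_def by (meson order_le_less_trans)
  have main: "integral {0..2*pi} (\<lambda>t. exp (p * (\<Sum>j\<in>{0,1,2,3}. Re (L j (W j (r * cis t))))))
       \<le> integral {0..2*pi} (\<lambda>t. exp (p * (\<Sum>j\<in>{0,1,2,3}. V j \<bar>t - pi\<bar>)))"
  proof (rule integral_exp_subordinate_le[OF holL])
    fix j :: nat
    show "W j holomorphic_on ball 0 1" "W j 0 = 0" using W[of j] by (auto simp: schwarz_function_def)
    show "norm (W j z) \<le> 1" if "norm z < 1" for z using W[of j] that by (auto simp: schwarz_function_def)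
    show "continuous_on {0..pi} (V j)"
    proof -
      have "continuous_on {0..pi} (\<lambda>x. ln (norm (1 + of_real s * cis x)))" if "\<bar>s\<bar> < 1" for s
        using norm_one_plus_cis_pos[OF that] by (intro continuous_intros) (metis less_irrefl)
      from this[OF kr(1)] this[OF kr(2)] this[OF kr(3)] show ?thesis
        unfolding V_def by (cases "j = 0"; cases "j = 3") (auto intro!: continuous_intros)
    qed
    fix x y :: real assume xy: "0 \<le> x" "x \<le> y" "y \<le> pi"
    have up: "ln (norm (1 + of_real s * cis x)) \<le> ln (norm (1 + of_real s * cis y))" if "\<bar>s\<bar> < 1" "s \<le> 0" for s
      using norm_one_plus_cis_mono(2)[OF xy that(2)] norm_one_plus_cis_pos[OF that(1)] by simp
    have down: "ln (norm (1 + of_real r * cis y)) \<le> ln (norm (1 + of_real r * cis x))"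
      using norm_one_plus_cis_mono(1)[OF xy, of r] norm_one_plus_cis_pos[OF kr(1)] r by simp
    show "V j y \<le> V j x"
      unfolding V_def using up[OF kr(2)] up[OF kr(3)] down r k by simp
  qed (use r p LV in auto)
  have e1: "exp (p * (\<Sum>j\<in>{0,1,2,3}. Re (L j (W j (r * cis t)))))
     = q (w0 (r * cis t)) (w1 (r * cis t)) (w2 (r * cis t)) (w3 (r * cis t)) powr p" for t
    using sumL[of "\<lambda>j. W j (r * cis t)", OF nW] by (simp add: powr_def W_def)
  have e2: "exp (p * (\<Sum>j\<in>{0,1,2,3}. V j \<bar>t - pi\<bar>)) = norm (H_ext k (- (r * cis t))) powr p" for t
  proof -
    have "(\<Sum>j\<in>{0,1,2,3}. V j \<bar>t - pi\<bar>) = (\<Sum>j\<in>{0,1,2,3}. Re (L j (r * cis t)))" by (simp only: LV)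
    hence "exp (p * (\<Sum>j\<in>{0,1,2,3}. V j \<bar>t - pi\<bar>)) = q (r * cis t) (r * cis t) (r * cis t) (r * cis t) powr p"
      using sumL[of "\<lambda>j. r * cis t", OF nr] by (simp add: powr_def)
    also have "q (r * cis t) (r * cis t) (r * cis t) (r * cis t) = norm (H_ext k (- (r * cis t)))"
      by (simp add: q_def H_ext_def norm_divide norm_mult norm_power power2_eq_square)
    finally show ?thesis .
  qed
  have "integral {0..2*pi} (\<lambda>t. norm (H_ext k (- (r * cis t))) powr p) = integral {0..2*pi} (\<lambda>t. norm (H_ext k (r * cis t)) powr p)"
  proof (rule integral_circle_antipodal)
    have nz: "1 - z \<noteq> 0" "1 + z \<noteq> 0" "1 - of_real k * z \<noteq> 0" if "norm z < 1" for z :: complex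
      using pos[OF that] pos[of "-z"] that by (auto simp: complex_eq_iff)
    show "continuous_on (sphere 0 r) (\<lambda>z. norm (H_ext k z) powr p)"
      unfolding H_ext_def using nz r by (intro continuous_intros) auto
  qed (use r in auto)
  thus ?thesis using main unfolding e1 e2 q_def by simp
qed

context convex_harm
begin

text \<open>Multiplying the half-plane expression by -\<i> gives \<open>P\<close> with nonnegative
  real part and |P 0| = |c a| = 1. Taking c h' and \<open>a\<close> out of its two brackets leaves 1
  - (cnj c)^2 \<omega> and 1 - (cnj a)^2 z^2; solving for |h'| gives the formula.\<close>

lemma deriv_h_factorization:
  assumes h0: "deriv h 0 = 1" and g0: "deriv g 0 = 0" and nz: "\<And>z. norm z < 1 \<Longrightarrow> deriv h z \<noteq> 0"
  obtains w0 w1 w2 w3 where "schwarz_function w0" "schwarz_function w1" "schwarz_function w2" "schwarz_function w3"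
    "\<And>z. norm z < 1 \<Longrightarrow> norm (deriv h z)
        = norm (1 - w0 z) / (norm (1 + w1 z) * norm (1 + w2 z) * norm (1 + of_real k * w3 z))"
proof -
  obtain c a where ca: "norm c = 1" "norm a = 1"
    and im: "\<And>z. z \<in> ball 0 1 \<Longrightarrow> Im ((c * deriv h z - cnj c * deriv g z) * (a - cnj a * z\<^sup>2)) \<ge> 0"
    using half_plane_condition by blast
  have cc: "c * cnj c = 1" "a * cnj a = 1" using ca by (metis complex_norm_square of_real_1 one_power2)+
  have hol: "deriv h holomorphic_on ball 0 1" "deriv g holomorphic_on ball 0 1"
    using hol_h hol_g by (auto intro: holomorphic_deriv)
  define P where "P z = -\<i> * ((c * deriv h z - cnj c * deriv g z) * (a - cnj a * z\<^sup>2))" for z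
  have "P holomorphic_on ball 0 1" unfolding P_def by (intro holomorphic_intros hol)
  moreover have "Re (P z) \<ge> 0" if "norm z < 1" for z
    using im[of z] that unfolding P_def by (simp only: mem_ball_0) simp
  moreover have "norm (P 0) = 1" using ca by (simp add: P_def h0 g0 norm_mult)
  ultimately obtain \<phi> \<epsilon> where \<phi>: "\<phi> holomorphic_on ball 0 1" "\<phi> 0 = 0" "\<And>z. norm z < 1 \<Longrightarrow> norm (\<phi> z) \<le> 1" "norm \<epsilon> = 1"
    "\<And>z. norm z < 1 \<Longrightarrow> norm (P z) * norm (1 - \<phi> z) = norm (1 + \<epsilon> * \<phi> z)"
    using positive_real_part_subordination[of P] by blast
  define \<omega> where "\<omega> z = deriv g z / deriv h z" for z
  have hol\<omega>: "\<omega> holomorphic_on ball 0 1" unfolding \<omega>_def using nz by (intro holomorphic_intros hol) auto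
  have n\<omega>: "norm (\<omega> z) \<le> k" if "norm z < 1" for z
    using dil[of z] nz[OF that] that by (simp add: \<omega>_def norm_divide divide_le_eq)
  \<comment> \<open>For k = 0 the dilatation vanishes, and division by zero gives the right value
    0.\<close>
  define w3 where "w3 z = - (cnj c)\<^sup>2 * \<omega> z / of_real k" for z
  have kw3: "of_real k * w3 z = - (cnj c)\<^sup>2 * \<omega> z" if "norm z < 1" for z
    using n\<omega>[OF that] by (cases "k = 0") (auto simp: w3_def)
  have s3: "schwarz_function w3"
    unfolding schwarz_function_def
  proof (intro conjI allI impI)
    show "w3 holomorphic_on ball 0 1"
      unfolding w3_def[abs_def] by (cases "k = 0") (auto intro!: holomorphic_intros hol\<omega>)
    show "w3 0 = 0" by (simp add: w3_def \<omega>_def g0)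
    show "norm (w3 z) \<le> 1" if "norm z < 1" for z
      using n\<omega>[OF that] ca k01 by (cases "k = 0") (auto simp: w3_def norm_mult norm_divide norm_power divide_le_eq)
  qed
  \<comment> \<open>The two factors 1 - z in the denominator of \<open>H_ext\<close> account for
    this quadratic term and for 1 - \<phi>.\<close>
  have s2: "schwarz_function (\<lambda>z. - ((cnj a)\<^sup>2 * z\<^sup>2))"
    using ca by (auto simp: schwarz_function_def norm_mult norm_power power_le_one intro!: holomorphic_intros)
  have s1: "schwarz_function (\<lambda>z. - \<phi> z)" and s0: "schwarz_function (\<lambda>z. - (\<epsilon> * \<phi> z))"
    using \<phi> by (auto simp: schwarz_function_def norm_mult intro!: holomorphic_intros)
  have fac: "norm (deriv h z) = norm (1 - - (\<epsilon> * \<phi> z)) / (norm (1 + - \<phi> z) * norm (1 + - ((cnj a)\<^sup>2 * z\<^sup>2)) * norm (1 + of_real k * w3 z))"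
    if z: "norm z < 1" for z
  proof -
    have "c * deriv h z * (1 + of_real k * w3 z) = c * deriv h z - (c * cnj c) * cnj c * (\<omega> z * deriv h z)"
      unfolding kw3[OF z] by (simp add: power2_eq_square algebra_simps)
    also have "\<dots> = c * deriv h z - cnj c * deriv g z" using nz[OF z] by (simp add: cc \<omega>_def)
    finally have f1: "c * deriv h z - cnj c * deriv g z = c * deriv h z * (1 + of_real k * w3 z)" by simp
    have "a * (1 + - ((cnj a)\<^sup>2 * z\<^sup>2)) = a - (a * cnj a) * cnj a * z\<^sup>2" by (simp add: power2_eq_square algebra_simps)
    hence f2: "a - cnj a * z\<^sup>2 = a * (1 + - ((cnj a)\<^sup>2 * z\<^sup>2))" by (simp add: cc)
    have nP: "norm (P z) = norm (deriv h z) * norm (1 + of_real k * w3 z) * norm (1 + - ((cnj a)\<^sup>2 * z\<^sup>2))"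
      unfolding P_def f1 f2 norm_mult using ca by simp
    have ne: "1 + w z \<noteq> 0" if "schwarz_function w" for w
    proof -
      have "norm (w z) < 1" using that Schwarz_bound[of w z] z unfolding schwarz_function_def by force
      thus ?thesis by (metis add_eq_0_iff2 norm_minus_cancel norm_one less_irrefl)
    qed
    have "norm (of_real k * w3 z) \<le> norm (w3 z)" using k01 by (simp add: norm_mult mult_left_le_one_le)
    also have "\<dots> < 1" using s3 Schwarz_bound[of w3 z] z unfolding schwarz_function_def by force
    finally have "1 + of_real k * w3 z \<noteq> 0" by (metis add_eq_0_iff2 norm_minus_cancel norm_one less_irrefl)
    moreover have "1 + - ((cnj a)\<^sup>2 * z\<^sup>2) \<noteq> 0" "1 + - \<phi> z \<noteq> 0" using ne[OF s2] ne[OF s1] by auto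
    moreover have "norm (P z) * norm (1 + - \<phi> z) = norm (1 - - (\<epsilon> * \<phi> z))" using \<phi>(5)[OF z] by simp
    ultimately show ?thesis unfolding nP by (simp add: eq_divide_eq mult_ac)
  qed
  show ?thesis using that[OF s0 s1 s2 s3] fac by blast
qed

lemma integral_deriv_h_le:
  assumes "deriv h 0 = 1" "deriv g 0 = 0" "\<And>z. norm z < 1 \<Longrightarrow> deriv h z \<noteq> 0" "0 < r" "r < 1" "0 \<le> p"
  shows "integral {0..2*pi} (\<lambda>t. norm (deriv h (of_real r * cis t)) powr p)
       \<le> integral {0..2*pi} (\<lambda>t. norm (H_ext k (of_real r * cis t)) powr p)"
proof -
  obtain w0 w1 w2 w3 where w: "schwarz_function w0" "schwarz_function w1" "schwarz_function w2" "schwarz_function w3"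
    "\<And>z. norm z < 1 \<Longrightarrow> norm (deriv h z)
        = norm (1 - w0 z) / (norm (1 + w1 z) * norm (1 + w2 z) * norm (1 + of_real k * w3 z))"
    using deriv_h_factorization[OF assms(1-3)] by blast
  have "norm (of_real r * cis t) < 1" for t using assms by (simp add: norm_mult)
  from w(5)[OF this] show ?thesis
    using integral_schwarz_product_le[OF assms(4,5) k01(1) less_imp_le[OF k01(2)] assms(6) w(1-4)] by simp
qed

end

text \<open>Passes from gauge integrals, used throughout, to the Lebesgue integral in
  \<open>Mp\<close>; they agree for continuous integrands.\<close>

lemma Mp_mono:
  assumes p: "p > 0" and F: "continuous_on (sphere 0 r) F" "continuous_on (sphere 0 r) G" and r: "r \<ge> 0"
    and le: "integral {0..2*pi} (\<lambda>t. norm (F (of_real r * cis t)) powr p) \<le> integral {0..2*pi} (\<lambda>t. norm (G (of_real r * cis t)) powr p)"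
  shows "Mp p r F \<le> Mp p r G"
proof -
  have c: "continuous_on A (\<lambda>t. norm (F (of_real r * cis t)) powr p)" if "continuous_on (sphere 0 r) F" for F :: "complex \<Rightarrow> complex" and A
    using p r by (intro continuous_on_powr' continuous_intros continuous_on_compose2[OF that]) (auto simp: norm_mult)
  have eq: "(LINT t:{0..2*pi}|lborel. norm (F (of_real r * cis t)) powr p) = integral {0..2*pi} (\<lambda>t. norm (F (of_real r * cis t)) powr p)"
    if "continuous_on (sphere 0 r) F" for F :: "complex \<Rightarrow> complex"
    by (intro set_borel_integral_eq_integral borel_integrable_atLeastAtMost' c that)
  have "integral {0..2*pi} (\<lambda>t. norm (F (of_real r * cis t)) powr p) \<ge> 0"
    by (intro integral_nonneg integrable_continuous_interval c F) auto
  thus ?thesis unfolding Mp_def eq[OF F(1)] eq[OF F(2)] using p le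
    by (intro powr_mono2 mult_left_mono) auto
qed

theorem theorem1:
  fixes K p r :: real and h g :: "complex \<Rightarrow> complex"
  assumes "K \<ge> 1" and "0 < p"
    and "K_H0 h g" and "qc_harmonic K h g"
    and "0 < r" and "r < 1"
  shows "Mp p r (deriv h) \<le> Mp p r (H_ext ((K - 1) / (K + 1))) \<and>
         Mp p r (deriv g) \<le> Mp p r (G_ext ((K - 1) / (K + 1)))"
proof -
  define k where "k = (K - 1) / (K + 1)"
  have k: "0 \<le> k" "k < 1" using assms(1) by (auto simp: k_def)
  note D = K_H0_def S_H0_def S_H_def sense_preserving_def qc_harmonic_def
  have hol: "h holomorphic_on ball 0 1" "g holomorphic_on ball 0 1" and h0: "deriv h 0 = 1" and g0: "deriv g 0 = 0"
    and z0: "h 0 = 0" "g 0 = 0" and inj: "inj_on (harm h g) (ball 0 1)" and cvx: "convex (harm h g ` ball 0 1)"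
    using assms(3) by (auto simp: D)
  have nz: "deriv h z \<noteq> 0" if "norm z < 1" for z
  proof -
    have "norm (deriv g z) < norm (deriv h z)" using assms(3) that by (auto simp: D)
    thus ?thesis by auto
  qed
  have dilat: "norm (deriv g z / deriv h z) \<le> k" if "norm z < 1" for z using assms(4) that by (auto simp: D k_def)
  interpret convex_harm h g k
  proof
    show "norm (deriv g z) \<le> k * norm (deriv h z)" if "z \<in> ball 0 1" for z
      using dilat[of z] nz[of z] that by (simp add: norm_divide divide_le_eq)
  qed (use hol inj cvx z0 k in \<open>auto simp: harm_def\<close>)
  have main: "integral {0..2*pi} (\<lambda>t. norm (deriv h (of_real r * cis t)) powr p)
       \<le> integral {0..2*pi} (\<lambda>t. norm (H_ext k (of_real r * cis t)) powr p)"
    using integral_deriv_h_le[OF h0 g0 nz assms(5,6)] assms(2) by simp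
  have cd: "continuous_on (sphere 0 r) (deriv h)" "continuous_on (sphere 0 r) (deriv g)"
    using hol assms(6) by (auto intro!: holomorphic_on_imp_continuous_on holomorphic_on_subset[OF holomorphic_deriv[of _ "ball 0 1"]])
  have ne: "1 - z \<noteq> 0" "1 - of_real k * z \<noteq> 0" if "norm z = r" for z :: complex
  proof -
    have "norm (of_real k * z) \<le> norm z" using k by (simp add: norm_mult mult_left_le_one_le)
    hence "norm (of_real k * z) < 1" "norm z < 1" using that assms(6) by auto
    thus "1 - z \<noteq> 0" "1 - of_real k * z \<noteq> 0" by auto
  qed
  have cH: "continuous_on (sphere 0 r) (H_ext k)" "continuous_on (sphere 0 r) (G_ext k)"
    unfolding H_ext_def[abs_def] G_ext_def[abs_def] using ne by (auto intro!: continuous_intros)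
  have nr: "norm (of_real r * cis t) = r" for t using assms(5) by (simp add: norm_mult)
  have Gw: "norm (deriv g (of_real r * cis t)) powr p \<le> (k * r) powr p * norm (deriv h (of_real r * cis t)) powr p" for t
  proof -
    define z where "z = of_real r * cis t"
    have z: "norm z = r" "norm z < 1" using nr[of t] assms(6) by (auto simp: z_def)
    have "norm (deriv g z) \<le> k * r * norm (deriv h z)"
    \<comment> \<open>For k > 0 the quotient \<omega> / k vanishes at 0 because
      \<open>deriv g 0 = 0\<close>, so Schwarz's lemma supplies the factor \<open>r\<close>; for k =
      0 the dilatation is zero.\<close>
    proof (cases "k = 0")
      case True
      thus ?thesis using dilat[OF z(2)] nz[OF z(2)] by simp
    next
      case False
      have "norm (deriv g z / deriv h z / of_real k) \<le> norm z"
      proof (rule Schwarz_bound[OF _ _ _ z(2)])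
        show "(\<lambda>z. deriv g z / deriv h z / of_real k) holomorphic_on ball 0 1"
          using nz False hol by (intro holomorphic_intros holomorphic_deriv) auto
        show "norm (deriv g z / deriv h z / of_real k) \<le> 1" if "norm z < 1" for z
        proof -
          have "x / k \<le> 1" if "x \<le> k" for x using that k False by (simp add: divide_le_eq)
          from this[OF dilat[OF that]] show ?thesis
            by (simp only: norm_divide[of _ "of_real k"] norm_of_real abs_of_nonneg[OF k(1)])
        qed
      qed (simp add: g0)
      thus ?thesis using k False nz[OF z(2)] z(1) by (simp add: norm_divide norm_mult divide_le_eq mult_ac)
    qed
    hence "norm (deriv g z) powr p \<le> (k * r * norm (deriv h z)) powr p" using assms(2) by (intro powr_mono2) auto
    also have "\<dots> = (k * r) powr p * norm (deriv h z) powr p" by (rule powr_mult)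
    finally show ?thesis unfolding z_def .
  qed
  have int: "(\<lambda>t. norm (F (of_real r * cis t)) powr p) integrable_on {0..2*pi}" if "continuous_on (sphere 0 r) F" for F :: "complex \<Rightarrow> complex"
    using assms(2) nr by (intro integrable_continuous_interval continuous_on_powr' continuous_intros continuous_on_compose2[OF that]) auto
  have "integral {0..2*pi} (\<lambda>t. norm (deriv g (of_real r * cis t)) powr p)
      \<le> integral {0..2*pi} (\<lambda>t. (k * r) powr p * norm (deriv h (of_real r * cis t)) powr p)"
    using Gw by (intro integral_le int cd integrable_on_mult_right) auto
  also have "\<dots> = (k * r) powr p * integral {0..2*pi} (\<lambda>t. norm (deriv h (of_real r * cis t)) powr p)" by simp
  also have "\<dots> \<le> (k * r) powr p * integral {0..2*pi} (\<lambda>t. norm (H_ext k (of_real r * cis t)) powr p)"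
    using main by (rule mult_left_mono) simp
  also have "\<dots> = integral {0..2*pi} (\<lambda>t. (k * r) powr p * norm (H_ext k (of_real r * cis t)) powr p)" by simp
  \<comment> \<open>On the circle |G_k| = k r |H_k| holds exactly, so the bound on
    \<open>deriv g\<close> becomes an equality for the extremal pair.\<close>
  also have "\<dots> = integral {0..2*pi} (\<lambda>t. norm (G_ext k (of_real r * cis t)) powr p)"
  proof (rule integral_cong)
    fix t
    have "G_ext k (of_real r * cis t) = of_real k * (of_real r * cis t) * H_ext k (of_real r * cis t)"
      by (simp add: G_ext_def H_ext_def)
    hence "norm (G_ext k (of_real r * cis t)) = k * r * norm (H_ext k (of_real r * cis t))"
      using k nr[of t] by (simp only: norm_mult[of _ "H_ext k _"] norm_mult[of "of_real k"] norm_of_real abs_of_nonneg)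
    thus "(k * r) powr p * norm (H_ext k (of_real r * cis t)) powr p = norm (G_ext k (of_real r * cis t)) powr p"
      using k assms(5) by (simp add: powr_mult)
  qed
  finally have "Mp p r (deriv g) \<le> Mp p r (G_ext k)" using assms(2,5) by (intro Mp_mono cd cH) auto
  moreover have "Mp p r (deriv h) \<le> Mp p r (H_ext k)" using assms(2,5) main by (intro Mp_mono cd cH) auto
  ultimately show ?thesis by (simp add: k_def)
qed

end
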